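(* Let $G\in\mathcal{C}$, $N\unlhd G$, and $(H,H,\vartheta)\in\mathcal{L}_N$ of height $n$ with $i$-th node $(H_i,A_i,\vartheta_i)$, $1\le i\le n$. Let $K=\ker\vartheta$, $k=[H:K]$ and $\xi_k$ a primitive $k$-th root of unity. Then $\mathbb{Q}Ge_{\mathbb{Q}}(\vartheta^G)$ is isomorphic to $$M_{k_1}\Big(M_{k_2}\cdots\Big(M_{k_{n-1}}\big(\mathbb{Q}(\xi_k)\ast^{\sigma_{n-1}}_{\tau_{n-1}}N_{H_{n-1}}(K)/H\big)\ast^{\sigma_{n-2}}_{\tau_{n-2}}\cdots\Big)\ast^{\sigma_1}_{\tau_1}\operatorname{Cen}_{H_1}(e(H_2,H,K))/H_2\Big),$$ with $k_i,\sigma_i,\tau_i$ as described in the context.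
   Context: All groups are finite. $\mathcal{C}$ is the class of finite groups $G$ such that every subgroup and every quotient group of $G$ is either abelian or contains a non-central abelian normal subgroup. For $\chi\in\operatorname{Irr}M$, $e_{\mathbb{Q}}(\chi)=\frac{\chi(1)}{|M|}\sum_{\sigma\in\operatorname{Gal}(\mathbb{Q}(\chi)/\mathbb{Q})}\sum_{g\in M}\sigma(\chi(g))g^{-1}$. For $K\unlhd H\le M$: $\widehat H=\frac1{|H|}\sum_{h\in H}h$; $\varepsilon(H,K)=\widehat K$ if $H=K$, else $\prod(\widehat K-\widehat L)$ over $L\unlhd H$ with $L/K$ minimal normal in $H/K$; $e(M,H,K)$ = sum of distinct $M$-conjugates of $\varepsilon(H,K)$. $\psi^x(g)=\psi(xgx^{-1})$, $\psi^G$ induced character, $1_N$ trivial character. Fix $N\unlhd G$. An $N$-linear character triple is $(H,A,\vartheta)$ with $H\le G$, $A\unlhd H$, $\vartheta$ linear on $A$, invariant in $H$, $\ker(\vartheta^G)=N$. For $B\unlhd M\le G$, linear $\lambda$ on $B$, $\widetilde{\operatorname{Lin}}(M|\lambda)$ = linear characters of $M$ whose restriction to $B$ contains $\lambda$ and whose induction to $G$ has kernel $N$. For each triple a normal subgroup $\mathcal{A}=\mathcal{A}_{(H,A,\vartheta)}$ of $H$ is fixed, of maximal order among normal subgroups of $H$ containing $\ker\vartheta$ with abelian quotient by $\ker\vartheta$. $\operatorname{Aut}(\mathbb{C}|\vartheta)\times H$ acts on $\widetilde{\operatorname{Lin}}(\mathcal{A}|\vartheta)$ by $(\sigma,h)\cdot\varphi=\sigma\circ\varphi^h$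 ($\sigma$ a field automorphism of $\mathbb{C}$ fixing $\mathbb{Q}(\vartheta)$); fix orbit representatives $\mathfrak{Lin}(\mathcal{A}|\vartheta)$. If $H\ne A$, $Cl(H,A,\vartheta)=\{(I_H(\varphi),\mathcal{A},\varphi):\varphi\in\mathfrak{Lin}(\mathcal{A}|\vartheta)\}$, $I_H(\varphi)=\{h\in H:\varphi^h=\varphi\}$; if $H=A$, empty. $\mathcal{G}_N$: directed graph of $N$-linear triples reachable from $(G,N,1_N)$, edges $(u,v)$ when $v\in Cl(u)$; each vertex is reached by a unique directed path from the root. $\mathcal{L}_N$: vertices of the form $(H,H,\vartheta)$; for such a leaf with path $v_1=(G,N,1_N),\dots,v_n=(H,H,\vartheta)$, $n$ is its height and $v_i=(H_i,A_i,\vartheta_i)$ its $i$-th node. Crossed products: for a ring $R$, a group $Q$, an action $\sigma:Q\to\operatorname{Aut}(R)$ and twisting $\tau:Q\times Q\to\mathcal{U}(R)$, $R\ast^\sigma_\tau Q$ is the free $R$-module on $\{u_q:q\in Q\}$ with $u_q r=\sigma(q)(r)u_q$ and $u_qu_{q'}=\tau(q,q')u_{qq'}$. For $1\le i\le n-1$ let $C_i=\operatorname{Cen}_{H_i}(e(H_{i+1},H,K))$ $(=\operatorname{Cen}_{H_i}(e_{\mathbb{Q}}(\vartheta^{H_{i+1}})))$, so $C_{n-1}=N_{H_{n-1}}(K)$, and $k_i=[H_i:C_i]$. Fix representatives in $C_i$ of the cosets of $H_{i+1}$; $\sigma_i$ is the action of $C_i/H_{i+1}$ on $\mathbb{Q}H_{i+1}e_{\mathbb{Q}}(\vartheta^{H_{i+1}})$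 in which $\bar x$ acts by conjugation by its representative, and $\tau_i(\bar g_1,\bar g_2)=g\,e_{\mathbb{Q}}(\vartheta^{H_{i+1}})$ where $g\in H_{i+1}$ satisfies (rep. of $\bar g_1$)(rep. of $\bar g_2$) $=g\cdot$(rep. of $\bar g_1\bar g_2$). Here $\mathbb{Q}H_ne_{\mathbb{Q}}(\vartheta^{H_n})=\mathbb{Q}H\varepsilon(H,K)\cong\mathbb{Q}(\xi_k)$, and recursively $\mathbb{Q}H_ie_{\mathbb{Q}}(\vartheta^{H_i})$ is identified with $R_i=M_{k_i}(R_{i+1}\ast^{\sigma_i}_{\tau_i}C_i/H_{i+1})$ (with $R_n=\mathbb{Q}(\xi_k)$); $\sigma_i,\tau_i$ are transported to $R_{i+1}$ through this identification and denoted by the same symbols. *)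

theory Defs
  imports Complex_Main "HOL-Algebra.QuotRing"
begin

definition center_of :: "('a,'b) monoid_scheme \<Rightarrow> 'a set" where
  "center_of Y = {z \<in> carrier Y. \<forall>x \<in> carrier Y. z \<otimes>\<^bsub>Y\<^esub> x = x \<otimes>\<^bsub>Y\<^esub> z}"

definition ab_or_ncan :: "('a,'b) monoid_scheme \<Rightarrow> bool" where
  "ab_or_ncan Y \<longleftrightarrow> comm_group Y \<or>
     (\<exists>A. normal A Y \<and> comm_group (Y\<lparr>carrier := A\<rparr>) \<and> \<not> A \<subseteq> center_of Y)"

definition class_C :: "('g,'b) monoid_scheme \<Rightarrow> bool" where
  "class_C G \<longleftrightarrow> group G \<and> finite (carrier G) \<and>
     (\<forall>H. subgroup H G \<longrightarrow> ab_or_ncan (G\<lparr>carrier := H\<rparr>)) \<and>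
     (\<forall>M. normal M G \<longrightarrow> ab_or_ncan (G Mod M))"

definition lin_char :: "('g,'b) monoid_scheme \<Rightarrow> 'g set \<Rightarrow> ('g \<Rightarrow> complex) \<Rightarrow> bool" where
  "lin_char G A \<phi> \<longleftrightarrow> (\<forall>x\<in>A. \<forall>y\<in>A. \<phi> (x \<otimes>\<^bsub>G\<^esub> y) = \<phi> x * \<phi> y) \<and>
     (\<forall>x\<in>A. \<phi> x \<noteq> 0) \<and> (\<forall>x. x \<notin> A \<longrightarrow> \<phi> x = 0)"

definition conjc :: "('g,'b) monoid_scheme \<Rightarrow> ('g \<Rightarrow> complex) \<Rightarrow> 'g \<Rightarrow> ('g \<Rightarrow> complex)" where
  "conjc G \<psi> x = (\<lambda>g. if g \<in> carrier G then \<psi> (x \<otimes>\<^bsub>G\<^esub> g \<otimes>\<^bsub>G\<^esub> inv\<^bsub>G\<^esub> x) else 0)"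

text \<open>induced character from \<open>H\<close> to \<open>M\<close> (\<open>\<psi>\<close> vanishes outside \<open>H\<close>)\<close>
definition ind :: "('g,'b) monoid_scheme \<Rightarrow> 'g set \<Rightarrow> 'g set \<Rightarrow> ('g \<Rightarrow> complex) \<Rightarrow> ('g \<Rightarrow> complex)" where
  "ind G M H \<psi> = (\<lambda>g. if g \<in> M then (1 / of_nat (card H)) * (\<Sum>x\<in>M. \<psi> (x \<otimes>\<^bsub>G\<^esub> g \<otimes>\<^bsub>G\<^esub> inv\<^bsub>G\<^esub> x)) else 0)"

definition charker :: "('g,'b) monoid_scheme \<Rightarrow> 'g set \<Rightarrow> ('g \<Rightarrow> complex) \<Rightarrow> 'g set" where
  "charker G M \<chi> = {g \<in> M. \<chi> g = \<chi> \<one>\<^bsub>G\<^esub>}"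

definition one_char :: "'g set \<Rightarrow> ('g \<Rightarrow> complex)" where
  "one_char N = (\<lambda>g. if g \<in> N then 1 else 0)"

definition kerlin :: "'g set \<Rightarrow> ('g \<Rightarrow> complex) \<Rightarrow> 'g set" where
  "kerlin A \<theta> = {a \<in> A. \<theta> a = 1}"

type_synonym 'g triple = "'g set \<times> 'g set \<times> ('g \<Rightarrow> complex)"

definition NLT :: "('g,'b) monoid_scheme \<Rightarrow> 'g set \<Rightarrow> 'g triple \<Rightarrow> bool" where
  "NLT G N t \<longleftrightarrow> (case t of (H, A, \<theta>) \<Rightarrow>
     subgroup H G \<and> normal A (G\<lparr>carrier := H\<rparr>) \<and> lin_char G A \<theta> \<and>
     (\<forall>h\<in>H. conjc G \<theta> h = \<theta>) \<and>
     charker G (carrier G) (ind G (carrier G) A \<theta>) = N)"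

definition Lin_t :: "('g,'b) monoid_scheme \<Rightarrow> 'g set \<Rightarrow> 'g set \<Rightarrow> 'g set \<Rightarrow> ('g \<Rightarrow> complex) \<Rightarrow> ('g \<Rightarrow> complex) set" where
  "Lin_t G N B M lam = {\<phi>. lin_char G M \<phi> \<and> (\<forall>b\<in>B. \<phi> b = lam b) \<and>
     charker G (carrier G) (ind G (carrier G) M \<phi>) = N}"

definition A_cands :: "('g,'b) monoid_scheme \<Rightarrow> 'g triple \<Rightarrow> 'g set set" where
  "A_cands G t = (case t of (H, A, \<theta>) \<Rightarrow>
     {Y. normal Y (G\<lparr>carrier := H\<rparr>) \<and> kerlin A \<theta> \<subseteq> Y \<and>
         comm_group ((G\<lparr>carrier := Y\<rparr>) Mod kerlin A \<theta>)})"

definition valid_Afun :: "('g,'b) monoid_scheme \<Rightarrow> 'g set \<Rightarrow> ('g triple \<Rightarrow> 'g set) \<Rightarrow> bool" where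
  "valid_Afun G N Af \<longleftrightarrow> (\<forall>t. NLT G N t \<longrightarrow>
     Af t \<in> A_cands G t \<and> (\<forall>Y \<in> A_cands G t. card Y \<le> card (Af t)))"

definition autC_fix :: "'g set \<Rightarrow> ('g \<Rightarrow> complex) \<Rightarrow> (complex \<Rightarrow> complex) \<Rightarrow> bool" where
  "autC_fix A \<theta> \<sigma> \<longleftrightarrow> bij \<sigma> \<and> (\<forall>x y. \<sigma> (x + y) = \<sigma> x + \<sigma> y \<and> \<sigma> (x * y) = \<sigma> x * \<sigma> y) \<and>
     (\<forall>a\<in>A. \<sigma> (\<theta> a) = \<theta> a)"

definition same_orbit :: "('g,'b) monoid_scheme \<Rightarrow> 'g triple \<Rightarrow> ('g \<Rightarrow> complex) \<Rightarrow> ('g \<Rightarrow> complex) \<Rightarrow> bool" where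
  "same_orbit G t \<phi> \<psi> \<longleftrightarrow> (case t of (H, A, \<theta>) \<Rightarrow>
     (\<exists>\<sigma> h. autC_fix A \<theta> \<sigma> \<and> h \<in> H \<and> \<psi> = \<sigma> \<circ> conjc G \<phi> h))"

definition valid_Rep :: "('g,'b) monoid_scheme \<Rightarrow> 'g set \<Rightarrow> ('g triple \<Rightarrow> 'g set)
    \<Rightarrow> ('g triple \<Rightarrow> ('g \<Rightarrow> complex) set) \<Rightarrow> bool" where
  "valid_Rep G N Af Rp \<longleftrightarrow> (\<forall>t. NLT G N t \<longrightarrow>
     (let L = Lin_t G N (fst (snd t)) (Af t) (snd (snd t)) in
       Rp t \<subseteq> L \<and> (\<forall>\<phi>\<in>L. \<exists>!\<rho>. \<rho> \<in> Rp t \<and> same_orbit G t \<rho> \<phi>)))"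

definition stab :: "('g,'b) monoid_scheme \<Rightarrow> 'g set \<Rightarrow> ('g \<Rightarrow> complex) \<Rightarrow> 'g set" where
  "stab G H \<phi> = {h \<in> H. conjc G \<phi> h = \<phi>}"

definition Cl :: "('g,'b) monoid_scheme \<Rightarrow> ('g triple \<Rightarrow> 'g set)
    \<Rightarrow> ('g triple \<Rightarrow> ('g \<Rightarrow> complex) set) \<Rightarrow> 'g triple \<Rightarrow> 'g triple set" where
  "Cl G Af Rp t = (case t of (H, A, \<theta>) \<Rightarrow>
     if H = A then {} else {(stab G H \<phi>, Af t, \<phi>) | \<phi>. \<phi> \<in> Rp t})"

text \<open>\<open>vs = [v_1,...,v_n]\<close> is the path from the root \<open>(G,N,1_N)\<close> to the leaf \<open>(H,H,\<theta>)\<close>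
  in \<open>\<G>_N\<close> (so \<open>(H,H,\<theta>) \<in> \<L>_N\<close> with height \<open>n = length vs\<close>).\<close>
definition leaf_path :: "('g,'b) monoid_scheme \<Rightarrow> 'g set \<Rightarrow> ('g triple \<Rightarrow> 'g set)
    \<Rightarrow> ('g triple \<Rightarrow> ('g \<Rightarrow> complex) set) \<Rightarrow> 'g triple list \<Rightarrow> 'g set \<Rightarrow> ('g \<Rightarrow> complex) \<Rightarrow> bool" where
  "leaf_path G N Af Rp vs H \<theta> \<longleftrightarrow> vs \<noteq> [] \<and>
     hd vs = (carrier G, N, one_char N) \<and>
     (\<forall>v \<in> set vs. NLT G N v) \<and>
     (\<forall>j. Suc j < length vs \<longrightarrow> vs ! Suc j \<in> Cl G Af Rp (vs ! j)) \<and>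
     last vs = (H, H, \<theta>)"

definition gaQ :: "('g,'b) monoid_scheme \<Rightarrow> 'g set \<Rightarrow> ('g \<Rightarrow> rat) ring" where
  "gaQ G M = \<lparr>carrier = {f. \<forall>x. x \<notin> M \<longrightarrow> f x = 0},
     mult = (\<lambda>f g. \<lambda>x. if x \<in> M then (\<Sum>y\<in>M. f y * g (inv\<^bsub>G\<^esub> y \<otimes>\<^bsub>G\<^esub> x)) else 0),
     one = (\<lambda>x. if x = \<one>\<^bsub>G\<^esub> then 1 else 0),
     zero = (\<lambda>x. 0),
     add = (\<lambda>f g. \<lambda>x. f x + g x)\<rparr>"

text \<open>\<open>\<rat>M e\<close> for a central idempotent \<open>e\<close> of \<open>\<rat>M\<close>, with identity \<open>e\<close>\<close>
definition gaQe :: "('g,'b) monoid_scheme \<Rightarrow> 'g set \<Rightarrow> ('g \<Rightarrow> rat) \<Rightarrow> ('g \<Rightarrow> rat) ring" where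
  "gaQe G M e = (gaQ G M)\<lparr>carrier := {f \<otimes>\<^bsub>gaQ G M\<^esub> e | f. f \<in> carrier (gaQ G M)}, one := e\<rparr>"

definition delta :: "'g \<Rightarrow> ('g \<Rightarrow> rat)" where
  "delta h = (\<lambda>x. if x = h then 1 else 0)"

definition genfield :: "complex set \<Rightarrow> complex set" where
  "genfield S = \<Inter>{F. S \<subseteq> F \<and> 0 \<in> F \<and> 1 \<in> F \<and>
     (\<forall>x\<in>F. \<forall>y\<in>F. x + y \<in> F \<and> x - y \<in> F \<and> x * y \<in> F) \<and> (\<forall>x\<in>F. inverse x \<in> F)}"

definition Gal :: "complex set \<Rightarrow> (complex \<Rightarrow> complex) set" where
  "Gal S = {\<sigma>. bij_betw \<sigma> (genfield S) (genfield S) \<and>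
     (\<forall>x\<in>genfield S. \<forall>y\<in>genfield S. \<sigma> (x + y) = \<sigma> x + \<sigma> y \<and> \<sigma> (x * y) = \<sigma> x * \<sigma> y) \<and>
     (\<forall>x. x \<notin> genfield S \<longrightarrow> \<sigma> x = x)}"

definition eQc :: "('g,'b) monoid_scheme \<Rightarrow> 'g set \<Rightarrow> ('g \<Rightarrow> complex) \<Rightarrow> ('g \<Rightarrow> complex)" where
  "eQc G M \<chi> = (\<lambda>x. if x \<in> M then \<chi> \<one>\<^bsub>G\<^esub> / of_nat (card M) *
       (\<Sum>\<sigma> \<in> Gal (\<chi> ` M). \<sigma> (\<chi> (inv\<^bsub>G\<^esub> x))) else 0)"

text \<open>the same element, viewed in \<open>\<rat>M\<close> (its coefficients are rational)\<close>
definition eQ :: "('g,'b) monoid_scheme \<Rightarrow> 'g set \<Rightarrow> ('g \<Rightarrow> complex) \<Rightarrow> ('g \<Rightarrow> rat)" where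
  "eQ G M \<chi> = (\<lambda>x. THE q. of_rat q = eQc G M \<chi> x)"

definition cen :: "('g,'b) monoid_scheme \<Rightarrow> 'g set \<Rightarrow> ('g \<Rightarrow> rat) \<Rightarrow> 'g set" where
  "cen G M e = {h \<in> M. delta h \<otimes>\<^bsub>gaQ G (carrier G)\<^esub> e = e \<otimes>\<^bsub>gaQ G (carrier G)\<^esub> delta h}"

text \<open>\<open>R *^\<sigma>_\<tau> Q\<close>: elements \<open>\<Sum> f(q) u_q\<close> encoded as functions \<open>f\<close>;
  \<open>(r u_p)(s u_q) = r \<sigma>(p)(s) \<tau>(p,q) u_{pq}\<close>; identity \<open>\<tau>(1,1)^{-1} u_1\<close>\<close>
definition crossed :: "('a,'m) ring_scheme \<Rightarrow> ('q,'n) monoid_scheme \<Rightarrow> ('q \<Rightarrow> 'a \<Rightarrow> 'a)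
    \<Rightarrow> ('q \<Rightarrow> 'q \<Rightarrow> 'a) \<Rightarrow> ('q \<Rightarrow> 'a) ring" where
  "crossed R Q \<sigma> \<tau> = \<lparr>carrier = {f. (\<forall>q\<in>carrier Q. f q \<in> carrier R) \<and> (\<forall>q. q \<notin> carrier Q \<longrightarrow> f q = \<zero>\<^bsub>R\<^esub>)},
     mult = (\<lambda>f g. \<lambda>q. if q \<in> carrier Q then
        (\<Oplus>\<^bsub>R\<^esub> pq \<in> {(p, p'). p \<in> carrier Q \<and> p' \<in> carrier Q \<and> p \<otimes>\<^bsub>Q\<^esub> p' = q}.
           f (fst pq) \<otimes>\<^bsub>R\<^esub> \<sigma> (fst pq) (g (snd pq)) \<otimes>\<^bsub>R\<^esub> \<tau> (fst pq) (snd pq))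
        else \<zero>\<^bsub>R\<^esub>),
     one = (\<lambda>q. if q = \<one>\<^bsub>Q\<^esub> then inv\<^bsub>R\<^esub> (\<tau> \<one>\<^bsub>Q\<^esub> \<one>\<^bsub>Q\<^esub>) else \<zero>\<^bsub>R\<^esub>),
     zero = (\<lambda>q. \<zero>\<^bsub>R\<^esub>),
     add = (\<lambda>f g. \<lambda>q. f q \<oplus>\<^bsub>R\<^esub> g q)\<rparr>"

definition mat_ring :: "nat \<Rightarrow> ('a,'m) ring_scheme \<Rightarrow> (nat \<Rightarrow> nat \<Rightarrow> 'a) ring" where
  "mat_ring k R = \<lparr>carrier = {A. \<forall>i j. (i < k \<and> j < k \<longrightarrow> A i j \<in> carrier R) \<and>
                                    (\<not> (i < k \<and> j < k) \<longrightarrow> A i j = \<zero>\<^bsub>R\<^esub>)},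
     mult = (\<lambda>A B. \<lambda>i j. if i < k \<and> j < k then (\<Oplus>\<^bsub>R\<^esub> l \<in> {..<k}. A i l \<otimes>\<^bsub>R\<^esub> B l j) else \<zero>\<^bsub>R\<^esub>),
     one = (\<lambda>i j. if i < k \<and> j < k then (if i = j then \<one>\<^bsub>R\<^esub> else \<zero>\<^bsub>R\<^esub>) else \<zero>\<^bsub>R\<^esub>),
     zero = (\<lambda>i j. \<zero>\<^bsub>R\<^esub>),
     add = (\<lambda>A B. \<lambda>i j. A i j \<oplus>\<^bsub>R\<^esub> B i j)\<rparr>"

definition Qadj :: "complex \<Rightarrow> complex ring" where
  "Qadj \<xi> = \<lparr>carrier = genfield {\<xi>}, mult = (*), one = 1, zero = 0, add = (+)\<rparr>"

section \<open>The data attached to a leaf (indices \<open>j = i - 1\<close>, 0-based)\<close>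

definition E_node :: "('g,'b) monoid_scheme \<Rightarrow> 'g triple list \<Rightarrow> 'g set \<Rightarrow> ('g \<Rightarrow> complex) \<Rightarrow> nat \<Rightarrow> ('g \<Rightarrow> rat)" where
  "E_node G vs H \<theta> j = eQ G (fst (vs ! j)) (ind G (fst (vs ! j)) H \<theta>)"

definition C_node :: "('g,'b) monoid_scheme \<Rightarrow> 'g triple list \<Rightarrow> 'g set \<Rightarrow> ('g \<Rightarrow> complex) \<Rightarrow> nat \<Rightarrow> 'g set" where
  "C_node G vs H \<theta> j = cen G (fst (vs ! j)) (E_node G vs H \<theta> (Suc j))"

definition k_node :: "('g,'b) monoid_scheme \<Rightarrow> 'g triple list \<Rightarrow> 'g set \<Rightarrow> ('g \<Rightarrow> complex) \<Rightarrow> nat \<Rightarrow> nat" where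
  "k_node G vs H \<theta> j = card (fst (vs ! j)) div card (C_node G vs H \<theta> j)"

definition Q_node :: "('g,'b) monoid_scheme \<Rightarrow> 'g triple list \<Rightarrow> 'g set \<Rightarrow> ('g \<Rightarrow> complex) \<Rightarrow> nat \<Rightarrow> 'g set monoid" where
  "Q_node G vs H \<theta> j = (G\<lparr>carrier := C_node G vs H \<theta> j\<rparr>) Mod (fst (vs ! Suc j))"

text \<open>\<open>\<sigma>_i\<close>: conjugation by the representative (\<open>rep\<close> picks coset representatives)\<close>
definition sigma_node :: "('g,'b) monoid_scheme \<Rightarrow> ('g set \<Rightarrow> 'g) \<Rightarrow> 'g set \<Rightarrow> ('g \<Rightarrow> rat) \<Rightarrow> ('g \<Rightarrow> rat)" where
  "sigma_node G rep c b = delta (rep c) \<otimes>\<^bsub>gaQ G (carrier G)\<^esub> b \<otimes>\<^bsub>gaQ G (carrier G)\<^esub> delta (inv\<^bsub>G\<^esub> rep c)"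

text \<open>\<open>\<tau>_i(c,d) = g e\<close> with \<open>rep(c) rep(d) = g rep(cd)\<close>\<close>
definition tau_node :: "('g,'b) monoid_scheme \<Rightarrow> 'g set monoid \<Rightarrow> ('g set \<Rightarrow> 'g) \<Rightarrow> ('g \<Rightarrow> rat) \<Rightarrow> 'g set \<Rightarrow> 'g set \<Rightarrow> ('g \<Rightarrow> rat)" where
  "tau_node G Q rep e c d = delta (rep c \<otimes>\<^bsub>G\<^esub> rep d \<otimes>\<^bsub>G\<^esub> inv\<^bsub>G\<^esub> rep (c \<otimes>\<^bsub>Q\<^esub> d)) \<otimes>\<^bsub>gaQ G (carrier G)\<^esub> e"

end

theory Submission
  imports Defs "HOL-Algebra.Multiplicative_Group" "HOL-Computational_Algebra.Polynomial_Factorial"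
    "HOL-Computational_Algebra.Field_as_Ring" "HOL-Library.Function_Algebras"
begin

text \<open>Along a path, every node \<open>H_{i+1}\<close> is the stabilizer in \<open>H_i\<close> of a linear character \<open>\<phi>\<close> of a normal
  subgroup \<open>A\<close> of \<open>H_i\<close>, with \<open>A \<subseteq> H\<close> and \<open>\<phi>\<close> the restriction of \<open>\<theta>\<close>. Therefore \<open>(H, \<theta>)\<close> satisfies Shoda's
  criterion in every \<open>H_i\<close>. The idempotent \<open>e_i\<close> of the character of \<open>H_i\<close> induced from \<open>\<theta>\<close> is the
  sum of the distinct Galois conjugates of a complex central idempotent; it is rational, and it is
  primitive in the centre of \<open>\<rat>H_i\<close>.

  By Clifford theory, the conjugates of \<open>e_{i+1}\<close> under \<open>H_i\<close> are equal or orthogonal, the centralizer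
  \<open>C_i\<close> of \<open>e_{i+1}\<close> normalizes \<open>H_{i+1}\<close>, and \<open>e_i\<close> is the sum of the \<open>k_i\<close> distinct conjugates. Hence
  \<open>\<rat>H_i e_i\<close> is the ring of \<open>k_i \<times> k_i\<close> matrices over \<open>\<rat>C_i e_{i+1}\<close>, and the latter is the crossed
  product of \<open>\<rat>H_{i+1} e_{i+1}\<close> and \<open>C_i / H_{i+1}\<close>. At the leaf, linear extension of \<open>\<theta>\<close> maps \<open>\<rat>H e_n\<close>
  isomorphically onto \<open>\<rat>(\<xi>_k)\<close>.\<close>

section \<open>The convolution algebra of a finite group\<close>

text \<open>Irreducibility of the induced character is never treated through representations. It
  enters only as the fact that, for e = \<open>eps H \<theta>\<close>, the corner e CM e of the
  complex group algebra is the line spanned by e; Shoda's criterion gives this by a short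
  computation, and it replaces Schur's lemma: central elements act on e by scalars. The obstacle is
  the descent to \<rat>. The definition of \<open>eQ\<close> refers to automorphisms of
  \<rat>(\<chi>), but the values of \<theta> lie in a larger field. Therefore everything is placed
  in \<rat>(w), with w a primitive |G|-th root of unity, and every automorphism of \<rat>(\<chi>) is
  shown to extend to \<rat>(w). This is needed only to establish the predicate \<open>prim\<close>;
  the Clifford theory and the ring isomorphisms start from \<open>prim\<close> and use no Galois
  group. All group algebras involved live in one function type and are told apart by supports, so
  that products of elements of H_{i+1}, C_i and H_i are values of one operation. The coefficient
  ring is generic, which makes the same operation serve \<rat> and the complex numbers.\<close>

definition dl :: "'a \<Rightarrow> 'a \<Rightarrow> 'r::comm_ring_1" where
  "dl a = (\<lambda>x. if x = a then 1 else 0)"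

definition scl :: "'r::comm_ring_1 \<Rightarrow> ('a \<Rightarrow> 'r) \<Rightarrow> 'a \<Rightarrow> 'r" where
  "scl c f = (\<lambda>x. c * f x)"

definition sup_in :: "'a set \<Rightarrow> ('a \<Rightarrow> 'r::zero) \<Rightarrow> bool" where
  "sup_in M f \<longleftrightarrow> (\<forall>x. x \<notin> M \<longrightarrow> f x = 0)"

lemma sum_fun_apply: "(\<Sum>i\<in>I. f i) x = (\<Sum>i\<in>I. f i x)"
  by (induction I rule: infinite_finite_induct) auto

lemma sup_inD: "sup_in M f \<Longrightarrow> x \<notin> M \<Longrightarrow> f x = 0"
  by (auto simp: sup_in_def)

lemma sup_in_mono: "sup_in M f \<Longrightarrow> M \<subseteq> M' \<Longrightarrow> sup_in M' f"
  by (auto simp: sup_in_def)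

lemma sup_in_sum: "(\<And>i. i \<in> I \<Longrightarrow> sup_in M (f i)) \<Longrightarrow> sup_in M (\<Sum>i\<in>I. f i)"
  by (auto simp: sup_in_def sum_fun_apply)

lemma sup_in_add: "sup_in M (f :: 'a \<Rightarrow> 'r::comm_ring_1) \<Longrightarrow> sup_in M g \<Longrightarrow> sup_in M (f + g)"
  by (auto simp: sup_in_def)

lemma sup_in_diff: "sup_in M (f :: 'a \<Rightarrow> 'r::comm_ring_1) \<Longrightarrow> sup_in M g \<Longrightarrow> sup_in M (f - g)"
  by (auto simp: sup_in_def)

lemma sup_in_dl: "sup_in M (dl a) \<longleftrightarrow> a \<in> M"
  by (auto simp: sup_in_def dl_def)

lemma sup_in_scl: "sup_in M f \<Longrightarrow> sup_in M (scl c f)"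
  by (auto simp: sup_in_def scl_def)

lemma sup_in_0: "sup_in M (0 :: 'a \<Rightarrow> 'r::comm_ring_1)"
  by (auto simp: sup_in_def)

lemma scl_1 [simp]: "scl 1 f = f"
  by (simp add: scl_def)

lemma scl_0 [simp]: "scl 0 f = 0"
  by (simp add: scl_def fun_eq_iff)

lemma scl_zero [simp]: "scl c 0 = 0"
  by (simp add: scl_def fun_eq_iff)

lemma scl_scl: "scl c (scl d f) = scl (c * d) f"
  by (simp add: scl_def mult.assoc)

lemma scl_sum: "scl c (\<Sum>i\<in>I. f i) = (\<Sum>i\<in>I. scl c (f i))"
  by (simp add: scl_def fun_eq_iff sum_fun_apply sum_distrib_left)

lemma scl_eq_0: "scl (c :: 'r::idom) f = 0 \<longleftrightarrow> c = 0 \<or> f = 0"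
  by (auto simp: scl_def fun_eq_iff)

lemma scl_diff_left: "scl (c - d) f = scl c f - scl d f"
  by (simp add: scl_def fun_eq_iff algebra_simps)

lemma sum_scl_const: "(\<Sum>i\<in>I. f) = scl (of_nat (card I)) f"
  by (simp add: scl_def fun_eq_iff sum_fun_apply)

locale finite_group = group G for G (structure) +
  assumes fin: "finite (carrier G)"
begin

text \<open>The sum runs over all of \<open>carrier G\<close>, also for elements of a subgroup
  algebra; \<open>gaQ_mult\<close> shows the agreement with the product of \<open>gaQ\<close>. With
  the value 0 outside the carrier, associativity holds without any condition on supports.\<close>

definition star :: "('a \<Rightarrow> 'r::comm_ring_1) \<Rightarrow> ('a \<Rightarrow> 'r) \<Rightarrow> 'a \<Rightarrow> 'r"  (infixl "\<star>" 70) where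
  "f \<star> g = (\<lambda>x. if x \<in> carrier G then \<Sum>y\<in>carrier G. f y * g (inv y \<otimes> x) else 0)"

lemma sum_translate: "a \<in> carrier G \<Longrightarrow> (\<Sum>y\<in>carrier G. h (a \<otimes> y)) = (\<Sum>y\<in>carrier G. h y)"
  by (rule sum.reindex_bij_witness[of _ "\<lambda>y. inv a \<otimes> y" "\<lambda>y. a \<otimes> y"])
     (auto simp: m_assoc[symmetric])

lemma star_assoc: "(f \<star> g) \<star> h = f \<star> (g \<star> h)"
proof
  fix x
  show "((f \<star> g) \<star> h) x = (f \<star> (g \<star> h)) x"
  proof (cases "x \<in> carrier G")
    case True
    have "((f \<star> g) \<star> h) x = (\<Sum>y\<in>carrier G. \<Sum>z\<in>carrier G. f z * g (inv z \<otimes> y) * h (inv y \<otimes> x))"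
      using True by (simp add: star_def sum_distrib_right)
    also have "\<dots> = (\<Sum>z\<in>carrier G. \<Sum>y\<in>carrier G. f z * g (inv z \<otimes> y) * h (inv y \<otimes> x))"
      by (rule sum.swap)
    also have "\<dots> = (\<Sum>z\<in>carrier G. \<Sum>u\<in>carrier G. f z * (g u * h (inv u \<otimes> (inv z \<otimes> x))))"
    proof (rule sum.cong[OF refl])
      fix z assume z: "z \<in> carrier G"
      have "(\<Sum>y\<in>carrier G. f z * g (inv z \<otimes> y) * h (inv y \<otimes> x))
          = (\<Sum>u\<in>carrier G. f z * g (inv z \<otimes> (z \<otimes> u)) * h (inv (z \<otimes> u) \<otimes> x))"
        by (rule sum_translate[OF z, symmetric, where h="\<lambda>y. f z * g (inv z \<otimes> y) * h (inv y \<otimes> x)"])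
      also have "\<dots> = (\<Sum>u\<in>carrier G. f z * (g u * h (inv u \<otimes> (inv z \<otimes> x))))"
        using z True by (intro sum.cong refl) (simp add: inv_mult_group m_assoc[symmetric] mult.assoc)
      finally show "(\<Sum>y\<in>carrier G. f z * g (inv z \<otimes> y) * h (inv y \<otimes> x))
          = (\<Sum>u\<in>carrier G. f z * (g u * h (inv u \<otimes> (inv z \<otimes> x))))" .
    qed
    also have "\<dots> = (f \<star> (g \<star> h)) x"
      using True by (simp add: star_def sum_distrib_left)
    finally show ?thesis .
  qed (simp add: star_def)
qed

lemma star_add_left: "(f + g) \<star> h = f \<star> h + g \<star> h"
  by (simp add: star_def fun_eq_iff algebra_simps sum.distrib)

lemma star_add_right: "f \<star> (g + h) = f \<star> g + f \<star> h"
  by (simp add: star_def fun_eq_iff algebra_simps sum.distrib)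

lemma star_diff_left: "(f - g) \<star> h = f \<star> h - g \<star> h"
  by (simp add: star_def fun_eq_iff algebra_simps sum_subtractf)

lemma star_diff_right: "f \<star> (g - h) = f \<star> g - f \<star> h"
  by (simp add: star_def fun_eq_iff algebra_simps sum_subtractf)

lemma star_0_left [simp]: "0 \<star> h = 0"
  by (simp add: star_def fun_eq_iff)

lemma star_0_right [simp]: "h \<star> 0 = 0"
  by (simp add: star_def fun_eq_iff)

lemma star_sum_left: "(\<Sum>i\<in>I. f i) \<star> h = (\<Sum>i\<in>I. f i \<star> h)"
  by (induction I rule: infinite_finite_induct) (simp_all only: sum.infinite sum.empty sum.insert star_add_left star_0_left not_False_eq_True if_False)

lemma star_sum_right: "h \<star> (\<Sum>i\<in>I. f i) = (\<Sum>i\<in>I. h \<star> f i)"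
  by (induction I rule: infinite_finite_induct) (simp_all only: sum.infinite sum.empty sum.insert star_add_right star_0_right not_False_eq_True if_False)

lemma star_scl_left: "scl c f \<star> h = scl c (f \<star> h)"
  by (simp add: star_def scl_def fun_eq_iff sum_distrib_left mult.assoc)

lemma star_scl_right: "h \<star> scl c f = scl c (h \<star> f)"
  by (simp add: star_def scl_def fun_eq_iff sum_distrib_left mult.left_commute)

lemma dl_star: "a \<in> carrier G \<Longrightarrow> x \<in> carrier G \<Longrightarrow> (dl a \<star> f) x = f (inv a \<otimes> x)"
  using fin by (simp add: star_def dl_def if_distrib[where f="\<lambda>c. c * _"] cong: if_cong)

lemma star_dl: "a \<in> carrier G \<Longrightarrow> x \<in> carrier G \<Longrightarrow> (f \<star> dl a) x = f (x \<otimes> inv a)"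
proof -
  assume a: "a \<in> carrier G" and x: "x \<in> carrier G"
  have "inv y \<otimes> x = a \<longleftrightarrow> y = x \<otimes> inv a" if "y \<in> carrier G" for y
    using a x that by (metis inv_closed inv_solve_left inv_solve_right)
  then have "(f \<star> dl a) x = (\<Sum>y\<in>carrier G. if y = x \<otimes> inv a then f y else 0)"
    unfolding star_def dl_def using a x by (auto intro!: sum.cong)
  then show ?thesis using fin a x by simp
qed

lemma star_outside: "x \<notin> carrier G \<Longrightarrow> (f \<star> g) x = 0"
  by (simp add: star_def)

lemma sup_in_star_carrier: "sup_in (carrier G) (f \<star> g)"
  by (simp add: sup_in_def star_def)

lemma dl_mult: "a \<in> carrier G \<Longrightarrow> b \<in> carrier G \<Longrightarrow> (dl a :: 'a \<Rightarrow> 'r::comm_ring_1) \<star> dl b = dl (a \<otimes> b)"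
proof
  fix x assume a: "a \<in> carrier G" and b: "b \<in> carrier G"
  show "((dl a :: 'a \<Rightarrow> 'r) \<star> dl b) x = dl (a \<otimes> b) x"
  proof (cases "x \<in> carrier G")
    case True
    then show ?thesis using a b
      by (simp add: dl_star) (auto simp: dl_def m_assoc[symmetric])
  next
    case False
    then show ?thesis using a b by (auto simp: star_outside dl_def)
  qed
qed

lemma dl_one_star: "sup_in (carrier G) f \<Longrightarrow> dl \<one> \<star> f = f"
  by (rule ext, case_tac "x \<in> carrier G") (auto simp: dl_star star_outside sup_in_def)

lemma star_dl_one: "sup_in (carrier G) f \<Longrightarrow> f \<star> dl \<one> = f"
  by (rule ext, case_tac "x \<in> carrier G") (auto simp: star_dl star_outside sup_in_def)

lemma conj_apply: "g \<in> carrier G \<Longrightarrow> x \<in> carrier G \<Longrightarrow> (dl g \<star> f \<star> dl (inv g)) x = f (inv g \<otimes> x \<otimes> g)"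
  by (simp add: star_dl dl_star m_assoc)

lemma sup_in_star: "subgroup M G \<Longrightarrow> sup_in M f \<Longrightarrow> sup_in M g \<Longrightarrow> sup_in M (f \<star> g)"
proof (unfold sup_in_def, intro allI impI)
  fix x assume M: "subgroup M G" and f: "\<forall>x. x \<notin> M \<longrightarrow> f x = 0" and g: "\<forall>x. x \<notin> M \<longrightarrow> g x = 0"
    and x: "x \<notin> M"
  have "f y * g (inv y \<otimes> x) = 0" if "x \<in> carrier G" "y \<in> carrier G" for y
  proof (cases "y \<in> M")
    case True
    then have "inv y \<otimes> x \<notin> M"
      using x that M subgroup.m_closed[OF M True, of "inv y \<otimes> x"]
      by (auto simp: m_assoc[symmetric] r_inv)
    then show ?thesis using g by simp
  qed (use f in simp)
  then show "(f \<star> g) x = 0" by (simp add: star_def)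
qed

lemma sup_expand: "finite M \<Longrightarrow> sup_in M f \<Longrightarrow> f = (\<Sum>g\<in>M. scl (f g) (dl g))"
proof
  fix x assume fM: "finite M" and s: "sup_in M f"
  have "(\<Sum>g\<in>M. scl (f g) (dl g)) x = (\<Sum>g\<in>M. if x = g then f g else 0)"
    by (simp add: sum_fun_apply scl_def dl_def if_distrib cong: if_cong)
  also have "\<dots> = f x" using fM s by (auto simp: sup_in_def)
  finally show "f x = (\<Sum>g\<in>M. scl (f g) (dl g)) x" by simp
qed

lemma star_eq_sum_left:
  assumes "M \<subseteq> carrier G" "sup_in M f"
  shows "f \<star> h = (\<Sum>g\<in>M. scl (f g) (dl g \<star> h))"
proof -
  have "finite M" using assms(1) fin finite_subset by blast
  then have "f \<star> h = (\<Sum>g\<in>M. scl (f g) (dl g)) \<star> h"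
    using sup_expand[OF _ assms(2)] by simp
  then show ?thesis by (simp add: star_sum_left star_scl_left)
qed

lemma star_eq_sum_right:
  assumes "M \<subseteq> carrier G" "sup_in M f"
  shows "h \<star> f = (\<Sum>g\<in>M. scl (f g) (h \<star> dl g))"
proof -
  have "finite M" using assms(1) fin finite_subset by blast
  then have "h \<star> f = h \<star> (\<Sum>g\<in>M. scl (f g) (dl g))"
    using sup_expand[OF _ assms(2)] by simp
  then show ?thesis by (simp add: star_sum_right star_scl_right)
qed

text \<open>Point masses span the group algebra. Centrality is therefore expressed throughout by
  commutation with \<open>dl m\<close>, and this lemma extends it linearly.\<close>

lemma star_commute_sup:
  assumes "M \<subseteq> carrier G" "sup_in M f" "\<And>m. m \<in> M \<Longrightarrow> dl m \<star> h = h \<star> dl m"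
  shows "f \<star> h = h \<star> f"
  using assms by (simp add: star_eq_sum_left star_eq_sum_right)

lemma dl_cancel_left: "a \<in> carrier G \<Longrightarrow> sup_in (carrier G) f \<Longrightarrow> dl (inv a) \<star> (dl a \<star> f) = f"
  by (simp add: star_assoc[symmetric] dl_mult dl_one_star)

lemma dl_cancel_right: "a \<in> carrier G \<Longrightarrow> sup_in (carrier G) f \<Longrightarrow> f \<star> dl a \<star> dl (inv a) = f"
  by (simp add: star_assoc dl_mult star_dl_one)

text \<open>Lets a rational element act on the complex idempotents. Being multiplicative and
  injective, it also brings identities back to \<rat>.\<close>

definition cr :: "('a \<Rightarrow> rat) \<Rightarrow> 'a \<Rightarrow> complex" where
  "cr f = (\<lambda>x. of_rat (f x))"

lemma cr_star: "cr (f \<star> g) = cr f \<star> cr g"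
  by (simp add: cr_def star_def fun_eq_iff of_rat_sum of_rat_mult)

lemma cr_dl: "cr (dl a) = dl a"
  by (simp add: cr_def dl_def fun_eq_iff)

lemma cr_diff: "cr (f - g) = cr f - cr g"
  by (simp add: cr_def fun_eq_iff of_rat_diff)

lemma cr_0: "cr 0 = 0"
  by (simp add: cr_def fun_eq_iff)

lemma cr_inj: "cr f = cr g \<longleftrightarrow> f = g"
  by (auto simp: cr_def fun_eq_iff)

lemma sup_in_cr: "sup_in M (cr f) \<longleftrightarrow> sup_in M f"
  by (simp add: sup_in_def cr_def)

section \<open>Idempotents of linear characters\<close>

lemma finite_sub: "subgroup M G \<Longrightarrow> finite M"
  using fin finite_subset subgroup.subset by blast

lemma card_sub_pos: "subgroup M G \<Longrightarrow> card M > 0"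
  using finite_sub subgroup.one_closed by (metis card_gt_0_iff empty_iff)

lemma lin_char_mult: "lin_char G H \<theta> \<Longrightarrow> x \<in> H \<Longrightarrow> y \<in> H \<Longrightarrow> \<theta> (x \<otimes> y) = \<theta> x * \<theta> y"
  by (simp add: lin_char_def)

lemma lin_char_nz: "lin_char G H \<theta> \<Longrightarrow> x \<in> H \<Longrightarrow> \<theta> x \<noteq> 0"
  by (simp add: lin_char_def)

lemma lin_char_out: "lin_char G H \<theta> \<Longrightarrow> x \<notin> H \<Longrightarrow> \<theta> x = 0"
  by (simp add: lin_char_def)

lemma lin_char_one: "subgroup H G \<Longrightarrow> lin_char G H \<theta> \<Longrightarrow> \<theta> \<one> = 1"
  using lin_char_mult[of H \<theta> \<one> \<one>] lin_char_nz[of H \<theta> \<one>] subgroup.one_closed[of H G] by auto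

lemma lin_char_inv: "subgroup H G \<Longrightarrow> lin_char G H \<theta> \<Longrightarrow> x \<in> H \<Longrightarrow> \<theta> (inv x) * \<theta> x = 1"
  using lin_char_mult[of H \<theta> "inv x" x] lin_char_one[of H \<theta>] subgroup.m_inv_closed[of H G x]
    subgroup.mem_carrier[of H G x] by auto

text \<open>The primitive idempotent of the complex group algebra of \<open>H\<close> that belongs
  to \<theta>. The case distinction is made because \<open>inv\<close> is unspecified outside the
  carrier.\<close>

definition eps :: "'a set \<Rightarrow> ('a \<Rightarrow> complex) \<Rightarrow> 'a \<Rightarrow> complex" where
  "eps H \<theta> = (\<lambda>x. if x \<in> H then \<theta> (inv x) / of_nat (card H) else 0)"

lemma sup_in_eps: "sup_in H (eps H \<theta>)"
  by (simp add: sup_in_def eps_def)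

lemma dl_eps:
  assumes H: "subgroup H G" and l: "lin_char G H \<theta>" and h: "h \<in> H"
  shows "dl h \<star> eps H \<theta> = scl (\<theta> h) (eps H \<theta>)"
proof
  fix x
  have hc: "h \<in> carrier G" using H h by (rule subgroup.mem_carrier)
  show "(dl h \<star> eps H \<theta>) x = scl (\<theta> h) (eps H \<theta>) x"
  proof (cases "x \<in> carrier G")
    case True
    have 1: "inv h \<otimes> x \<in> H \<longleftrightarrow> x \<in> H"
      using H h True hc by (metis inv_solve_left inv_closed subgroup.m_closed subgroup.m_inv_closed inv_inv m_closed)
    have 2: "\<theta> (inv x \<otimes> h) = \<theta> h * \<theta> (inv x)" if "x \<in> H"
      using lin_char_mult[OF l _ h, of "inv x"] H that by (simp add: subgroup.m_inv_closed)
    show ?thesis using 1 2 hc True by (auto simp: dl_star scl_def eps_def inv_mult_group)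
  next
    case False
    then show ?thesis using subgroup.mem_carrier[OF H] by (auto simp: star_outside scl_def eps_def)
  qed
qed

lemma eps_dl:
  assumes H: "subgroup H G" and l: "lin_char G H \<theta>" and h: "h \<in> H"
  shows "eps H \<theta> \<star> dl h = scl (\<theta> h) (eps H \<theta>)"
proof
  fix x
  have hc: "h \<in> carrier G" using H h by (rule subgroup.mem_carrier)
  show "(eps H \<theta> \<star> dl h) x = scl (\<theta> h) (eps H \<theta>) x"
  proof (cases "x \<in> carrier G")
    case True
    have 1: "x \<otimes> inv h \<in> H \<longleftrightarrow> x \<in> H"
      using H h True hc by (metis inv_solve_right inv_closed subgroup.m_closed subgroup.m_inv_closed inv_inv m_closed)
    have 2: "\<theta> (h \<otimes> inv x) = \<theta> h * \<theta> (inv x)" if "x \<in> H"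
      using lin_char_mult[OF l h, of "inv x"] H that by (simp add: subgroup.m_inv_closed)
    show ?thesis using 1 2 hc True by (auto simp: star_dl scl_def eps_def inv_mult_group)
  next
    case False
    then show ?thesis using subgroup.mem_carrier[OF H] by (auto simp: star_outside scl_def eps_def)
  qed
qed

lemma star_eps_eq:
  assumes H: "subgroup H G" and l: "lin_char G H \<theta>" and f: "sup_in H f"
  shows "f \<star> eps H \<theta> = scl (\<Sum>h\<in>H. f h * \<theta> h) (eps H \<theta>)"
proof -
  have "f \<star> eps H \<theta> = (\<Sum>h\<in>H. scl (f h) (scl (\<theta> h) (eps H \<theta>)))"
    using star_eq_sum_left[OF subgroup.subset[OF H] f, of "eps H \<theta>"] dl_eps[OF H l] by simp
  then show ?thesis
    by (simp add: scl_def fun_eq_iff sum_fun_apply sum_distrib_right mult.assoc)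
qed

lemma eps_idem:
  assumes H: "subgroup H G" and l: "lin_char G H \<theta>"
  shows "eps H \<theta> \<star> eps H \<theta> = eps H \<theta>"
proof -
  have "(\<Sum>h\<in>H. eps H \<theta> h * \<theta> h) = (\<Sum>h\<in>H. 1 / of_nat (card H))"
    by (rule sum.cong) (use lin_char_inv[OF H l] in \<open>auto simp: eps_def divide_simps\<close>)
  also have "\<dots> = 1" using card_sub_pos[OF H] by simp
  finally show ?thesis using star_eps_eq[OF H l sup_in_eps] by simp
qed

lemma eps_nz:
  assumes H: "subgroup H G" and l: "lin_char G H \<theta>"
  shows "eps H \<theta> \<noteq> 0"
proof
  assume "eps H \<theta> = 0"
  then have "eps H \<theta> \<one> = 0" by simp
  then show False using lin_char_one[OF H l] card_sub_pos[OF H] subgroup.one_closed[OF H]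
    by (simp add: eps_def)
qed

text \<open>Shoda's criterion for the irreducibility of the character induced from \<open>\<theta>\<close> to \<open>M\<close>.\<close>
definition shoda :: "'a set \<Rightarrow> 'a set \<Rightarrow> ('a \<Rightarrow> complex) \<Rightarrow> bool" where
  "shoda M H \<theta> \<longleftrightarrow> (\<forall>g\<in>M - H. \<exists>a\<in>H. g \<otimes> a \<otimes> inv g \<in> H \<and> \<theta> (g \<otimes> a \<otimes> inv g) \<noteq> \<theta> a)"

text \<open>For g outside \<open>H\<close>, Shoda's criterion provides a with (g a g^-1) g = g a.
  Absorbing g a g^-1 into the left \<open>eps\<close> and a into the right one yields two different
  scalars for the same product, which is therefore zero. As \<theta> vanishes outside
  \<open>H\<close>, one formula covers both cases.\<close>

lemma eps_dl_eps:
  assumes H: "subgroup H G" and l: "lin_char G H \<theta>" and s: "shoda M H \<theta>" and M: "M \<subseteq> carrier G"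
    and g: "g \<in> M"
  shows "eps H \<theta> \<star> dl g \<star> eps H \<theta> = scl (\<theta> g) (eps H \<theta>)"
proof (cases "g \<in> H")
  case True
  then show ?thesis by (simp add: eps_dl[OF H l] star_scl_left eps_idem[OF H l])
next
  case False
  have gc: "g \<in> carrier G" using g M by auto
  obtain a where a: "a \<in> H" "g \<otimes> a \<otimes> inv g \<in> H" "\<theta> (g \<otimes> a \<otimes> inv g) \<noteq> \<theta> a"
    using s g False by (auto simp: shoda_def)
  let ?b = "g \<otimes> a \<otimes> inv g" and ?x = "eps H \<theta> \<star> dl g \<star> eps H \<theta>"
  have ac: "a \<in> carrier G" using a H by (simp add: subgroup.mem_carrier)
  have "?b \<otimes> g = g \<otimes> a" using gc ac by (simp add: m_assoc)
  then have "(dl ?b :: 'a \<Rightarrow> complex) \<star> dl g = dl g \<star> dl a" using gc ac by (simp add: dl_mult)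
  then have "eps H \<theta> \<star> dl ?b \<star> dl g \<star> eps H \<theta> = eps H \<theta> \<star> dl g \<star> (dl a \<star> eps H \<theta>)"
    by (metis star_assoc)
  then have "scl (\<theta> ?b) ?x = scl (\<theta> a) ?x"
    using a by (simp add: eps_dl[OF H l] dl_eps[OF H l] star_scl_left star_scl_right)
  then have "scl (\<theta> ?b - \<theta> a) ?x = 0" by (simp add: scl_diff_left)
  then have "?x = 0" using a(3) by (simp add: scl_eq_0)
  then show ?thesis using lin_char_out[OF l False] by simp
qed

lemma eps_star_eps:
  assumes H: "subgroup H G" and l: "lin_char G H \<theta>" and s: "shoda M H \<theta>" and M: "M \<subseteq> carrier G"
    and f: "sup_in M f"
  shows "eps H \<theta> \<star> f \<star> eps H \<theta> = scl (\<Sum>g\<in>M. f g * \<theta> g) (eps H \<theta>)"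
proof -
  have "eps H \<theta> \<star> f \<star> eps H \<theta> = (\<Sum>g\<in>M. scl (f g) (eps H \<theta> \<star> dl g \<star> eps H \<theta>))"
    by (simp add: star_eq_sum_right[OF M f] star_sum_left star_scl_left)
  also have "\<dots> = (\<Sum>g\<in>M. scl (f g) (scl (\<theta> g) (eps H \<theta>)))"
    using eps_dl_eps[OF H l s M] by simp
  finally show ?thesis
    by (simp add: scl_def fun_eq_iff sum_fun_apply sum_distrib_right mult.assoc)
qed

text \<open>If the character induced from \<open>\<theta>\<close> to \<open>M\<close> is irreducible, this sum of conjugates of
  \<open>eps H \<theta>\<close> is its primitive central idempotent in \<open>\<complex>M\<close>.\<close>
definition ind_idem :: "'a set \<Rightarrow> 'a set \<Rightarrow> ('a \<Rightarrow> complex) \<Rightarrow> 'a \<Rightarrow> complex" where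
  "ind_idem M H \<theta> = scl (1 / of_nat (card H)) (\<Sum>y\<in>M. dl (inv y) \<star> eps H \<theta> \<star> dl y)"

lemma ind_idem_apply:
  assumes M: "subgroup M G" and H: "H \<subseteq> M" and x: "x \<in> carrier G"
  shows "ind_idem M H \<theta> x = (\<Sum>y\<in>M. eps H \<theta> (y \<otimes> x \<otimes> inv y)) / of_nat (card H)"
proof -
  have "(dl (inv y) \<star> eps H \<theta> \<star> dl y) x = eps H \<theta> (y \<otimes> x \<otimes> inv y)" if "y \<in> M" for y
    using conj_apply[of "inv y" x "eps H \<theta>"] x subgroup.mem_carrier[OF M that] by simp
  then show ?thesis by (simp add: ind_idem_def scl_def sum_fun_apply)
qed

lemma sup_in_ind_idem:
  assumes M: "subgroup M G" and H: "H \<subseteq> M"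
  shows "sup_in M (ind_idem M H \<theta>)"
  unfolding ind_idem_def
  by (intro sup_in_scl sup_in_sum sup_in_star[OF M] sup_in_mono[OF sup_in_eps H])
     (auto simp: sup_in_dl subgroup.m_inv_closed[OF M])

lemma sum_sub_translate:
  assumes M: "subgroup M G" and a: "a \<in> M"
  shows "(\<Sum>y\<in>M. h (y \<otimes> a)) = (\<Sum>y\<in>M. h y)"
proof -
  note [simp] = subgroup.mem_carrier[OF M] subgroup.m_closed[OF M] subgroup.m_inv_closed[OF M]
  show ?thesis using a
    by (intro sum.reindex_bij_witness[of _ "\<lambda>y. y \<otimes> inv a" "\<lambda>y. y \<otimes> a"]) (auto simp: m_assoc)
qed

text \<open>Replacing y by y m permutes the terms and moves \<open>dl m\<close> from one side to the
  other.\<close>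

lemma sum_conj_central:
  fixes f :: "'a \<Rightarrow> 'r::comm_ring_1"
  assumes M: "subgroup M G" and m: "m \<in> M"
  shows "dl m \<star> (\<Sum>y\<in>M. dl (inv y) \<star> f \<star> dl y) = (\<Sum>y\<in>M. dl (inv y) \<star> f \<star> dl y) \<star> dl m"
proof -
  have mc: "m \<in> carrier G" using M m by (rule subgroup.mem_carrier)
  have "dl m \<star> (\<Sum>y\<in>M. dl (inv y) \<star> f \<star> dl y)
      = dl m \<star> (\<Sum>y\<in>M. dl (inv (y \<otimes> m)) \<star> f \<star> dl (y \<otimes> m))"
    by (subst sum_sub_translate[OF M m]) simp
  also have "\<dots> = (\<Sum>y\<in>M. dl m \<star> (dl (inv (y \<otimes> m)) \<star> f \<star> dl (y \<otimes> m)))"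
    by (simp add: star_sum_right)
  also have "\<dots> = (\<Sum>y\<in>M. dl (inv y) \<star> f \<star> dl y \<star> dl m)"
  proof (rule sum.cong[OF refl])
    fix y assume "y \<in> M"
    then have y: "y \<in> carrier G" using M by (simp add: subgroup.mem_carrier)
    have "(dl m :: 'a \<Rightarrow> 'r) \<star> dl (inv (y \<otimes> m)) = dl (inv y)"
      using mc y by (simp add: dl_mult inv_mult_group m_assoc[symmetric])
    moreover have "(dl (y \<otimes> m) :: 'a \<Rightarrow> 'r) = dl y \<star> dl m"
      using mc y by (simp add: dl_mult)
    ultimately show "dl m \<star> (dl (inv (y \<otimes> m)) \<star> f \<star> dl (y \<otimes> m)) = dl (inv y) \<star> f \<star> dl y \<star> dl m"
      by (metis star_assoc)
  qed
  also have "\<dots> = (\<Sum>y\<in>M. dl (inv y) \<star> f \<star> dl y) \<star> dl m"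
    by (simp add: star_sum_left)
  finally show ?thesis .
qed

lemma ind_idem_central:
  assumes "subgroup M G" "m \<in> M"
  shows "dl m \<star> ind_idem M H \<theta> = ind_idem M H \<theta> \<star> dl m"
  by (simp add: ind_idem_def star_scl_left star_scl_right sum_conj_central[OF assms])

text \<open>The value depends on \<open>M\<close> and \<open>H\<close> alone. This is what makes the
  two scalars in \<open>ind_idem_orth\<close> comparable.\<close>

lemma ind_idem_one:
  assumes M: "subgroup M G" and H: "subgroup H G" "H \<subseteq> M" and l: "lin_char G H \<theta>"
  shows "ind_idem M H \<theta> \<one> = of_nat (card M) / (of_nat (card H))\<^sup>2"
proof -
  have "eps H \<theta> (y \<otimes> \<one> \<otimes> inv y) = 1 / of_nat (card H)" if "y \<in> M" for y
    using subgroup.mem_carrier[OF M that] subgroup.one_closed[OF H(1)] lin_char_one[OF H(1) l]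
    by (simp add: eps_def)
  then show ?thesis by (simp add: ind_idem_apply[OF M H(2)] power2_eq_square)
qed

text \<open>The term for y contributes \<open>eps H \<theta>\<close> if y lies in \<open>H\<close>
  and 0 otherwise, by \<open>eps_dl_eps\<close>; the |H| equal terms cancel the normalising
  factor.\<close>

lemma ind_idem_eps:
  assumes M: "subgroup M G" and H: "subgroup H G" "H \<subseteq> M" and l: "lin_char G H \<theta>" and s: "shoda M H \<theta>"
  shows "ind_idem M H \<theta> \<star> eps H \<theta> = eps H \<theta>"
proof -
  have *: "dl (inv y) \<star> eps H \<theta> \<star> dl y \<star> eps H \<theta> = (if y \<in> H then eps H \<theta> else 0)" if "y \<in> M" for y
  proof -
    have "dl (inv y) \<star> eps H \<theta> \<star> dl y \<star> eps H \<theta> = dl (inv y) \<star> scl (\<theta> y) (eps H \<theta>)"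
      using eps_dl_eps[OF H(1) l s subgroup.subset[OF M] that] by (simp add: star_assoc)
    also have "\<dots> = (if y \<in> H then eps H \<theta> else 0)"
      using dl_eps[OF H(1) l, of "inv y"] lin_char_inv[OF H(1) l, of y] lin_char_out[OF l, of y]
        subgroup.m_inv_closed[OF H(1), of y]
      by (auto simp: star_scl_right scl_scl mult.commute)
    finally show ?thesis .
  qed
  have "(\<Sum>y\<in>M. dl (inv y) \<star> eps H \<theta> \<star> dl y) \<star> eps H \<theta> = (\<Sum>y\<in>M. if y \<in> H then eps H \<theta> else 0)"
    by (simp add: star_sum_left *)
  also have "\<dots> = (\<Sum>y\<in>H. eps H \<theta>)"
    using sum.inter_restrict[OF finite_sub[OF M], of "\<lambda>_. eps H \<theta>" H] H(2) by (simp add: Int_absorb1)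
  finally have "(\<Sum>y\<in>M. dl (inv y) \<star> eps H \<theta> \<star> dl y) \<star> eps H \<theta> = scl (of_nat (card H)) (eps H \<theta>)"
    by (simp only: sum_scl_const)
  then show ?thesis
    using card_sub_pos[OF H(1)] by (simp add: ind_idem_def star_scl_left scl_scl)
qed

text \<open>The substitute for Schur's lemma: f commutes with the idempotent
  \<open>eps H \<theta>\<close>, so the product lies in its one-dimensional corner.\<close>

lemma central_star_eps:
  assumes M: "subgroup M G" and H: "subgroup H G" "H \<subseteq> M" and l: "lin_char G H \<theta>" and s: "shoda M H \<theta>"
    and f: "sup_in M f" "\<And>m. m \<in> M \<Longrightarrow> dl m \<star> f = f \<star> dl m"
  obtains c where "f \<star> eps H \<theta> = scl c (eps H \<theta>)"
proof
  have 1: "f \<star> eps H \<theta> = eps H \<theta> \<star> f"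
    using star_commute_sup[OF subgroup.subset[OF M] sup_in_mono[OF sup_in_eps H(2)] f(2)] by simp
  have "f \<star> eps H \<theta> = f \<star> eps H \<theta> \<star> eps H \<theta>" by (simp add: eps_idem[OF H(1) l] star_assoc)
  then show "f \<star> eps H \<theta> = scl (\<Sum>g\<in>M. f g * \<theta> g) (eps H \<theta>)"
    using eps_star_eps[OF H(1) l s subgroup.subset[OF M] f(1)] 1 by simp
qed

text \<open>Commuting past the conjugating elements, f acts by the same scalar on every conjugate of
  \<open>eps H \<theta>\<close>.\<close>

lemma central_star_ind_idem:
  assumes M: "subgroup M G"
    and f: "\<And>m. m \<in> M \<Longrightarrow> dl m \<star> f = f \<star> dl m" "f \<star> eps H \<theta> = scl c (eps H \<theta>)"
  shows "f \<star> ind_idem M H \<theta> = scl c (ind_idem M H \<theta>)"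
proof -
  have "f \<star> (dl (inv y) \<star> eps H \<theta> \<star> dl y) = scl c (dl (inv y) \<star> eps H \<theta> \<star> dl y)" if "y \<in> M" for y
  proof -
    have "f \<star> (dl (inv y) \<star> eps H \<theta> \<star> dl y) = f \<star> dl (inv y) \<star> eps H \<theta> \<star> dl y" by (simp add: star_assoc)
    also have "\<dots> = dl (inv y) \<star> f \<star> eps H \<theta> \<star> dl y"
      using f(1)[of "inv y"] subgroup.m_inv_closed[OF M that] by simp
    also have "\<dots> = dl (inv y) \<star> (f \<star> eps H \<theta>) \<star> dl y" by (simp add: star_assoc)
    finally show ?thesis by (simp add: f(2) star_scl_left star_scl_right)
  qed
  then show ?thesis
    by (simp add: ind_idem_def star_scl_right star_sum_right scl_sum[symmetric] scl_scl mult.commute)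
qed

text \<open>As both idempotents are primitive in the centre, their product is a multiple of each of them;
  the two factors agree because the values at \<open>\<one>\<close> do.\<close>
lemma ind_idem_orth:
  assumes M: "subgroup M G" and H: "subgroup H G" "H \<subseteq> M"
    and l: "lin_char G H \<theta>" "shoda M H \<theta>" and l': "lin_char G H \<theta>'" "shoda M H \<theta>'"
    and ne: "ind_idem M H \<theta>' \<noteq> ind_idem M H \<theta>"
  shows "ind_idem M H \<theta>' \<star> eps H \<theta> = 0"
proof -
  let ?e = "ind_idem M H \<theta>" and ?e' = "ind_idem M H \<theta>'"
  obtain c where c: "?e' \<star> eps H \<theta> = scl c (eps H \<theta>)"
    using central_star_eps[OF M H l sup_in_ind_idem[OF M H(2)] ind_idem_central[OF M]] by blast
  obtain c' where c': "?e \<star> eps H \<theta>' = scl c' (eps H \<theta>')"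
    using central_star_eps[OF M H l' sup_in_ind_idem[OF M H(2)] ind_idem_central[OF M]] by blast
  have "?e' \<star> ?e = scl c ?e" by (rule central_star_ind_idem[OF M ind_idem_central[OF M] c])
  moreover have "?e \<star> ?e' = scl c' ?e'" by (rule central_star_ind_idem[OF M ind_idem_central[OF M] c'])
  moreover have "?e' \<star> ?e = ?e \<star> ?e'"
    by (rule star_commute_sup[OF subgroup.subset[OF M] sup_in_ind_idem[OF M H(2)] ind_idem_central[OF M]])
  ultimately have eq: "scl c ?e = scl c' ?e'" by simp
  then have "c * ?e \<one> = c' * ?e' \<one>" by (simp add: scl_def fun_eq_iff)
  then have "c = c'"
    using card_sub_pos[OF M] card_sub_pos[OF H(1)] by (simp add: ind_idem_one[OF M H] l l')
  then have "c * (?e x - ?e' x) = 0" for x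
    using fun_cong[OF eq, of x] by (simp add: scl_def algebra_simps)
  then have "c = 0" using ne by (metis eq_iff_diff_eq_0 ext mult_eq_0_iff)
  then show ?thesis using c by simp
qed

section \<open>Rational primitive central idempotents\<close>

text \<open>\<open>E\<close> is the idempotent of \<open>\<rat>M\<close> that belongs to the character induced from \<open>\<theta>\<close>. The last
  clause stands for primitivity, and it makes all computations with \<open>E\<close> independent of Galois
  groups: an element of \<open>\<rat>G\<close> that kills \<open>\<complex>M eps H \<theta>\<close> kills \<open>E\<close>.\<close>
definition prim :: "'a set \<Rightarrow> 'a set \<Rightarrow> ('a \<Rightarrow> complex) \<Rightarrow> ('a \<Rightarrow> rat) \<Rightarrow> bool" where
  "prim M H \<theta> E \<longleftrightarrow> sup_in M E \<and> (\<forall>m\<in>M. dl m \<star> E = E \<star> dl m) \<and> cr E \<star> eps H \<theta> = eps H \<theta> \<and>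
     (\<forall>f. (\<forall>y\<in>M. cr f \<star> (dl y \<star> eps H \<theta>) = 0) \<longrightarrow> f \<star> E = 0)"

lemma prim_sup: "prim M H \<theta> E \<Longrightarrow> sup_in M E"
  and prim_comm: "prim M H \<theta> E \<Longrightarrow> m \<in> M \<Longrightarrow> dl m \<star> E = E \<star> dl m"
  and prim_eps: "prim M H \<theta> E \<Longrightarrow> cr E \<star> eps H \<theta> = eps H \<theta>"
  and prim_ann: "prim M H \<theta> E \<Longrightarrow> (\<And>y. y \<in> M \<Longrightarrow> cr f \<star> (dl y \<star> eps H \<theta>) = 0) \<Longrightarrow> f \<star> E = 0"
  by (auto simp: prim_def)

lemma cr_comm: "dl m \<star> f = f \<star> dl m \<Longrightarrow> dl m \<star> cr f = cr f \<star> dl m"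
  by (metis cr_dl cr_star)

lemma cr_comm_eps: "dl m \<star> f = f \<star> dl m \<Longrightarrow> cr f \<star> (dl m \<star> x) = dl m \<star> (cr f \<star> x)"
  by (metis cr_comm star_assoc)

text \<open>A central f moves past \<open>dl y\<close>, so the annihilator condition for all y
  reduces to the single equation at \<open>eps H \<theta>\<close>.\<close>

lemma prim_absorb0:
  assumes "prim M H \<theta> E" "\<And>m. m \<in> M \<Longrightarrow> dl m \<star> f = f \<star> dl m" "cr f \<star> eps H \<theta> = 0"
  shows "f \<star> E = 0"
  using assms by (intro prim_ann[OF assms(1)]) (simp add: cr_comm_eps)

text \<open>This is \<open>prim_absorb0\<close> for f - 1.\<close>

lemma prim_absorb:
  assumes M: "subgroup M G" and p: "prim M H \<theta> E" and H: "H \<subseteq> M"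
    and f: "\<And>m. m \<in> M \<Longrightarrow> dl m \<star> f = f \<star> dl m" and e: "cr f \<star> eps H \<theta> = eps H \<theta>"
  shows "f \<star> E = E"
proof -
  have "sup_in (carrier G) E" "sup_in (carrier G) (eps H \<theta>)"
    using prim_sup[OF p] sup_in_eps[of H \<theta>] subgroup.subset[OF M] H by (auto intro: sup_in_mono)
  moreover have "(f - dl \<one>) \<star> E = 0"
  proof (rule prim_absorb0[OF p])
    fix m assume m: "m \<in> M"
    then have "m \<in> carrier G" using M by (simp add: subgroup.mem_carrier)
    then show "dl m \<star> (f - dl \<one>) = (f - dl \<one>) \<star> dl m"
      by (simp add: star_diff_left star_diff_right f[OF m] dl_mult)
  next
    show "cr (f - dl \<one>) \<star> eps H \<theta> = 0"
      using e \<open>sup_in (carrier G) (eps H \<theta>)\<close> by (simp add: cr_diff cr_dl star_diff_left dl_one_star)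
  qed
  ultimately show ?thesis by (simp add: star_diff_left dl_one_star)
qed

lemma prim_idem:
  assumes M: "subgroup M G" and p: "prim M H \<theta> E" and H: "H \<subseteq> M"
  shows "E \<star> E = E"
  by (rule prim_absorb[OF M p H prim_comm[OF p] prim_eps[OF p]])

lemma prim_nz:
  assumes "subgroup H G" "lin_char G H \<theta>" "prim M H \<theta> E"
  shows "E \<noteq> 0"
  using prim_eps[OF assms(3)] eps_nz[OF assms(1,2)] by (metis cr_0 star_0_left)

text \<open>Over the complex numbers f acts on \<open>eps H \<theta>\<close> by a scalar c with c^2
  = c. The two possible values of c correspond to the two absorption lemmas. In this form
  \<open>E\<close> is primitive among the central idempotents of \<rat>M.\<close>

lemma prim_dichotomy:
  assumes M: "subgroup M G" and p: "prim M H \<theta> E" and H: "subgroup H G" "H \<subseteq> M"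
    and l: "lin_char G H \<theta>" "shoda M H \<theta>"
    and f: "sup_in M f" "\<And>m. m \<in> M \<Longrightarrow> dl m \<star> f = f \<star> dl m" "f \<star> f = f"
  shows "f \<star> E = E \<or> f \<star> E = 0"
proof -
  obtain c where c: "cr f \<star> eps H \<theta> = scl c (eps H \<theta>)"
    using central_star_eps[OF M H l, of "cr f"] f(1,2) by (auto simp: sup_in_cr cr_comm)
  have "scl c (eps H \<theta>) = cr f \<star> (cr f \<star> eps H \<theta>)"
    using f(3) c by (metis cr_star star_assoc)
  also have "\<dots> = scl (c * c) (eps H \<theta>)" by (simp add: c star_scl_right scl_scl)
  finally have "scl (c - c * c) (eps H \<theta>) = 0" by (simp add: scl_diff_left)
  then have "c - c * c = 0" using eps_nz[OF H(1) l(1)] by (simp add: scl_eq_0)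
  then have "c * (1 - c) = 0" by (simp add: algebra_simps)
  then have "c = 0 \<or> c = 1" by auto
  then show ?thesis
  proof
    assume "c = 0"
    then have "cr f \<star> eps H \<theta> = 0" using c by simp
    then show ?thesis using prim_absorb0[OF p f(2)] by blast
  next
    assume "c = 1"
    then have "cr f \<star> eps H \<theta> = eps H \<theta>" using c by simp
    then show ?thesis using prim_absorb[OF M p H(2) f(2)] by blast
  qed
qed

text \<open>Both conjugations are demanded, so that passing to \<open>inv g\<close> needs no
  finiteness argument.\<close>

definition normalizes :: "'a \<Rightarrow> 'a set \<Rightarrow> bool" where
  "normalizes g M \<longleftrightarrow> g \<in> carrier G \<and> (\<forall>m\<in>M. g \<otimes> m \<otimes> inv g \<in> M \<and> inv g \<otimes> m \<otimes> g \<in> M)"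

lemma normalizes_inv: "normalizes g M \<Longrightarrow> normalizes (inv g) M"
  by (auto simp: normalizes_def)

lemma sup_in_conj:
  assumes "subgroup M G" "normalizes g M" "sup_in M f"
  shows "sup_in M (dl g \<star> f \<star> dl (inv g))"
proof (unfold sup_in_def, intro allI impI)
  fix x assume x: "x \<notin> M"
  have g: "g \<in> carrier G" using assms(2) by (simp add: normalizes_def)
  show "(dl g \<star> f \<star> dl (inv g)) x = 0"
  proof (cases "x \<in> carrier G")
    case True
    have "inv g \<otimes> x \<otimes> g \<notin> M"
    proof
      assume "inv g \<otimes> x \<otimes> g \<in> M"
      then have "g \<otimes> (inv g \<otimes> x \<otimes> g) \<otimes> inv g \<in> M" using assms(2) by (simp add: normalizes_def)
      moreover have "g \<otimes> (inv g \<otimes> x \<otimes> g) \<otimes> inv g = x"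
        using g True by (metis inv_closed m_assoc m_closed r_inv l_one r_one)
      ultimately show False using x by simp
    qed
    then show ?thesis using conj_apply[OF g True, of f] assms(3) by (simp add: sup_in_def)
  qed (simp add: star_outside)
qed

lemma conj_central:
  assumes "subgroup M G" "normalizes g M" "\<And>m. m \<in> M \<Longrightarrow> dl m \<star> f = f \<star> dl m" "m \<in> M"
  shows "dl m \<star> (dl g \<star> f \<star> dl (inv g)) = (dl g \<star> f \<star> dl (inv g)) \<star> dl m"
proof -
  have g: "g \<in> carrier G" and n: "inv g \<otimes> m \<otimes> g \<in> M"
    using assms(2,4) by (auto simp: normalizes_def)
  have m: "m \<in> carrier G" using assms(1,4) by (rule subgroup.mem_carrier)
  let ?n = "inv g \<otimes> m \<otimes> g"
  have 1: "dl m \<star> dl g = dl g \<star> dl ?n" using g m by (simp add: dl_mult m_assoc[symmetric])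
  have 2: "dl ?n \<star> dl (inv g) = dl (inv g) \<star> dl m" using g m by (simp add: dl_mult m_assoc)
  have "dl m \<star> (dl g \<star> f \<star> dl (inv g)) = dl g \<star> (dl ?n \<star> f) \<star> dl (inv g)"
    using 1 by (metis star_assoc)
  also have "\<dots> = dl g \<star> f \<star> (dl ?n \<star> dl (inv g))"
    using assms(3)[OF n] by (metis star_assoc)
  finally show ?thesis using 2 by (metis star_assoc)
qed

lemma conj_idem:
  assumes "g \<in> carrier G" "sup_in (carrier G) f" "f \<star> f = f"
  shows "(dl g \<star> f \<star> dl (inv g)) \<star> (dl g \<star> f \<star> dl (inv g)) = dl g \<star> f \<star> dl (inv g)"
proof -
  have "dl (inv g) \<star> (dl g \<star> f) = f" using assms by (simp add: dl_cancel_left)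
  then show ?thesis by (metis assms(3) star_assoc)
qed

text \<open>Put F = g E g^-1. The dichotomy for g^-1 yields E g E = 0 or E F = F. In the second case
  F E = 0 is impossible because F is nonzero, so the dichotomy for g gives F E = E, and F = E
  follows without a comparison of dimensions.\<close>

lemma prim_conj_dichotomy:
  assumes M: "subgroup M G" and p: "prim M H \<theta> E" and H: "subgroup H G" "H \<subseteq> M"
    and l: "lin_char G H \<theta>" "shoda M H \<theta>" and n: "normalizes g M"
  shows "dl g \<star> E = E \<star> dl g \<or> E \<star> dl g \<star> E = 0"
proof -
  have g: "g \<in> carrier G" "inv g \<in> carrier G" using n by (auto simp: normalizes_def)
  have sE: "sup_in (carrier G) E" using prim_sup[OF p] subgroup.subset[OF M] by (rule sup_in_mono)
  have iE: "E \<star> E = E" by (rule prim_idem[OF M p H(2)])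
  define F where "F = dl g \<star> E \<star> dl (inv g)"
  define F' where "F' = dl (inv g) \<star> E \<star> dl g"
  have F: "F \<star> E = E \<or> F \<star> E = 0" unfolding F_def
    by (intro prim_dichotomy[OF M p H l] sup_in_conj[OF M n] prim_sup[OF p] conj_idem g sE iE
        conj_central[OF M n] prim_comm[OF p])
  have "(dl (inv g) \<star> E \<star> dl (inv (inv g))) \<star> E = E \<or> (dl (inv g) \<star> E \<star> dl (inv (inv g))) \<star> E = 0"
    by (intro prim_dichotomy[OF M p H l] sup_in_conj[OF M normalizes_inv[OF n]] prim_sup[OF p] conj_idem g sE iE
        conj_central[OF M normalizes_inv[OF n]] prim_comm[OF p])
  then have "F' \<star> E = E \<or> F' \<star> E = 0" using g by (simp add: F'_def)
  then show ?thesis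
  proof
    assume "F' \<star> E = 0"
    moreover have "dl g \<star> (F' \<star> E) = E \<star> dl g \<star> E"
      unfolding F'_def using dl_cancel_left[OF g(2), of "E \<star> (dl g \<star> E)"] g(1)
      by (simp add: star_assoc sup_in_star_carrier)
    ultimately show ?thesis by simp
  next
    assume a: "F' \<star> E = E"
    have "dl g \<star> (F' \<star> E) \<star> dl (inv g) = E \<star> F"
      unfolding F'_def F_def using dl_cancel_left[OF g(2), of "E \<star> (dl g \<star> (E \<star> dl (inv g)))"] g(1)
      by (simp add: star_assoc sup_in_star_carrier)
    then have EF: "E \<star> F = F" using a by (simp add: F_def)
    moreover have FE: "F \<star> E = E \<star> F"
      using star_commute_sup[OF subgroup.subset[OF M] prim_sup[OF p], of F] conj_central[OF M n prim_comm[OF p]]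
      by (simp add: F_def)
    have dF: "dl (inv g) \<star> F \<star> dl g = E"
    proof -
      have "E \<star> dl (inv g) \<star> dl (inv (inv g)) = E" by (rule dl_cancel_right[OF g(2) sE])
      then show ?thesis unfolding F_def
        using dl_cancel_left[OF g(1) sE] g(1) by (metis inv_inv star_assoc)
    qed
    have "F \<star> E \<noteq> 0"
    proof
      assume "F \<star> E = 0"
      then have "F = 0" using FE EF by simp
      then have "E = 0" using dF by simp
      then show False using prim_nz[OF H(1) l(1) p] by simp
    qed
    then have "F = E" using F FE EF by auto
    then have "dl g \<star> E \<star> dl (inv g) \<star> dl g = E \<star> dl g" by (simp add: F_def)
    then show ?thesis using g by (simp add: star_assoc dl_mult star_dl_one sE sup_in_star_carrier)
  qed
qed

lemma normalizes_iff_normal: "subgroup M G \<Longrightarrow> m \<in> M \<Longrightarrow> (\<And>m a. m \<in> M \<Longrightarrow> a \<in> A \<Longrightarrow> m \<otimes> a \<otimes> inv m \<in> A) \<Longrightarrow> normalizes m A"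
  unfolding normalizes_def
  by (metis inv_inv subgroup.m_inv_closed subgroup.mem_carrier)

lemma comm_inv:
  assumes "g \<in> carrier G" "sup_in (carrier G) f" "dl g \<star> f = f \<star> dl g"
  shows "dl (inv g) \<star> f = f \<star> dl (inv g)"
proof -
  have "dl (inv g) \<star> f = dl (inv g) \<star> (f \<star> dl g) \<star> dl (inv g)"
    using dl_cancel_right[OF assms(1) assms(2)] by (metis star_assoc)
  also have "\<dots> = f \<star> dl (inv g)" using dl_cancel_left[OF assms(1) assms(2)] assms(3) by simp
  finally show ?thesis .
qed

end

text \<open>One edge of the path: \<open>M\<close> is H_i, \<open>A\<close> is A_{i+1} with its
  character \<phi>, \<open>L\<close> is the stabilizer H_{i+1}, and (H, \<theta>) belongs to the
  leaf. \<open>E\<close> is the idempotent of the character of \<open>L\<close> induced from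
  \<theta>, and \<open>\<Phi>\<close> is that of \<phi> in \<rat>A; both are known only through
  \<open>prim\<close>.\<close>

locale clifford = finite_group +
  fixes M A L H :: "'a set" and \<phi> \<theta> :: "'a \<Rightarrow> complex" and E \<Phi> :: "'a \<Rightarrow> rat"
  assumes M: "subgroup M G" and A: "subgroup A G" "A \<subseteq> M"
    and A_normal: "\<And>m a. m \<in> M \<Longrightarrow> a \<in> A \<Longrightarrow> m \<otimes> a \<otimes> inv m \<in> A"
    and phi: "lin_char G A \<phi>"
    and L: "subgroup L G" and L_iff: "\<And>h. h \<in> L \<longleftrightarrow> h \<in> M \<and> (\<forall>a\<in>A. \<phi> (h \<otimes> a \<otimes> inv h) = \<phi> a)"
    and H: "subgroup H G" "A \<subseteq> H" "H \<subseteq> L" and theta: "lin_char G H \<theta>" "\<And>a. a \<in> A \<Longrightarrow> \<theta> a = \<phi> a"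
    and shoda: "shoda M H \<theta>"
    and E: "prim L H \<theta> E" and \<Phi>: "prim A A \<phi> \<Phi>"
begin

lemma L_M: "L \<subseteq> M" using L_iff by auto

lemma M_carrier: "m \<in> M \<Longrightarrow> m \<in> carrier G" using M by (rule subgroup.mem_carrier)

lemma A_norm: "m \<in> M \<Longrightarrow> normalizes m A"
  by (rule normalizes_iff_normal[OF M _ A_normal])

lemma shoda_A: "shoda A A \<phi>" by (simp add: shoda_def)

lemma shoda_L: "shoda L H \<theta>" using shoda L_M by (auto simp: shoda_def)

lemma sup_E: "sup_in (carrier G) E"
  using prim_sup[OF E] subgroup.subset[OF L] by (rule sup_in_mono)

lemma sup_Phi: "sup_in (carrier G) \<Phi>"
  using prim_sup[OF \<Phi>] subgroup.subset[OF A(1)] by (rule sup_in_mono)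

lemma E_idem: "E \<star> E = E" by (rule prim_idem[OF L E H(3)])

text \<open>As \<theta> extends \<phi>, each element of \<open>A\<close> contributes 1/|A| to the
  scalar by which \<open>eps A \<phi>\<close> acts on \<open>eps H \<theta>\<close>.\<close>

lemma eps_eps: "eps A \<phi> \<star> eps H \<theta> = eps H \<theta>"
proof -
  have "(\<Sum>h\<in>H. eps A \<phi> h * \<theta> h) = (\<Sum>h\<in>A. eps A \<phi> h * \<theta> h)"
    using H(2) by (intro sum.mono_neutral_right finite_sub[OF H(1)]) (auto simp: eps_def)
  also have "\<dots> = (\<Sum>h\<in>A. 1 / of_nat (card A))"
    by (rule sum.cong) (use lin_char_inv[OF A(1) phi] in \<open>auto simp: eps_def theta(2) divide_simps\<close>)
  also have "\<dots> = 1" using card_sub_pos[OF A(1)] by simp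
  finally show ?thesis
    using star_eps_eq[OF H(1) theta(1) sup_in_mono[OF sup_in_eps H(2)]] by simp
qed

lemma eps_comm:
  assumes h: "h \<in> L"
  shows "dl h \<star> eps A \<phi> = eps A \<phi> \<star> dl h"
proof -
  have hM: "h \<in> M" and hc: "h \<in> carrier G" using h L_M M_carrier by auto
  have "(dl h \<star> eps A \<phi>) x = (eps A \<phi> \<star> dl h) x" if x: "x \<in> carrier G" for x
  proof -
    \<comment> \<open>At x, the two sides are the values of \<open>eps A \<phi>\<close> at inv h y h
      and at y, which the invariance of \<phi> under h compares.\<close>
    define y where "y = x \<otimes> inv h"
    have y: "y \<in> carrier G" "inv h \<otimes> x = inv h \<otimes> y \<otimes> h" using x hc by (auto simp: y_def m_assoc)
    have 1: "inv h \<otimes> y \<otimes> h \<in> A \<longleftrightarrow> y \<in> A"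
    proof
      assume "y \<in> A"
      then show "inv h \<otimes> y \<otimes> h \<in> A" using A_norm[OF hM] by (auto simp: normalizes_def)
    next
      assume "inv h \<otimes> y \<otimes> h \<in> A"
      then have "h \<otimes> (inv h \<otimes> y \<otimes> h) \<otimes> inv h \<in> A" using A_norm[OF hM] by (auto simp: normalizes_def)
      moreover have "h \<otimes> (inv h \<otimes> y \<otimes> h) \<otimes> inv h = y"
        using y(1) hc by (metis inv_closed m_assoc m_closed r_inv l_one r_one)
      ultimately show "y \<in> A" by simp
    qed
    have "\<phi> (inv (inv h \<otimes> y \<otimes> h)) = \<phi> (inv y)" if "y \<in> A"
    proof -
      have "inv (inv h \<otimes> y \<otimes> h) \<in> A" using 1 that by (simp add: subgroup.m_inv_closed[OF A(1)])
      then have "\<phi> (h \<otimes> inv (inv h \<otimes> y \<otimes> h) \<otimes> inv h) = \<phi> (inv (inv h \<otimes> y \<otimes> h))"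
        using h L_iff by auto
      moreover have "h \<otimes> inv (inv h \<otimes> y \<otimes> h) \<otimes> inv h = inv y"
        using y(1) hc by (simp add: inv_mult_group m_assoc) (simp add: m_assoc[symmetric])
      ultimately show ?thesis by simp
    qed
    then show ?thesis using 1 x hc y(2) by (simp add: dl_star star_dl eps_def y_def[symmetric])
  qed
  then show ?thesis by (intro ext) (metis star_outside)
qed

text \<open>Elements of \<open>L\<close> commute with \<open>eps A \<phi>\<close>, which
  \<open>\<Phi>\<close> absorbs. So if the product of \<open>\<Phi>\<close>, h and
  \<open>\<Phi>\<close> were zero, then \<open>eps A \<phi> \<star> dl h\<close> would be zero, too;
  only the other case of the dichotomy remains.\<close>

lemma Phi_comm:
  assumes h: "h \<in> L"
  shows "dl h \<star> \<Phi> = \<Phi> \<star> dl h"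
proof -
  have hM: "h \<in> M" and hc: "h \<in> carrier G" using h L_M M_carrier by auto
  have "\<Phi> \<star> dl h \<star> \<Phi> \<noteq> 0"
  proof
    assume "\<Phi> \<star> dl h \<star> \<Phi> = 0"
    then have "cr \<Phi> \<star> dl h \<star> cr \<Phi> \<star> eps A \<phi> = 0" by (metis cr_0 cr_dl cr_star star_0_left)
    then have "cr \<Phi> \<star> (dl h \<star> eps A \<phi>) = 0" using prim_eps[OF \<Phi>] by (metis star_assoc)
    then have "eps A \<phi> \<star> dl h = 0" using prim_eps[OF \<Phi>] eps_comm[OF h] by (metis star_assoc)
    then have "eps A \<phi> \<star> dl h \<star> dl (inv h) = 0" by simp
    then have "eps A \<phi> = 0"
      using dl_cancel_right[OF hc, of "eps A \<phi>"] sup_in_mono[OF sup_in_eps subgroup.subset[OF A(1)]] by simp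
    then show False using eps_nz[OF A(1) phi] by simp
  qed
  then show ?thesis using prim_conj_dichotomy[OF A(1) \<Phi> A(1) order_refl phi shoda_A A_norm[OF hM]] by simp
qed

text \<open>Because \<open>E\<close> lies under \<open>\<Phi>\<close>, orthogonality of conjugates
  of \<open>\<Phi>\<close> passes to the conjugates of \<open>E\<close>.\<close>

lemma Phi_E: "\<Phi> \<star> E = E"
proof (rule prim_absorb[OF L E H(3) Phi_comm])
  show "cr \<Phi> \<star> eps H \<theta> = eps H \<theta>"
    using prim_eps[OF \<Phi>] eps_eps by (metis star_assoc)
qed

lemma E_Phi: "E \<star> \<Phi> = E"
  using star_commute_sup[OF subgroup.subset[OF L] prim_sup[OF E] Phi_comm] Phi_E by simp

text \<open>The rational \<open>\<Phi>\<close> determines \<phi> only up to Galois conjugacy, but it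
  does determine the kernel. An element that commutes with \<open>\<Phi>\<close> may change \<phi>
  and still preserves its kernel.\<close>

lemma ker_iff: "a \<in> A \<Longrightarrow> dl a \<star> \<Phi> = \<Phi> \<longleftrightarrow> \<phi> a = 1"
proof
  assume a: "a \<in> A" and *: "dl a \<star> \<Phi> = \<Phi>"
  have "dl a \<star> (cr \<Phi> \<star> eps A \<phi>) = cr \<Phi> \<star> eps A \<phi>" using * by (metis cr_dl cr_star star_assoc)
  then have "scl (\<phi> a - 1) (eps A \<phi>) = 0"
    using prim_eps[OF \<Phi>] dl_eps[OF A(1) phi a] by (simp add: scl_diff_left)
  then show "\<phi> a = 1" using eps_nz[OF A(1) phi] by (simp add: scl_eq_0)
next
  assume a: "a \<in> A" and *: "\<phi> a = 1"
  have s: "sup_in (carrier G) (eps A \<phi>)" by (rule sup_in_mono[OF sup_in_eps subgroup.subset[OF A(1)]])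
  have "(dl a - dl \<one>) \<star> \<Phi> = 0"
    by (rule prim_ann[OF \<Phi>])
       (simp add: cr_diff cr_dl dl_eps[OF A(1) phi] star_scl_right star_diff_left dl_one_star a * s)
  then show "dl a \<star> \<Phi> = \<Phi>" by (simp add: star_diff_left dl_one_star sup_Phi)
qed

lemma ker_conj:
  assumes g: "g \<in> M" "dl g \<star> \<Phi> = \<Phi> \<star> dl g" and a: "a \<in> A" "\<phi> a = 1"
  shows "\<phi> (g \<otimes> a \<otimes> inv g) = 1"
proof -
  have gc: "g \<in> carrier G" and ac: "a \<in> carrier G" using g(1) a(1) M_carrier A by auto
  have 1: "dl (g \<otimes> a \<otimes> inv g) \<star> \<Phi> = dl g \<star> dl a \<star> (dl (inv g) \<star> \<Phi>)"
    using gc ac by (simp add: dl_mult star_assoc[symmetric])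
  have 2: "dl (inv g) \<star> \<Phi> = \<Phi> \<star> dl (inv g)" by (rule comm_inv[OF gc sup_Phi g(2)])
  have 3: "dl a \<star> \<Phi> = \<Phi>" using ker_iff a by simp
  have "dl (g \<otimes> a \<otimes> inv g) \<star> \<Phi> = dl g \<star> \<Phi> \<star> dl (inv g)"
    unfolding 1 2 using 3 by (metis star_assoc)
  also have "\<dots> = \<Phi>" using dl_cancel_right[OF gc sup_Phi] g(2) by simp
  finally show ?thesis using ker_iff[OF A_normal[OF g(1) a(1)]] by simp
qed

lemma conj_L:
  assumes g: "g \<in> M" "dl g \<star> \<Phi> = \<Phi> \<star> dl g" and l: "l \<in> L"
  shows "g \<otimes> l \<otimes> inv g \<in> L"
proof -
  have gc: "g \<in> carrier G" and lM: "l \<in> M" and lc: "l \<in> carrier G" using g(1) l L_M M_carrier by auto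
  note mi = subgroup.m_inv_closed[OF M] and mc = subgroup.m_closed[OF M]
  have "\<phi> (g \<otimes> l \<otimes> inv g \<otimes> a \<otimes> inv (g \<otimes> l \<otimes> inv g)) = \<phi> a" if a: "a \<in> A" for a
  proof -
    have ac: "a \<in> carrier G" using a A M_carrier by auto
    \<comment> \<open>The commutator of g l g^-1 with a is the g-conjugate of the commutator of l
      with b. The latter lies in the kernel of \<phi>, which g preserves by
      \<open>ker_conj\<close>.\<close>
    define b where "b = inv g \<otimes> a \<otimes> g"
    have b: "b \<in> A" using a A_norm[OF g(1)] by (simp add: b_def normalizes_def)
    have bc: "b \<in> carrier G" using b A M_carrier by auto
    have ab: "a = g \<otimes> b \<otimes> inv g" using ac gc by (simp add: b_def m_assoc) (simp add: m_assoc[symmetric])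
    have lb: "l \<otimes> b \<otimes> inv l \<in> A" "\<phi> (l \<otimes> b \<otimes> inv l) = \<phi> b" using l b A_normal lM L_iff by auto
    have "inv b \<in> A" using b A(1) by (simp add: subgroup.m_inv_closed)
    then have "\<phi> (l \<otimes> b \<otimes> inv l \<otimes> inv b) = 1"
      using lin_char_mult[OF phi lb(1), of "inv b"] lb(2) lin_char_inv[OF A(1) phi b] by (simp add: mult.commute)
    moreover have cA: "l \<otimes> b \<otimes> inv l \<otimes> inv b \<in> A"
      using lb(1) \<open>inv b \<in> A\<close> by (simp add: subgroup.m_closed[OF A(1)])
    ultimately have 1: "\<phi> (g \<otimes> (l \<otimes> b \<otimes> inv l \<otimes> inv b) \<otimes> inv g) = 1"
      by (intro ker_conj g)
    have 2: "g \<otimes> (l \<otimes> b \<otimes> inv l \<otimes> inv b) \<otimes> inv g \<in> A" using g(1) cA by (rule A_normal)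
    have "g \<otimes> l \<otimes> inv g \<otimes> a \<otimes> inv (g \<otimes> l \<otimes> inv g) = g \<otimes> (l \<otimes> b \<otimes> inv l \<otimes> inv b) \<otimes> inv g \<otimes> a"
      unfolding ab using gc lc bc by (simp add: inv_mult_group m_assoc inv_solve_left' inv_solve_right')
        (simp add: m_assoc[symmetric])
    then show ?thesis using lin_char_mult[OF phi 2 a] 1 by simp
  qed
  then show ?thesis using L_iff g(1) lM mi mc by simp
qed

lemma normalizes_L:
  assumes g: "g \<in> M" "dl g \<star> \<Phi> = \<Phi> \<star> dl g"
  shows "normalizes g L"
proof -
  have gc: "g \<in> carrier G" using g M_carrier by auto
  have i: "dl (inv g) \<star> \<Phi> = \<Phi> \<star> dl (inv g)" by (rule comm_inv[OF gc sup_Phi g(2)])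
  show ?thesis
    using conj_L[OF g] conj_L[OF subgroup.m_inv_closed[OF M g(1)] i] gc by (simp add: normalizes_def)
qed

text \<open>Conjugation by \<open>g\<close> maps \<open>\<Phi>\<close> to itself or to an idempotent orthogonal to it. In the first case
  \<open>g\<close> normalizes the kernel of \<open>\<phi>\<close>, and hence \<open>L\<close>, which consists of the \<open>h \<in> M\<close> with
  \<open>[h, A]\<close> contained in this kernel.\<close>
lemma E_conj_dichotomy:
  assumes g: "g \<in> M"
  shows "(dl g \<star> E = E \<star> dl g \<and> normalizes g L) \<or> E \<star> dl g \<star> E = 0"
proof (cases "dl g \<star> \<Phi> = \<Phi> \<star> dl g")
  case True
  then have "normalizes g L" by (rule normalizes_L[OF g])
  then show ?thesis using prim_conj_dichotomy[OF L E H(1,3) theta(1) shoda_L] by blast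
next
  case False
  then have "\<Phi> \<star> dl g \<star> \<Phi> = 0"
    using prim_conj_dichotomy[OF A(1) \<Phi> A(1) order_refl phi shoda_A A_norm[OF g]] by simp
  then have "E \<star> (\<Phi> \<star> dl g \<star> \<Phi>) \<star> E = 0" by simp
  then have "E \<star> \<Phi> \<star> dl g \<star> (\<Phi> \<star> E) = 0" by (simp add: star_assoc)
  then show ?thesis by (simp add: Phi_E E_Phi)
qed

text \<open>In the orthogonal case, E g = E E g = E g E = 0 would force \<open>E\<close> to
  vanish.\<close>

lemma comm_normalizes:
  assumes g: "g \<in> M" "dl g \<star> E = E \<star> dl g"
  shows "normalizes g L"
proof (rule ccontr)
  assume "\<not> normalizes g L"
  then have "E \<star> dl g \<star> E = 0" using E_conj_dichotomy[OF g(1)] by simp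
  then have "E \<star> dl g = 0" using g(2) E_idem by (metis star_assoc)
  then have "E \<star> dl g \<star> dl (inv g) = 0" by simp
  then have "E = 0" using dl_cancel_right[OF M_carrier[OF g(1)] sup_E] by simp
  then show False using prim_nz[OF H(1) theta(1) E] by simp
qed

lemma E_dichotomy: "g \<in> M \<Longrightarrow> dl g \<star> E \<noteq> E \<star> dl g \<Longrightarrow> E \<star> dl g \<star> E = 0"
  using E_conj_dichotomy by blast

definition C :: "'a set" where
  "C = {g \<in> M. dl g \<star> E = E \<star> dl g}"

lemma C_M: "C \<subseteq> M" by (auto simp: C_def)

lemma L_C: "L \<subseteq> C" using L_M prim_comm[OF E] by (auto simp: C_def)

lemma C_comm: "g \<in> C \<Longrightarrow> dl g \<star> E = E \<star> dl g" by (simp add: C_def)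

lemma C_carrier: "g \<in> C \<Longrightarrow> g \<in> carrier G" using C_M M_carrier by auto

lemma C_subgroup: "subgroup C G"
proof (rule subgroupI)
  show "C \<subseteq> carrier G" using C_carrier by auto
  show "C \<noteq> {}" using L_C subgroup.one_closed[OF L] by auto
next
  fix a assume "a \<in> C"
  then show "inv a \<in> C" using comm_inv[OF C_carrier sup_E C_comm] subgroup.m_inv_closed[OF M]
    by (auto simp: C_def)
next
  fix a b assume ab: "a \<in> C" "b \<in> C"
  have "dl (a \<otimes> b) \<star> E = E \<star> dl (a \<otimes> b)"
    using ab C_carrier C_comm[OF ab(1)] C_comm[OF ab(2)] by (metis dl_mult star_assoc)
  then show "a \<otimes> b \<in> C" using ab subgroup.m_closed[OF M] by (auto simp: C_def)
qed

lemma C_normalizes: "g \<in> C \<Longrightarrow> normalizes g L"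
  using comm_normalizes by (auto simp: C_def)

lemma conj_E_star_E:
  assumes y: "y \<in> M"
  shows "dl (inv y) \<star> E \<star> dl y \<star> E = (if y \<in> C then E else 0)"
proof (cases "y \<in> C")
  case True
  have "dl (inv y) \<star> E \<star> dl y \<star> E = dl (inv y) \<star> (dl y \<star> E) \<star> E"
    using C_comm[OF True] by (metis star_assoc)
  also have "\<dots> = E" using dl_cancel_left[OF C_carrier[OF True] sup_E] E_idem by simp
  finally show ?thesis using True by simp
next
  case False
  then have "E \<star> dl y \<star> E = 0" using E_dichotomy[OF y] y by (auto simp: C_def)
  then show ?thesis using False by (simp add: star_assoc)
qed

text \<open>The factor is 1/|C| because every distinct conjugate of \<open>E\<close> occurs |C|
  times among the y in \<open>M\<close>. The sum F fixes \<open>E\<close>, so it is absorbed by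
  \<open>EM\<close>; conversely \<open>EM\<close> fixes \<open>E\<close> and with it all conjugates,
  so EM F = F. Both are central, hence equal.\<close>

lemma prim_M_eq_sum:
  assumes EM: "prim M H \<theta> EM"
  shows "EM = scl (1 / of_nat (card C)) (\<Sum>y\<in>M. dl (inv y) \<star> E \<star> dl y)"
proof -
  define F where "F = scl (1 / of_nat (card C)) (\<Sum>y\<in>M. dl (inv y) \<star> E \<star> dl y)"
  have F_comm: "dl m \<star> F = F \<star> dl m" if "m \<in> M" for m
    by (simp add: F_def star_scl_left star_scl_right sum_conj_central[OF M that])
  have F_sup: "sup_in M F" unfolding F_def
    by (intro sup_in_scl sup_in_sum sup_in_star[OF M] sup_in_mono[OF prim_sup[OF E] L_M])
       (auto simp: sup_in_dl subgroup.m_inv_closed[OF M])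
  have "(\<Sum>y\<in>M. dl (inv y) \<star> E \<star> dl y) \<star> E = (\<Sum>y\<in>M. if y \<in> C then E else 0)"
    by (simp add: star_sum_left conj_E_star_E)
  also have "\<dots> = (\<Sum>y\<in>C. E)"
    using sum.inter_restrict[OF finite_sub[OF M], of "\<lambda>_. E" C] C_M by (simp add: Int_absorb1)
  finally have "(\<Sum>y\<in>M. dl (inv y) \<star> E \<star> dl y) \<star> E = scl (of_nat (card C)) E"
    by (simp only: sum_scl_const)
  then have FE: "F \<star> E = E"
    using card_sub_pos[OF C_subgroup] by (simp add: F_def star_scl_left scl_scl)
  have "cr F \<star> eps H \<theta> = eps H \<theta>"
    using FE prim_eps[OF E] by (metis cr_star star_assoc)
  then have 1: "F \<star> EM = EM"
    using prim_absorb[OF M EM _ F_comm] H(3) L_M by blast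
  have "EM \<star> E = E"
    by (rule prim_absorb[OF L E H(3) _ prim_eps[OF EM]]) (use prim_comm[OF EM] L_M in blast)
  then have "EM \<star> (dl (inv y) \<star> E \<star> dl y) = dl (inv y) \<star> E \<star> dl y" if "y \<in> M" for y
    using prim_comm[OF EM, of "inv y"] subgroup.m_inv_closed[OF M that] by (metis star_assoc)
  then have 2: "EM \<star> F = F" by (simp add: F_def star_scl_right star_sum_right)
  have "F \<star> EM = EM \<star> F" by (rule star_commute_sup[OF subgroup.subset[OF M] F_sup prim_comm[OF EM]])
  then show ?thesis using 1 2 by (simp add: F_def)
qed

text \<open>The conjugate y^-1 E y depends only on the right coset C y.\<close>

lemma prim_M_eq_sum_reps:
  assumes EM: "prim M H \<theta> EM" and s: "bij_betw (\<lambda>(c, i). c \<otimes> s i) (C \<times> {..<k}) M"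
    and sM: "\<And>i. i < k \<Longrightarrow> s i \<in> M"
  shows "EM = (\<Sum>i<k. dl (inv (s i)) \<star> E \<star> dl (s i))"
proof -
  let ?t = "\<lambda>y. dl (inv y) \<star> E \<star> dl y"
  have t: "?t (c \<otimes> s i) = ?t (s i)" if c: "c \<in> C" and i: "i < k" for c i
  proof -
    have cc: "c \<in> carrier G" and ic: "s i \<in> carrier G" using C_carrier M_carrier c sM[OF i] by auto
    have 1: "dl (inv (c \<otimes> s i)) = dl (inv (s i)) \<star> dl (inv c)" and 2: "dl (c \<otimes> s i) = dl c \<star> dl (s i)"
      using cc ic by (simp_all add: dl_mult inv_mult_group)
    have "?t (c \<otimes> s i) = dl (inv (s i)) \<star> (dl (inv c) \<star> (E \<star> dl c)) \<star> dl (s i)"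
      unfolding 1 2 by (simp add: star_assoc)
    also have "dl (inv c) \<star> (E \<star> dl c) = E"
      using dl_cancel_left[OF cc sup_E] C_comm[OF c] by simp
    finally show ?thesis .
  qed
  have "(\<Sum>y\<in>M. ?t y) = (\<Sum>(c, i)\<in>C \<times> {..<k}. ?t (c \<otimes> s i))"
    using sum.reindex_bij_betw[OF s, of ?t] by (simp add: case_prod_unfold)
  also have "\<dots> = (\<Sum>c\<in>C. \<Sum>i<k. ?t (c \<otimes> s i))" by (simp add: sum.cartesian_product)
  also have "\<dots> = (\<Sum>c\<in>C. \<Sum>i<k. ?t (s i))" using t by (intro sum.cong refl) auto
  also have "\<dots> = scl (of_nat (card C)) (\<Sum>i<k. ?t (s i))" by (rule sum_scl_const)
  finally show ?thesis
    using prim_M_eq_sum[OF EM] card_sub_pos[OF C_subgroup] by (simp add: scl_scl)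
qed

end

text \<open>Right cosets are taken because y^-1 E y is constant on them; numbering the
  representatives makes them usable as matrix indices.\<close>

lemma (in finite_group) coset_reps:
  assumes C: "subgroup C G" and M: "subgroup M G" and CM: "C \<subseteq> M"
  obtains s where "bij_betw (\<lambda>(c, i). c \<otimes> s i) (C \<times> {..<card M div card C}) M"
    "\<And>i. i < card M div card C \<Longrightarrow> s i \<in> M"
proof -
  note mem = subgroup.mem_carrier[OF M] and memC = subgroup.mem_carrier[OF C]
  define S where "S = (\<lambda>y. C #> y) ` M"
  have fS: "finite S" using finite_sub[OF M] by (simp add: S_def)
  have sub: "D \<subseteq> M" if "D \<in> S" for D
    using that CM subgroup.m_closed[OF M] by (auto simp: S_def r_coset_def)
  have cd: "card D = card C" if "D \<in> S" for D
  proof -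
    have "D \<in> rcosets C" using that mem by (auto simp: S_def RCOSETS_def)
    then show ?thesis using card_cosets_equal[OF _ subgroup.subset[OF C]] bij_betw_same_card by metis
  qed
  have un: "\<Union>S = M"
    using sub subgroup.one_closed[OF C] mem rcos_self[OF _ C] by (fastforce simp: S_def)
  have dis: "pairwise disjnt S"
    using rcos_disjoint[OF C] mem by (auto simp: S_def pairwise_def disjnt_def RCOSETS_def)
  have "card M = card C * card S"
    using card_partition[OF fS _ cd] finite_sub[OF M] un dis by (auto simp: pairwise_def disjnt_def)
  then have k: "card M div card C = card S" using card_sub_pos[OF C] by simp
  obtain e where e: "bij_betw e {..<card S} S"
    using ex_bij_betw_nat_finite[OF fS] by (auto simp: atLeast0LessThan)
  define s where "s i = (SOME y. y \<in> M \<and> e i = C #> y)" for i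
  have s: "s i \<in> M \<and> e i = C #> s i" if "i < card S" for i
    unfolding s_def by (rule someI_ex) (use bij_betwE[OF e] that in \<open>auto simp: S_def\<close>)
  have "bij_betw (\<lambda>(c, i). c \<otimes> s i) (C \<times> {..<card S}) M"
    unfolding bij_betw_def
  proof
    show "inj_on (\<lambda>(c, i). c \<otimes> s i) (C \<times> {..<card S})"
    proof (rule inj_onI, clarsimp)
      fix c i c' i' assume a: "c \<in> C" "i < card S" "c' \<in> C" "i' < card S" "c \<otimes> s i = c' \<otimes> s i'"
      have "c \<otimes> s i \<in> e i" "c \<otimes> s i \<in> e i'"
        using a s[of i] s[of i'] by (metis UN_I r_coset_def singletonI)+
      moreover have "e i \<in> S" "e i' \<in> S" using bij_betwE[OF e] a by auto
      ultimately have "e i = e i'" using dis by (auto simp: pairwise_def disjnt_def)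
      then have "i = i'" using e a by (auto simp: bij_betw_def inj_on_def)
      then show "c = c' \<and> i = i'" using a s[OF a(2)] mem memC by auto
    qed
    show "(\<lambda>(c, i). c \<otimes> s i) ` (C \<times> {..<card S}) = M"
    proof
      show "(\<lambda>(c, i). c \<otimes> s i) ` (C \<times> {..<card S}) \<subseteq> M"
        using s CM subgroup.m_closed[OF M] by auto
      show "M \<subseteq> (\<lambda>(c, i). c \<otimes> s i) ` (C \<times> {..<card S})"
      proof
        fix y assume "y \<in> M"
        then obtain i where i: "i < card S" "y \<in> e i" using un e by (auto simp: bij_betw_def)
        then obtain c where "c \<in> C" "y = c \<otimes> s i" using s[OF i(1)] by (auto simp: r_coset_def)
        then show "y \<in> (\<lambda>(c, i). c \<otimes> s i) ` (C \<times> {..<card S})" using i by force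
      qed
    qed
  qed
  then show thesis using that[of s] s k by simp
qed

section \<open>Galois groups of subfields of cyclotomic fields\<close>

text \<open>Names the closure condition inside \<open>genfield\<close>. As
  \<open>inverse 0 = 0\<close>, closure under inverses needs no exception.\<close>

definition subfield_C :: "complex set \<Rightarrow> bool" where
  "subfield_C F \<longleftrightarrow> 0 \<in> F \<and> 1 \<in> F \<and>
     (\<forall>x\<in>F. \<forall>y\<in>F. x + y \<in> F \<and> x - y \<in> F \<and> x * y \<in> F) \<and> (\<forall>x\<in>F. inverse x \<in> F)"

lemma genfield_least: "subfield_C F \<Longrightarrow> S \<subseteq> F \<Longrightarrow> genfield S \<subseteq> F"
  unfolding genfield_def subfield_C_def by (intro Inter_lower) auto

lemma genfield_subset: "S \<subseteq> genfield S"
  unfolding genfield_def by auto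

lemma subfield_genfield: "subfield_C (genfield S)"
  unfolding genfield_def subfield_C_def by auto

lemma subfield_add: "subfield_C F \<Longrightarrow> x \<in> F \<Longrightarrow> y \<in> F \<Longrightarrow> x + y \<in> F"
  and subfield_diff: "subfield_C F \<Longrightarrow> x \<in> F \<Longrightarrow> y \<in> F \<Longrightarrow> x - y \<in> F"
  and subfield_mult: "subfield_C F \<Longrightarrow> x \<in> F \<Longrightarrow> y \<in> F \<Longrightarrow> x * y \<in> F"
  and subfield_inverse: "subfield_C F \<Longrightarrow> x \<in> F \<Longrightarrow> inverse x \<in> F"
  and subfield_0: "subfield_C F \<Longrightarrow> 0 \<in> F"
  and subfield_1: "subfield_C F \<Longrightarrow> 1 \<in> F"
  by (auto simp: subfield_C_def)

lemma subfield_power: "subfield_C F \<Longrightarrow> x \<in> F \<Longrightarrow> x ^ n \<in> F"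
  by (induction n) (auto intro: subfield_1 subfield_mult)

lemma subfield_sum: "subfield_C F \<Longrightarrow> (\<And>i. i \<in> I \<Longrightarrow> f i \<in> F) \<Longrightarrow> sum f I \<in> F"
  by (induction I rule: infinite_finite_induct) (auto intro: subfield_0 subfield_add)

lemma subfield_of_nat: "subfield_C F \<Longrightarrow> of_nat n \<in> F"
  by (induction n) (auto intro: subfield_0 subfield_1 subfield_add)

lemma subfield_divide: "subfield_C F \<Longrightarrow> x \<in> F \<Longrightarrow> y \<in> F \<Longrightarrow> x / y \<in> F"
  by (simp add: divide_inverse subfield_mult subfield_inverse)

lemma subfield_of_rat:
  assumes "subfield_C F"
  shows "of_rat q \<in> F"
proof (cases q)
  case (Fract a b)
  have "of_int i \<in> F" for i
  proof (cases i)
    case (nonneg n)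
    then show ?thesis using subfield_of_nat[OF assms] by simp
  next
    case (neg n)
    then have "of_int i = 0 - (of_nat (Suc n) :: complex)" by simp
    then show ?thesis using subfield_diff[OF assms subfield_0[OF assms] subfield_of_nat[OF assms, of "Suc n"]] by simp
  qed
  then show ?thesis using Fract by (simp add: of_rat_rat subfield_divide[OF assms])
qed

text \<open>Field endomorphisms are extended by the identity, as in \<open>Gal\<close>, so that
  equal functions are equal endomorphisms. Surjectivity is not part of the notion; for the fields
  generated by a stable finite set it is derived in \<open>fhom_image_F\<close>.\<close>

definition fhom :: "complex set \<Rightarrow> (complex \<Rightarrow> complex) \<Rightarrow> bool" where
  "fhom K \<gamma> \<longleftrightarrow> \<gamma> ` K \<subseteq> K \<and> (\<forall>x\<in>K. \<forall>y\<in>K. \<gamma> (x + y) = \<gamma> x + \<gamma> y \<and> \<gamma> (x * y) = \<gamma> x * \<gamma> y) \<and>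
     \<gamma> 1 = 1 \<and> (\<forall>x. x \<notin> K \<longrightarrow> \<gamma> x = x)"

lemma fhom_in: "fhom K \<gamma> \<Longrightarrow> x \<in> K \<Longrightarrow> \<gamma> x \<in> K"
  and fhom_add: "fhom K \<gamma> \<Longrightarrow> x \<in> K \<Longrightarrow> y \<in> K \<Longrightarrow> \<gamma> (x + y) = \<gamma> x + \<gamma> y"
  and fhom_mult: "fhom K \<gamma> \<Longrightarrow> x \<in> K \<Longrightarrow> y \<in> K \<Longrightarrow> \<gamma> (x * y) = \<gamma> x * \<gamma> y"
  and fhom_1: "fhom K \<gamma> \<Longrightarrow> \<gamma> 1 = 1"
  and fhom_out: "fhom K \<gamma> \<Longrightarrow> x \<notin> K \<Longrightarrow> \<gamma> x = x"
  by (auto simp: fhom_def)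

lemma fhom_0: "subfield_C K \<Longrightarrow> fhom K \<gamma> \<Longrightarrow> \<gamma> 0 = 0"
  using fhom_add[of K \<gamma> 0 0] subfield_0 by auto

lemma fhom_diff:
  assumes "subfield_C K" "fhom K \<gamma>" "x \<in> K" "y \<in> K"
  shows "\<gamma> (x - y) = \<gamma> x - \<gamma> y"
  using fhom_add[OF assms(2) subfield_diff[OF assms(1,3,4)] assms(4)] by simp

lemma fhom_power:
  assumes "subfield_C K" "fhom K \<gamma>" "x \<in> K"
  shows "\<gamma> (x ^ n) = \<gamma> x ^ n"
  by (induction n) (simp_all add: fhom_1[OF assms(2)] fhom_mult[OF assms(2,3) subfield_power[OF assms(1,3)]])

lemma fhom_sum:
  assumes "subfield_C K" "fhom K \<gamma>" "\<And>i. i \<in> I \<Longrightarrow> f i \<in> K"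
  shows "\<gamma> (sum f I) = (\<Sum>i\<in>I. \<gamma> (f i))"
  using assms(3)
proof (induction I rule: infinite_finite_induct)
  case (insert x F)
  then show ?case using fhom_add[OF assms(2), of "f x" "sum f F"] subfield_sum[OF assms(1), of F f] by auto
qed (auto simp: fhom_0[OF assms(1,2)])

lemma fhom_inverse:
  assumes "subfield_C K" "fhom K \<gamma>" "x \<in> K"
  shows "\<gamma> (inverse x) = inverse (\<gamma> x)"
proof (cases "x = 0")
  case False
  then have "\<gamma> x * \<gamma> (inverse x) = 1"
    using fhom_mult[OF assms(2,3) subfield_inverse[OF assms(1,3)]] fhom_1[OF assms(2)] by simp
  then show ?thesis by (metis inverse_unique)
qed (simp add: fhom_0[OF assms(1,2)])

lemma fhom_eq_0:
  assumes "subfield_C K" "fhom K \<gamma>" "x \<in> K" "\<gamma> x = 0"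
  shows "x = 0"
proof (rule ccontr)
  assume "x \<noteq> 0"
  then have "\<gamma> x * \<gamma> (inverse x) = 1"
    using fhom_mult[OF assms(2,3) subfield_inverse[OF assms(1,3)]] fhom_1[OF assms(2)] by simp
  then show False using assms(4) by simp
qed

lemma fhom_inj:
  assumes "subfield_C K" "fhom K \<gamma>"
  shows "inj_on \<gamma> K"
proof (rule inj_onI)
  fix x y assume "x \<in> K" "y \<in> K" "\<gamma> x = \<gamma> y"
  then show "x = y"
    using fhom_eq_0[OF assms subfield_diff[OF assms(1)], of x y] fhom_diff[OF assms, of x y] by simp
qed

lemma fhom_of_nat:
  assumes "subfield_C K" "fhom K \<gamma>"
  shows "\<gamma> (of_nat n) = of_nat n"
  by (induction n)
     (simp_all add: fhom_0[OF assms] fhom_1[OF assms(2)] fhom_add[OF assms(2) subfield_1[OF assms(1)] subfield_of_nat[OF assms(1)]])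

lemma fhom_of_rat:
  assumes "subfield_C K" "fhom K \<gamma>"
  shows "\<gamma> (of_rat q) = of_rat q"
proof (cases q)
  case (Fract a b)
  have i: "(of_int i :: complex) \<in> K \<and> \<gamma> (of_int i) = of_int i" for i
  proof (cases i)
    case (nonneg n)
    then show ?thesis using subfield_of_nat[OF assms(1)] fhom_of_nat[OF assms] by simp
  next
    case (neg n)
    then have "of_int i = 0 - (of_nat (Suc n) :: complex)" by simp
    then show ?thesis
      using fhom_diff[OF assms subfield_0[OF assms(1)] subfield_of_nat[OF assms(1), of "Suc n"]]
        subfield_diff[OF assms(1) subfield_0[OF assms(1)] subfield_of_nat[OF assms(1), of "Suc n"]]
        fhom_0[OF assms] fhom_of_nat[OF assms, of "Suc n"] by metis
  qed
  have "\<gamma> (of_int a / of_int b) = of_int a / of_int b"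
    using i[of a] i[of b] fhom_mult[OF assms(2), of "of_int a" "inverse (of_int b)"]
      subfield_inverse[OF assms(1), of "of_int b"] fhom_inverse[OF assms, of "of_int b"]
    by (simp add: divide_inverse)
  then show ?thesis using Fract by (simp add: of_rat_rat)
qed

lemma fhom_comp: "fhom K \<gamma> \<Longrightarrow> fhom K \<delta> \<Longrightarrow> fhom K (\<gamma> \<circ> \<delta>)"
  unfolding fhom_def by (auto simp: image_subset_iff)

lemma fhom_id: "fhom K id"
  by (auto simp: fhom_def)

text \<open>Only \<open>\<sigma> 1 = 1\<close> has to be derived: \<open>\<sigma> 1\<close> is
  idempotent, and it is nonzero because \<sigma> is injective.\<close>

lemma Gal_imp_fhom:
  assumes "\<sigma> \<in> Gal S"
  shows "fhom (genfield S) \<sigma>"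
proof -
  let ?F = "genfield S"
  have s: "bij_betw \<sigma> ?F ?F" "\<And>x y. x \<in> ?F \<Longrightarrow> y \<in> ?F \<Longrightarrow> \<sigma> (x * y) = \<sigma> x * \<sigma> y"
    "\<And>x y. x \<in> ?F \<Longrightarrow> y \<in> ?F \<Longrightarrow> \<sigma> (x + y) = \<sigma> x + \<sigma> y"
    using assms by (auto simp: Gal_def)
  have 01: "0 \<in> ?F" "1 \<in> ?F" using subfield_genfield by (auto intro: subfield_0 subfield_1)
  have "\<sigma> 0 = 0" using s(3)[OF 01(1) 01(1)] by simp
  moreover have "\<sigma> 1 \<noteq> \<sigma> 0"
    using inj_onD[OF bij_betw_imp_inj_on[OF s(1)] _ 01(2) 01(1)] by fastforce
  ultimately have "\<sigma> 1 = 1" using s(2)[OF 01(2) 01(2)] by simp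
  then show ?thesis using assms by (auto simp: fhom_def Gal_def bij_betw_def)
qed

lemma inj_comp_left: "inj f \<Longrightarrow> inj_on ((\<circ>) f) A"
  by (auto simp: inj_on_def fun_eq_iff)

lemma Gal_iff: "\<sigma> \<in> Gal S \<longleftrightarrow> fhom (genfield S) \<sigma> \<and> \<sigma> ` genfield S = genfield S"
proof
  assume "\<sigma> \<in> Gal S"
  then show "fhom (genfield S) \<sigma> \<and> \<sigma> ` genfield S = genfield S"
    using Gal_imp_fhom by (auto simp: Gal_def bij_betw_def)
next
  assume "fhom (genfield S) \<sigma> \<and> \<sigma> ` genfield S = genfield S"
  then show "\<sigma> \<in> Gal S"
    using fhom_inj[OF subfield_genfield] by (auto simp: fhom_def Gal_def bij_betw_def)
qed

text \<open>Substituting y x for x and subtracting \<tau> y times the given relation eliminates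
  \<tau>; induction then kills the coefficient of any \<rho> that differs from \<tau> at y.
  Multiplicativity is assumed on \<open>F\<close> only, since the elements of \<open>Gal\<close> are
  the identity elsewhere.\<close>

lemma dedekind_independence:
  fixes T :: "('a::monoid_mult \<Rightarrow> 'b::idom) set"
  assumes "finite T" and F: "1 \<in> F" "\<And>x y. x \<in> F \<Longrightarrow> y \<in> F \<Longrightarrow> x * y \<in> F"
    and "\<And>\<sigma>. \<sigma> \<in> T \<Longrightarrow> \<sigma> 1 = 1 \<and> (\<forall>x\<in>F. \<forall>y\<in>F. \<sigma> (x * y) = \<sigma> x * \<sigma> y)"
    and "\<And>\<sigma> \<tau>. \<sigma> \<in> T \<Longrightarrow> \<tau> \<in> T \<Longrightarrow> \<sigma> \<noteq> \<tau> \<Longrightarrow> \<exists>y\<in>F. \<sigma> y \<noteq> \<tau> y"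
    and "\<And>x. x \<in> F \<Longrightarrow> (\<Sum>\<sigma>\<in>T. c \<sigma> * \<sigma> x) = 0"
    and "\<sigma> \<in> T"
  shows "c \<sigma> = 0"
  using assms(1,4-7)
proof (induction T arbitrary: c \<sigma> rule: finite_induct)
  case (insert \<tau> T)
  have z: "c \<rho> = 0" if \<rho>: "\<rho> \<in> T" for \<rho>
  proof -
    obtain y where y: "y \<in> F" "\<rho> y \<noteq> \<tau> y"
      using insert.prems(2)[of \<rho> \<tau>] insert.hyps(2) \<rho> by auto
    have "c \<rho> * (\<rho> y - \<tau> y) = 0"
    proof (rule insert.IH[where c="\<lambda>\<rho>. c \<rho> * (\<rho> y - \<tau> y)"])
      fix x assume x: "x \<in> F"
      have "(\<Sum>\<sigma>\<in>insert \<tau> T. c \<sigma> * \<sigma> (y * x)) - \<tau> y * (\<Sum>\<sigma>\<in>insert \<tau> T. c \<sigma> * \<sigma> x)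
          = (\<Sum>\<sigma>\<in>insert \<tau> T. c \<sigma> * (\<sigma> y - \<tau> y) * \<sigma> x)"
        unfolding sum_distrib_left sum_subtractf[symmetric]
      proof (rule sum.cong[OF refl])
        fix \<sigma> assume "\<sigma> \<in> insert \<tau> T"
        then have *: "\<sigma> (y * x) = \<sigma> y * \<sigma> x" using x y(1) insert.prems(1) by blast
        show "c \<sigma> * \<sigma> (y * x) - \<tau> y * (c \<sigma> * \<sigma> x) = c \<sigma> * (\<sigma> y - \<tau> y) * \<sigma> x"
          unfolding * by (simp add: algebra_simps)
      qed
      then have "0 = (\<Sum>\<sigma>\<in>insert \<tau> T. c \<sigma> * (\<sigma> y - \<tau> y) * \<sigma> x)"
        using insert.prems(3)[OF F(2)[OF y(1) x]] insert.prems(3)[OF x] by simp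
      then show "(\<Sum>\<sigma>\<in>T. c \<sigma> * (\<sigma> y - \<tau> y) * \<sigma> x) = 0"
        using insert.hyps by simp
    qed (use insert.prems \<rho> in auto)
    then show ?thesis using y by simp
  qed
  have "(\<Sum>\<sigma>\<in>insert \<tau> T. c \<sigma> * \<sigma> 1) = 0" using insert.prems(3) F(1) by blast
  then have "c \<tau> = 0" using insert.hyps insert.prems(1)[of \<tau>] z by simp
  then show ?case using z insert.prems(4) by auto
qed simp

section \<open>Rational polynomials at complex arguments, and cyclotomic fields\<close>

definition rpoly :: "rat poly \<Rightarrow> complex \<Rightarrow> complex" where
  "rpoly f z = poly (map_poly of_rat f) z"

lemma rpoly_0 [simp]: "rpoly 0 z = 0"
  by (simp add: rpoly_def)

lemma rpoly_pCons [simp]: "rpoly (pCons a p) z = of_rat a + z * rpoly p z"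
  by (simp add: rpoly_def map_poly_pCons)

lemma rpoly_add [simp]: "rpoly (p + q) z = rpoly p z + rpoly q z"
  by (induction p q rule: poly_induct2) (simp_all add: of_rat_add algebra_simps)

lemma rpoly_smult [simp]: "rpoly (smult a p) z = of_rat a * rpoly p z"
  by (induction p) (simp_all add: of_rat_mult algebra_simps)

lemma rpoly_mult [simp]: "rpoly (p * q) z = rpoly p z * rpoly q z"
  by (induction p) (simp_all add: algebra_simps)

lemma rpoly_diff [simp]: "rpoly (p - q) z = rpoly p z - rpoly q z"
  using rpoly_add[of "p - q" q z] by simp

lemma rpoly_1 [simp]: "rpoly 1 z = 1"
  by (simp add: one_pCons)

lemma rpoly_monom [simp]: "rpoly (monom 1 n) z = z ^ n"
  by (induction n) (simp_all add: monom_Suc monom_0)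

lemma rpoly_subfield: "subfield_C F \<Longrightarrow> z \<in> F \<Longrightarrow> rpoly f z \<in> F"
  by (induction f) (auto intro: subfield_0 subfield_add subfield_mult subfield_of_rat)

lemma fhom_rpoly:
  assumes "subfield_C K" "fhom K \<gamma>" "x \<in> K"
  shows "\<gamma> (rpoly f x) = rpoly f (\<gamma> x)"
proof (induction f)
  case 0
  then show ?case by (simp add: fhom_0[OF assms(1,2)])
next
  case (pCons a p)
  have p: "rpoly p x \<in> K" by (rule rpoly_subfield[OF assms(1,3)])
  then show ?case
    using pCons fhom_add[OF assms(2) subfield_of_rat[OF assms(1)] subfield_mult[OF assms(1,3) p]]
    by (simp add: fhom_mult[OF assms(2,3) p] fhom_of_rat[OF assms(1,2)])
qed

text \<open>\<open>w\<close> is a root of unity of exact order \<open>m\<close>. It is instantiated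
  twice: with m = |G|, for a field that contains all character values, and with \<xi> and k at the
  leaf.\<close>

locale cyclotomic =
  fixes w :: complex and m :: nat
  assumes m: "m > 0" and w: "w ^ m = 1" and prim_root: "\<And>j. 0 < j \<Longrightarrow> j < m \<Longrightarrow> w ^ j \<noteq> 1"
begin

abbreviation "K \<equiv> genfield {w}"

lemma w_nz: "w \<noteq> 0" using w m by (metis power_0_left not_less_zero zero_neq_one)

lemma inj_power: "inj_on (\<lambda>i. w ^ i) {..<m}"
proof (rule inj_onI)
  have *: False if "i < j" "j < m" "w ^ i = w ^ j" for i j
  proof -
    have "w ^ i * w ^ (j - i) = w ^ i * 1"
      using that by (metis le_add_diff_inverse less_imp_le mult_1_right power_add)
    then have "w ^ (j - i) = 1" using w_nz by simp
    then show False using prim_root[of "j - i"] that by simp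
  qed
  fix i j assume "i \<in> {..<m}" "j \<in> {..<m}" "w ^ i = w ^ j"
  then show "i = j" using *[of i j] *[of j i] by (cases i j rule: linorder_cases) auto
qed

lemma roots_of_unity: "{z. z ^ m = 1} = (\<lambda>i. w ^ i) ` {..<m}"
proof (rule sym, rule card_seteq)
  show "finite {z::complex. z ^ m = 1}" using finite_roots_unity[of m] m by simp
  show "(\<lambda>i. w ^ i) ` {..<m} \<subseteq> {z. z ^ m = 1}"
    using w by (auto simp: power_mult[symmetric] mult.commute[of _ m]) (simp add: power_mult)
  show "card {z::complex. z ^ m = 1} \<le> card ((\<lambda>i. w ^ i) ` {..<m})"
    using card_roots_unity[of m, where 'a=complex] m by (simp add: card_image[OF inj_power])
qed

lemma root_is_power:
  assumes "z ^ m = 1"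
  obtains i where "i < m" "z = w ^ i"
  using assms roots_of_unity by blast

lemma w_K: "w \<in> K" using genfield_subset by auto

lemma root_in_K: "z ^ m = 1 \<Longrightarrow> z \<in> K"
  by (metis root_is_power subfield_power[OF subfield_genfield w_K])

lemma ex_min_poly:
  obtains p where "p \<noteq> 0" "rpoly p w = 0" "\<And>f. f \<noteq> 0 \<Longrightarrow> rpoly f w = 0 \<Longrightarrow> degree p \<le> degree f"
proof -
  let ?P = "\<lambda>p. p \<noteq> 0 \<and> rpoly p w = 0"
  have "(monom 1 m - 1 :: rat poly) \<noteq> 0"
    using m by (metis degree_1 degree_monom_eq eq_iff_diff_eq_0 not_less_zero zero_neq_one)
  then have "?P (monom 1 m - 1)" using w by simp
  then obtain p where "?P p" "\<And>f. ?P f \<Longrightarrow> degree p \<le> degree f"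
    using exists_least_iff[of "\<lambda>n. \<exists>p. ?P p \<and> degree p = n"] by (metis not_le)
  then show thesis using that by blast
qed

text \<open>The minimal polynomial of \<open>w\<close> over \<rat>, up to a nonzero scalar
  factor.\<close>

definition mp :: "rat poly" where
  "mp = (SOME p. p \<noteq> 0 \<and> rpoly p w = 0 \<and> (\<forall>f. f \<noteq> 0 \<longrightarrow> rpoly f w = 0 \<longrightarrow> degree p \<le> degree f))"

lemma mp: "mp \<noteq> 0" "rpoly mp w = 0" "\<And>f. f \<noteq> 0 \<Longrightarrow> rpoly f w = 0 \<Longrightarrow> degree mp \<le> degree f"
proof -
  have "mp \<noteq> 0 \<and> rpoly mp w = 0 \<and> (\<forall>f. f \<noteq> 0 \<longrightarrow> rpoly f w = 0 \<longrightarrow> degree mp \<le> degree f)"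
    unfolding mp_def by (rule someI_ex) (metis ex_min_poly)
  then show "mp \<noteq> 0" "rpoly mp w = 0" "\<And>f. f \<noteq> 0 \<Longrightarrow> rpoly f w = 0 \<Longrightarrow> degree mp \<le> degree f"
    by auto
qed

lemma degree_mp: "degree mp > 0"
proof (rule ccontr)
  assume "\<not> degree mp > 0"
  then obtain a where "mp = [:a:]" by (meson degree_eq_zeroE neq0_conv)
  then show False using mp(1,2) by simp
qed

lemma mp_dvd_iff: "rpoly f w = 0 \<longleftrightarrow> mp dvd f"
proof
  assume a: "rpoly f w = 0"
  have "rpoly (f mod mp) w = 0"
    using a mp(2) by (simp add: minus_div_mult_eq_mod[symmetric])
  then have "f mod mp = 0"
    using mp(3)[of "f mod mp"] degree_mod_less[OF mp(1), of f] by fastforce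
  then show "mp dvd f" by (simp add: dvd_eq_mod_eq_0)
qed (auto simp: mp(2))

text \<open>Inverses come from Bezout's identity for \<open>mp\<close> and f. Their gcd does not
  vanish at \<open>w\<close>, so the cofactor h of \<open>mp\<close> does; minimality of the degree
  then makes the gcd constant.\<close>

lemma K_eq: "K = range (\<lambda>f. rpoly f w)"
proof
  show "range (\<lambda>f. rpoly f w) \<subseteq> K" using rpoly_subfield[OF subfield_genfield w_K] by auto
  have inv: "inverse (rpoly f w) \<in> range (\<lambda>f. rpoly f w)" for f
  proof (cases "rpoly f w = 0")
    case True
    then show ?thesis by (metis inverse_zero rangeI)
  next
    case False
    define g where "g = gcd mp f"
    obtain h where h: "mp = g * h" by (metis g_def gcd_dvd1 dvdE)
    have gw: "rpoly g w \<noteq> 0" using False by (metis dvd_trans g_def gcd_dvd2 mp_dvd_iff)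
    have nz: "g \<noteq> 0" "h \<noteq> 0" using h mp(1) by auto
    have "rpoly h w = 0" using gw h mp(2) by simp
    then have "degree mp \<le> degree h" using mp(3) nz by blast
    then have "degree g = 0" using h nz by (simp add: degree_mult_eq)
    then obtain c where c: "g = [:c:]" by (meson degree_eq_zeroE)
    have c0: "c \<noteq> 0" using nz c by auto
    obtain a b where ab: "a * mp + b * f = g" unfolding g_def by (metis bezout_coefficients_fst_snd)
    have "rpoly b w * rpoly f w = of_rat c"
      using arg_cong[OF ab, of "\<lambda>f. rpoly f w"] mp(2) c by simp
    then have "rpoly (smult (1 / c) b) w * rpoly f w = 1" using c0 by (simp add: of_rat_divide)
    then have "inverse (rpoly f w) = rpoly (smult (1 / c) b) w" by (metis inverse_unique mult.commute)
    then show ?thesis by (metis rangeI)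
  qed
  have "subfield_C (range (\<lambda>f. rpoly f w))"
    unfolding subfield_C_def using inv
    by (auto simp: image_iff)
      (metis rpoly_0, metis rpoly_1, metis rpoly_add, metis rpoly_diff, metis rpoly_mult)
  moreover have "w \<in> range (\<lambda>f. rpoly f w)" by (rule range_eqI[of _ _ "[:0, 1:]"]) simp
  ultimately show "K \<subseteq> range (\<lambda>f. rpoly f w)" by (intro genfield_least) auto
qed

lemma fhom_w_root: "fhom K \<gamma> \<Longrightarrow> \<gamma> w ^ m = 1"
  using fhom_power[OF subfield_genfield _ w_K, of \<gamma> m] w fhom_1[of K \<gamma>] by metis

lemma fhom_eqI:
  assumes "fhom K \<gamma>" "fhom K \<delta>" "\<gamma> w = \<delta> w"
  shows "\<gamma> = \<delta>"
proof
  fix x show "\<gamma> x = \<delta> x"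
  proof (cases "x \<in> K")
    case True
    then obtain f where "x = rpoly f w" using K_eq by auto
    then show ?thesis
      using fhom_rpoly[OF subfield_genfield assms(1) w_K] fhom_rpoly[OF subfield_genfield assms(2) w_K] assms(3)
      by simp
  qed (simp add: fhom_out[OF assms(1)] fhom_out[OF assms(2)])
qed

lemma finite_fhom: "finite {\<gamma>. fhom K \<gamma>}"
proof (rule finite_imageD)
  have "(\<lambda>\<gamma>. \<gamma> w) ` {\<gamma>. fhom K \<gamma>} \<subseteq> {z. z ^ m = 1}" using fhom_w_root by auto
  then show "finite ((\<lambda>\<gamma>. \<gamma> w) ` {\<gamma>. fhom K \<gamma>})"
    by (rule finite_subset) (simp add: roots_of_unity)
  show "inj_on (\<lambda>\<gamma>. \<gamma> w) {\<gamma>. fhom K \<gamma>}" using fhom_eqI by (auto simp: inj_on_def)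
qed

lemma mp_roots_unity: "rpoly mp z = 0 \<Longrightarrow> z ^ m = 1"
proof -
  assume "rpoly mp z = 0"
  moreover have "mp dvd monom 1 m - 1" using w by (simp add: mp_dvd_iff[symmetric])
  ultimately have "rpoly (monom 1 m - 1) z = 0" by (metis dvdE mult_zero_left rpoly_mult)
  then show ?thesis by simp
qed

text \<open>Evaluate at z instead of \<open>w\<close>. The choice of the representing polynomial
  does not matter, since two of them differ by a multiple of \<open>mp\<close>, which vanishes at
  z.\<close>

lemma ex_fhom:
  assumes z: "rpoly mp z = 0"
  obtains \<gamma> where "fhom K \<gamma>" "\<gamma> w = z"
proof -
  define \<gamma> where "\<gamma> x = (if x \<in> K then rpoly (SOME f. rpoly f w = x) z else x)" for x
  have \<gamma>: "\<gamma> (rpoly f w) = rpoly f z" for f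
  proof -
    define g where "g = (SOME g. rpoly g w = rpoly f w)"
    have "rpoly g w = rpoly f w" unfolding g_def by (rule someI_ex) auto
    then have "mp dvd g - f" by (simp add: mp_dvd_iff[symmetric])
    then have "rpoly (g - f) z = 0" using z by (metis dvdE mult_zero_left rpoly_mult)
    moreover have "rpoly f w \<in> K" by (rule rpoly_subfield[OF subfield_genfield w_K])
    ultimately show ?thesis by (simp add: \<gamma>_def g_def)
  qed
  have zK: "z \<in> K" using mp_roots_unity[OF z] root_in_K by simp
  have "fhom K \<gamma>" unfolding fhom_def
  proof (intro conjI ballI allI impI)
    show "\<gamma> ` K \<subseteq> K" using \<gamma> rpoly_subfield[OF subfield_genfield zK] by (auto simp: K_eq)
    show "\<gamma> 1 = 1" using \<gamma>[of 1] by simp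
    fix x y assume "x \<in> K" "y \<in> K"
    then obtain f g where "x = rpoly f w" "y = rpoly g w" by (auto simp: K_eq)
    then show "\<gamma> (x + y) = \<gamma> x + \<gamma> y" "\<gamma> (x * y) = \<gamma> x * \<gamma> y"
      using \<gamma>[of "f + g"] \<gamma>[of "f * g"] \<gamma>[of f] \<gamma>[of g] by simp_all
  qed (simp add: \<gamma>_def)
  moreover have "\<gamma> w = z" using \<gamma>[of "[:0, 1:]"] by simp
  ultimately show thesis by (rule that)
qed

text \<open>Separability by counting: X^m - 1 is the product of \<open>mp\<close> and r and has m
  distinct roots, of which at most deg r are roots of r.\<close>

lemma card_mp_roots: "card {z. rpoly mp z = 0} \<ge> degree mp"
proof -
  let ?M = "map_poly of_rat :: rat poly \<Rightarrow> complex poly"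
  have deg: "degree (?M f) = degree f" for f by (rule degree_map_poly) simp
  obtain r where r: "monom 1 m - 1 = mp * r"
    using w by (metis dvdE mp_dvd_iff rpoly_diff rpoly_1 rpoly_monom diff_self)
  have nz: "(monom 1 m - 1 :: rat poly) \<noteq> 0"
    using m by (metis degree_1 degree_monom_eq eq_iff_diff_eq_0 not_less_zero zero_neq_one)
  then have r0: "r \<noteq> 0" using r by auto
  have "degree (monom 1 m - 1 :: rat poly) = m"
    using m degree_add_eq_left[of "-1" "monom 1 m :: rat poly"] by (simp add: degree_monom_eq)
  then have dm: "degree mp + degree r = m" using r degree_mult_eq[OF mp(1) r0] by simp
  have M0: "?M f \<noteq> 0" if "f \<noteq> 0" for f using that by (simp add: map_poly_eq_0_iff)
  have fin: "finite {z. rpoly f z = 0}" if "f \<noteq> 0" for f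
    unfolding rpoly_def by (rule poly_roots_finite[OF M0[OF that]])
  have cr: "card {z. rpoly r z = 0} \<le> degree r"
    unfolding rpoly_def using card_poly_roots_bound[OF M0[OF r0]] deg by metis
  have "z ^ m = 1 \<longleftrightarrow> rpoly mp z * rpoly r z = 0" for z
    using arg_cong[OF r, of "\<lambda>f. rpoly f z"] by (metis eq_iff_diff_eq_0 rpoly_1 rpoly_diff rpoly_monom rpoly_mult)
  then have "{z. z ^ m = 1} = {z. rpoly mp z = 0} \<union> {z. rpoly r z = 0}" by auto
  then have "card {z::complex. z ^ m = 1} \<le> card {z. rpoly mp z = 0} + card {z. rpoly r z = 0}"
    using card_Un_le by metis
  moreover have "card {z::complex. z ^ m = 1} = m" by (simp add: roots_of_unity card_image[OF inj_power])
  ultimately show ?thesis using cr dm by linarith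
qed

text \<open>If \<open>x\<close> is a polynomial \<open>h\<close> in \<open>w\<close> with \<open>degree h < degree mp\<close>, then \<open>h - x\<close> vanishes at all
  roots of \<open>mp\<close>, so it is zero.\<close>
lemma fixed_rational:
  assumes x: "x \<in> K" and f: "\<And>\<gamma>. fhom K \<gamma> \<Longrightarrow> \<gamma> x = x"
  shows "x \<in> \<rat>"
proof -
  let ?M = "map_poly of_rat :: rat poly \<Rightarrow> complex poly"
  obtain g where "x = rpoly g w" using x K_eq by auto
  define h where "h = g mod mp"
  have xh: "x = rpoly h w"
    using \<open>x = rpoly g w\<close> mp(2) by (simp add: h_def minus_div_mult_eq_mod[symmetric])
  have dh: "degree h < degree mp"
    using degree_mod_less[OF mp(1), of g] degree_mp by (auto simp: h_def)
  define q where "q = ?M h - [:x:]"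
  have "degree q \<le> degree h"
    unfolding q_def by (rule degree_diff_le) (simp_all add: degree_map_poly)
  moreover have "rpoly mp z = 0 \<Longrightarrow> poly q z = 0" for z
  proof -
    assume "rpoly mp z = 0"
    then obtain \<gamma> where "fhom K \<gamma>" "\<gamma> w = z" by (rule ex_fhom)
    then have "rpoly h z = x" using fhom_rpoly[OF subfield_genfield _ w_K, of \<gamma> h] xh f[of \<gamma>] by simp
    then show "poly q z = 0" by (simp add: q_def rpoly_def)
  qed
  then have sub: "{z. rpoly mp z = 0} \<subseteq> {z. poly q z = 0}" by auto
  have "q = 0"
  proof (rule ccontr)
    assume q: "q \<noteq> 0"
    have "degree mp \<le> card {z. poly q z = 0}"
      using card_mp_roots card_mono[OF poly_roots_finite[OF q] sub] by linarith
    then show False using card_poly_roots_bound[OF q] \<open>degree q \<le> degree h\<close> dh by linarith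
  qed
  then have "coeff (?M h) 0 = coeff [:x:] 0" by (simp add: q_def)
  then have "x = of_rat (coeff h 0)" by (simp add: coeff_map_poly)
  then show ?thesis by simp
qed

end

text \<open>The set \<open>S\<close> will consist of the values of a character. Its stability under
  all endomorphisms of \<rat>(w) stands in for the normality of the field it generates.\<close>

locale stable_subset = cyclotomic +
  fixes S :: "complex set"
  assumes S_finite: "finite S" and S_K: "S \<subseteq> K" and S_stable: "\<And>\<gamma>. fhom K \<gamma> \<Longrightarrow> \<gamma> ` S \<subseteq> S"
begin

abbreviation "F \<equiv> genfield S"

lemma F_K: "F \<subseteq> K"
  by (rule genfield_least[OF subfield_genfield S_K])

text \<open>For the reverse inclusion, \<gamma> permutes the finite set \<open>S\<close>, so the
  image of \<open>F\<close> is a subfield containing \<open>S\<close>.\<close>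

lemma fhom_image_F:
  assumes g: "fhom K \<gamma>"
  shows "\<gamma> ` F = F"
proof
  have "subfield_C {x \<in> F. \<gamma> x \<in> F}"
    unfolding subfield_C_def
  proof (intro conjI ballI)
    note sF = subfield_genfield[of S] and sK = subfield_genfield[of "{w}"]
    show "0 \<in> {x \<in> F. \<gamma> x \<in> F}" using fhom_0[OF sK g] subfield_0[OF sF] by simp
    show "1 \<in> {x \<in> F. \<gamma> x \<in> F}" using fhom_1[OF g] subfield_1[OF sF] by simp
    fix x assume x: "x \<in> {x \<in> F. \<gamma> x \<in> F}"
    then have xK: "x \<in> K" using F_K by auto
    show "inverse x \<in> {x \<in> F. \<gamma> x \<in> F}"
      using x fhom_inverse[OF sK g xK] subfield_inverse[OF sF] by simp
    fix y assume y: "y \<in> {x \<in> F. \<gamma> x \<in> F}"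
    then have yK: "y \<in> K" using F_K by auto
    show "x + y \<in> {x \<in> F. \<gamma> x \<in> F}" using x y fhom_add[OF g xK yK] subfield_add[OF sF] by simp
    show "x - y \<in> {x \<in> F. \<gamma> x \<in> F}" using x y fhom_diff[OF sK g xK yK] subfield_diff[OF sF] by simp
    show "x * y \<in> {x \<in> F. \<gamma> x \<in> F}" using x y fhom_mult[OF g xK yK] subfield_mult[OF sF] by simp
  qed
  moreover have "S \<subseteq> {x \<in> F. \<gamma> x \<in> F}" using S_stable[OF g] genfield_subset[of S] by auto
  ultimately show "\<gamma> ` F \<subseteq> F" using genfield_least by blast
  have "subfield_C (\<gamma> ` F)"
    unfolding subfield_C_def
  proof (intro conjI ballI)
    show "0 \<in> \<gamma> ` F" using fhom_0[OF subfield_genfield g] subfield_0[OF subfield_genfield[of S]] by (metis imageI)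
    show "1 \<in> \<gamma> ` F" using fhom_1[OF g] subfield_1[OF subfield_genfield[of S]] by (metis imageI)
    fix x assume "x \<in> \<gamma> ` F"
    then obtain a where a: "a \<in> F" "x = \<gamma> a" by auto
    then show "inverse x \<in> \<gamma> ` F"
      using fhom_inverse[OF subfield_genfield g, of a] F_K subfield_inverse[OF subfield_genfield, of a S]
      by (metis imageI subsetD)
    fix y assume "y \<in> \<gamma> ` F"
    then obtain b where b: "b \<in> F" "y = \<gamma> b" by auto
    have ab: "a \<in> K" "b \<in> K" using a b F_K by auto
    show "x + y \<in> \<gamma> ` F"
      using fhom_add[OF g ab] subfield_add[OF subfield_genfield a(1) b(1)] a(2) b(2) by (metis imageI)
    show "x - y \<in> \<gamma> ` F"
      using fhom_diff[OF subfield_genfield g ab] subfield_diff[OF subfield_genfield a(1) b(1)] a(2) b(2) by (metis imageI)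
    show "x * y \<in> \<gamma> ` F"
      using fhom_mult[OF g ab] subfield_mult[OF subfield_genfield a(1) b(1)] a(2) b(2) by (metis imageI)
  qed
  moreover have "S \<subseteq> \<gamma> ` F"
  proof -
    have "inj_on \<gamma> S" using fhom_inj[OF subfield_genfield g] S_K by (rule inj_on_subset)
    then have "\<gamma> ` S = S" using S_stable[OF g] S_finite by (simp add: endo_inj_surj)
    then show ?thesis using genfield_subset[of S] by blast
  qed
  ultimately show "F \<subseteq> \<gamma> ` F" by (rule genfield_least)
qed

definition restr :: "(complex \<Rightarrow> complex) \<Rightarrow> complex \<Rightarrow> complex" where
  "restr \<gamma> = (\<lambda>x. if x \<in> F then \<gamma> x else x)"

lemma restr_in: "x \<in> F \<Longrightarrow> restr \<gamma> x = \<gamma> x"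
  by (simp add: restr_def)

lemma fhom_F: "fhom K \<gamma> \<Longrightarrow> x \<in> F \<Longrightarrow> \<gamma> x \<in> F"
  using fhom_image_F by blast

lemma restr_Gal:
  assumes g: "fhom K \<gamma>"
  shows "restr \<gamma> \<in> Gal S"
proof -
  have "restr \<gamma> ` F = F" using fhom_image_F[OF g] by (simp add: restr_def)
  moreover have "fhom F (restr \<gamma>)" unfolding fhom_def
  proof (intro conjI ballI allI impI)
    show "restr \<gamma> ` F \<subseteq> F" using calculation by simp
    fix x y assume xy: "x \<in> F" "y \<in> F"
    then have K: "x \<in> K" "y \<in> K" using F_K by auto
    show "restr \<gamma> (x + y) = restr \<gamma> x + restr \<gamma> y"
      using xy subfield_add[OF subfield_genfield xy] fhom_add[OF g K] by (simp add: restr_def)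
    show "restr \<gamma> (x * y) = restr \<gamma> x * restr \<gamma> y"
      using xy subfield_mult[OF subfield_genfield xy] fhom_mult[OF g K] by (simp add: restr_def)
  qed (auto simp: restr_def fhom_1[OF g])
  ultimately show ?thesis by (simp add: Gal_iff)
qed

text \<open>The automorphisms of \<open>F\<close> that extend to \<open>K\<close>. That there are no
  others, \<open>Gal_eq_D\<close>, takes the place of an extension theorem for field
  embeddings.\<close>

definition D :: "(complex \<Rightarrow> complex) set" where
  "D = restr ` {\<gamma>. fhom K \<gamma>}"

lemma finite_D: "finite D" using finite_fhom by (simp add: D_def)

lemma D_Gal: "D \<subseteq> Gal S" using restr_Gal by (auto simp: D_def)

lemma Gal_bij: "\<sigma> \<in> Gal S \<Longrightarrow> inj \<sigma>"
proof (rule injI)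
  fix x y assume s: "\<sigma> \<in> Gal S" and e: "\<sigma> x = \<sigma> y"
  have *: "z \<in> F \<longleftrightarrow> \<sigma> z \<in> F" for z
    using s by (cases "z \<in> F") (auto simp: Gal_iff fhom_def)
  show "x = y"
    using *[of x] *[of y] e s fhom_inj[OF subfield_genfield, of S \<sigma>]
    by (cases "x \<in> F") (auto simp: Gal_iff fhom_def inj_on_def)
qed

text \<open>Composition with the restriction of \<gamma> permutes \<open>D\<close>, so the sum is
  fixed by every endomorphism of \<open>K\<close>.\<close>

lemma D_sum_rational:
  assumes x: "x \<in> F"
  shows "(\<Sum>\<delta>\<in>D. \<delta> x) \<in> \<rat>"
proof (rule fixed_rational)
  have DF: "\<delta> x \<in> F" if "\<delta> \<in> D" for \<delta>
    using that D_Gal fhom_in[OF Gal_imp_fhom x] by auto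
  then show "(\<Sum>\<delta>\<in>D. \<delta> x) \<in> K" using F_K by (intro subfield_sum subfield_genfield) auto
  fix \<gamma> assume g: "fhom K \<gamma>"
  have "\<gamma> (\<Sum>\<delta>\<in>D. \<delta> x) = (\<Sum>\<delta>\<in>D. \<gamma> (\<delta> x))"
    using DF F_K by (intro fhom_sum[OF subfield_genfield g]) auto
  also have "\<dots> = (\<Sum>\<delta>\<in>D. (restr \<gamma> \<circ> \<delta>) x)" using DF by (intro sum.cong) (auto simp: restr_in)
  also have "\<dots> = (\<Sum>\<delta>\<in>(\<circ>) (restr \<gamma>) ` D. \<delta> x)"
  proof (subst sum.reindex)
    show "inj_on ((\<circ>) (restr \<gamma>)) D"
      by (rule inj_comp_left[OF Gal_bij[OF restr_Gal[OF g]]])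
  qed simp
  also have "(\<circ>) (restr \<gamma>) ` D = D"
  proof (rule endo_inj_surj[OF finite_D])
    show "inj_on ((\<circ>) (restr \<gamma>)) D"
      by (rule inj_comp_left[OF Gal_bij[OF restr_Gal[OF g]]])
    show "(\<circ>) (restr \<gamma>) ` D \<subseteq> D"
    proof
      fix \<rho> assume "\<rho> \<in> (\<circ>) (restr \<gamma>) ` D"
      then obtain \<delta> where d: "fhom K \<delta>" "\<rho> = restr \<gamma> \<circ> restr \<delta>" by (auto simp: D_def)
      have "\<rho> = restr (\<gamma> \<circ> \<delta>)" unfolding d(2) by (rule ext) (simp add: restr_def fhom_F[OF d(1)])
      then show "\<rho> \<in> D" using fhom_comp[OF g d(1)] by (auto simp: D_def)
    qed
  qed
  finally show "\<gamma> (\<Sum>\<delta>\<in>D. \<delta> x) = (\<Sum>\<delta>\<in>D. \<delta> x)" .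
qed

text \<open>A sum over \<open>D\<close> is rational, hence fixed by \<open>\<tau>\<close>; independence of
  characters then forces \<open>\<tau> \<circ> D = D\<close>.\<close>
lemma Gal_eq_D: "Gal S = D"
proof (rule ccontr)
  assume "Gal S \<noteq> D"
  then obtain \<tau> where t: "\<tau> \<in> Gal S" "\<tau> \<notin> D" using D_Gal by blast
  define D' where "D' = (\<circ>) \<tau> ` D"
  \<comment> \<open>The coefficients of the difference of the sums over \<open>D\<close> and
    \<open>D'\<close>. As \<open>id\<close> is in \<open>D\<close>, \<tau> itself is in
    \<open>D'\<close>; it is not in \<open>D\<close>, so its coefficient is -1, whereas independence
    makes it 0.\<close>
  define c :: "(complex \<Rightarrow> complex) \<Rightarrow> complex" where
    "c \<delta> = (if \<delta> \<in> D then 1 else 0) - (if \<delta> \<in> D' then 1 else 0)" for \<delta>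
  have "restr id = id" by (simp add: restr_def fun_eq_iff)
  then have "id \<in> D" using fhom_id by (force simp: D_def)
  then have tD: "\<tau> \<in> D'" unfolding D'_def by (rule image_eqI[rotated]) simp
  have G: "\<sigma> \<in> Gal S" if "\<sigma> \<in> D \<union> D'" for \<sigma>
    using that
  proof
    assume "\<sigma> \<in> D'"
    then obtain \<delta> where d: "\<delta> \<in> Gal S" "\<sigma> = \<tau> \<circ> \<delta>" using D_Gal by (auto simp: D'_def)
    have "(\<tau> \<circ> \<delta>) ` F = F" using d(1) t(1) by (metis Gal_iff image_comp)
    then show "\<sigma> \<in> Gal S" using t(1) d fhom_comp[of F \<tau> \<delta>] by (simp add: Gal_iff)
  qed (use D_Gal in auto)
  have "c \<tau> = 0"
  proof (rule dedekind_independence[where F=F and T="D \<union> D'" and c=c and \<sigma>=\<tau>])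
    show "finite (D \<union> D')" using finite_D by (simp add: D'_def)
    show "1 \<in> F" "\<And>x y. x \<in> F \<Longrightarrow> y \<in> F \<Longrightarrow> x * y \<in> F"
      using subfield_1[OF subfield_genfield] subfield_mult[OF subfield_genfield] by auto
    show "\<sigma> 1 = 1 \<and> (\<forall>x\<in>F. \<forall>y\<in>F. \<sigma> (x * y) = \<sigma> x * \<sigma> y)" if "\<sigma> \<in> D \<union> D'" for \<sigma>
      using Gal_imp_fhom[OF G[OF that]] by (simp add: fhom_def)
    show "\<exists>y\<in>F. \<sigma> y \<noteq> \<rho> y" if "\<sigma> \<in> D \<union> D'" "\<rho> \<in> D \<union> D'" "\<sigma> \<noteq> \<rho>" for \<sigma> \<rho>
    proof (rule ccontr)
      assume "\<not> (\<exists>y\<in>F. \<sigma> y \<noteq> \<rho> y)"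
      then have "\<sigma> y = \<rho> y" for y
        using fhom_out[OF Gal_imp_fhom[OF G[OF that(1)]], of y] fhom_out[OF Gal_imp_fhom[OF G[OF that(2)]], of y]
        by (cases "y \<in> F") auto
      then show False using that(3) by auto
    qed
    show "\<tau> \<in> D \<union> D'" using tD by simp
    fix x assume x: "x \<in> F"
    have DF: "\<delta> x \<in> F" if "\<delta> \<in> D" for \<delta> using that D_Gal fhom_in[OF Gal_imp_fhom x] by auto
    obtain q where q: "(\<Sum>\<delta>\<in>D. \<delta> x) = of_rat q" using D_sum_rational[OF x] by (auto elim: Rats_cases)
    have "(\<Sum>\<delta>\<in>D'. \<delta> x) = (\<Sum>\<delta>\<in>D. \<tau> (\<delta> x))"
      unfolding D'_def
    proof (subst sum.reindex)
      show "inj_on ((\<circ>) \<tau>) D"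
        by (rule inj_comp_left[OF Gal_bij[OF t(1)]])
    qed simp
    also have "\<dots> = \<tau> (\<Sum>\<delta>\<in>D. \<delta> x)"
      using DF by (intro fhom_sum[OF subfield_genfield Gal_imp_fhom[OF t(1)], symmetric])
    also have "\<dots> = (\<Sum>\<delta>\<in>D. \<delta> x)"
      unfolding q by (rule fhom_of_rat[OF subfield_genfield Gal_imp_fhom[OF t(1)]])
    finally have "(\<Sum>\<delta>\<in>D'. \<delta> x) = (\<Sum>\<delta>\<in>D. \<delta> x)" .
    moreover have "(\<Sum>\<sigma>\<in>D \<union> D'. (if \<sigma> \<in> D then 1 else 0) * \<sigma> x) = (\<Sum>\<delta>\<in>D. \<delta> x)"
      using finite_D by (intro sum.mono_neutral_cong_right) (auto simp: D'_def)
    moreover have "(\<Sum>\<sigma>\<in>D \<union> D'. (if \<sigma> \<in> D' then 1 else 0) * \<sigma> x) = (\<Sum>\<delta>\<in>D'. \<delta> x)"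
      using finite_D by (intro sum.mono_neutral_cong_right) (auto simp: D'_def)
    ultimately show "(\<Sum>\<sigma>\<in>D \<union> D'. c \<sigma> * \<sigma> x) = 0"
      by (simp add: c_def left_diff_distrib sum_subtractf)
  qed
  then show False using t(2) tD by (simp add: c_def)
qed

lemma finite_Gal: "finite (Gal S)"
  by (simp add: Gal_eq_D finite_D)

lemma Gal_sum_rational: "x \<in> F \<Longrightarrow> (\<Sum>\<sigma>\<in>Gal S. \<sigma> x) \<in> \<rat>"
  by (simp add: Gal_eq_D D_sum_rational)

lemma Gal_extend:
  assumes "\<sigma> \<in> Gal S"
  obtains \<gamma> where "fhom K \<gamma>" "\<And>x. x \<in> F \<Longrightarrow> \<sigma> x = \<gamma> x"
  using assms by (auto simp: Gal_eq_D D_def restr_in)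

end

section \<open>Rational idempotents of monomial characters\<close>

lemma ex_cyclotomic:
  assumes "m > 0"
  obtains w where "cyclotomic w m"
proof
  let ?w = "cis (2 * pi / real m)"
  have pw: "?w ^ j = cis (2 * pi * real j / real m)" for j
    by (simp add: DeMoivre mult.commute)
  have bij: "bij_betw (\<lambda>k. cis (2 * pi * real k / real m)) {..<m} {z. z ^ m = 1}"
    by (rule bij_betw_roots_unity[OF assms])
  show "cyclotomic ?w m"
  proof
    show "m > 0" by fact
    show "?w ^ m = 1" using assms unfolding pw by simp
    fix j assume j: "0 < j" "j < m"
    have "inj_on (\<lambda>k. cis (2 * pi * real k / real m)) {..<m}" using bij by (rule bij_betw_imp_inj_on)
    then show "?w ^ j \<noteq> 1" unfolding pw
      using j inj_onD[of "\<lambda>k. cis (2 * pi * real k / real m)" "{..<m}" j 0] assms by fastforce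
  qed
qed

context finite_group
begin

lemma conj_pow:
  assumes "x \<in> carrier G" "y \<in> carrier G"
  shows "(y \<otimes> x \<otimes> inv y) [^] (n::nat) = y \<otimes> x [^] n \<otimes> inv y"
proof (induction n)
  case (Suc n)
  have "(y \<otimes> x [^] n \<otimes> inv y) \<otimes> (y \<otimes> x \<otimes> inv y) = y \<otimes> (x [^] n \<otimes> x) \<otimes> inv y"
    using assms by (simp add: m_assoc) (simp add: m_assoc[symmetric])
  then show ?case using Suc by simp
qed (use assms in simp)

lemma sub_pow_closed: "subgroup H G \<Longrightarrow> x \<in> H \<Longrightarrow> x [^] (n::nat) \<in> H"
  by (induction n) (auto intro: subgroup.one_closed subgroup.m_closed)

lemma lin_char_pow:
  assumes "subgroup H G" "lin_char G H \<theta>" "x \<in> H"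
  shows "\<theta> (x [^] (n::nat)) = \<theta> x ^ n"
  by (induction n) (simp_all add: lin_char_one[OF assms(1,2)] lin_char_mult[OF assms(2)] sub_pow_closed assms)

end

text \<open>The order |G| of \<open>w\<close> ensures that all values of \<theta>, and hence of the
  induced character, lie in \<rat>(w).\<close>

locale monomial = finite_group + 
  fixes M H :: "'a set" and \<theta> :: "'a \<Rightarrow> complex" and w :: complex
  assumes M: "subgroup M G" and H: "subgroup H G" "H \<subseteq> M" and lin: "lin_char G H \<theta>"
    and shoda: "shoda M H \<theta>" and cyc: "cyclotomic w (card (carrier G))"
begin

sublocale cyclotomic w "card (carrier G)" by (rule cyc)

abbreviation "\<chi> \<equiv> ind G M H \<theta>"

lemma M_carrier: "x \<in> M \<Longrightarrow> x \<in> carrier G" using M by (rule subgroup.mem_carrier)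

lemma sub_K: "subfield_C K" by (rule subfield_genfield)

lemma theta_K: "\<theta> h \<in> K"
proof (cases "h \<in> H")
  case True
  have "\<theta> h ^ card (carrier G) = \<theta> (h [^] card (carrier G))" by (simp add: lin_char_pow[OF H(1) lin True])
  also have "\<dots> = 1"
    using pow_order_eq_1[OF subgroup.mem_carrier[OF H(1) True]] lin_char_one[OF H(1) lin] by (simp add: Coset.order_def)
  finally show ?thesis by (rule root_in_K)
qed (simp add: lin_char_out[OF lin] subfield_0[OF sub_K])

lemma chi_K: "\<chi> x \<in> K"
proof -
  have "1 / complex_of_nat (card H) \<in> K"
    by (intro subfield_divide[OF sub_K] subfield_1[OF sub_K] subfield_of_nat[OF sub_K])
  then show ?thesis
    by (simp only: ind_def if_split subfield_0[OF sub_K])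
      (auto intro!: subfield_mult[OF sub_K] subfield_sum[OF sub_K] theta_K subfield_0[OF sub_K] simp del: times_divide_eq_left)
qed

lemma fhom_chi:
  assumes g: "fhom K \<gamma>"
  shows "\<gamma> (\<chi> x) = ind G M H (\<gamma> \<circ> \<theta>) x"
proof -
  have K1: "1 / complex_of_nat (card H) \<in> K"
    by (intro subfield_divide[OF sub_K] subfield_1[OF sub_K] subfield_of_nat[OF sub_K])
  have "1 / complex_of_nat (card H) = of_rat (1 / of_nat (card H))" by (simp add: of_rat_divide)
  then have g1: "\<gamma> (1 / complex_of_nat (card H)) = 1 / complex_of_nat (card H)"
    using fhom_of_rat[OF sub_K g] by metis
  have "\<gamma> (\<Sum>x'\<in>M. \<theta> (x' \<otimes> x \<otimes> inv x')) = (\<Sum>x'\<in>M. \<gamma> (\<theta> (x' \<otimes> x \<otimes> inv x')))"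
    by (rule fhom_sum[OF sub_K g theta_K])
  then show ?thesis
    using fhom_mult[OF g K1 subfield_sum[OF sub_K theta_K], of "\<lambda>x'. x' \<otimes> x \<otimes> inv x'" M] g1 fhom_0[OF sub_K g]
    by (cases "x \<in> M") (simp_all only: ind_def if_True if_False comp_apply)
qed

text \<open>\<gamma> raises \<open>w\<close> to a power a prime to |G|, and on the values of a
  linear character this can be moved into the argument. Coprimality is what extends the formula to x
  outside \<open>H\<close>, where both sides have to be 0: x is a power of x^a, so x^a is not in
  \<open>H\<close> either.\<close>

lemma fhom_theta_pow:
  assumes g: "fhom K \<gamma>"
  obtains a where "\<And>x. x \<in> carrier G \<Longrightarrow> \<gamma> (\<theta> x) = \<theta> (x [^] (a::nat))"
proof -
  let ?m = "card (carrier G)"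
  obtain i where i: "\<gamma> w = w ^ i" using root_is_power[OF fhom_w_root[OF g]] by metis
  \<comment> \<open>Adding |G| leaves the power of \<open>w\<close> unchanged and makes the exponent
    nonzero, as \<open>bezout_nat\<close> requires.\<close>
  define a where "a = i + ?m"
  have a: "\<gamma> w = w ^ a" "a \<noteq> 0" using i w m by (simp_all add: a_def power_add)
  have cop: "coprime a ?m"
  proof (rule ccontr)
    define d where "d = gcd a ?m"
    assume "\<not> coprime a ?m"
    then have d: "d \<noteq> 1" "d dvd a" "d dvd ?m" by (auto simp: d_def coprime_iff_gcd_eq_1)
    then have d2: "d > 1" using m by (metis dvd_0_left_iff less_one linorder_neqE_nat not_less_zero)
    \<comment> \<open>With a common divisor d > 1 and n = |G|/d, \<gamma> would map w^n to 1,
      although w^n differs from 1 and \<gamma> is injective.\<close>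
    obtain n where n: "?m = d * n" using d(3) by (elim dvdE)
    have n1: "n > 0" "n < ?m" using n m d2 by (auto intro: gr0I)
    have "\<gamma> (w ^ n) = 1"
    proof -
      obtain c where "a = d * c" using d(2) by (elim dvdE)
      then have "(w ^ a) ^ n = (w ^ ?m) ^ c" by (simp add: n power_mult[symmetric] ac_simps)
      then show ?thesis using fhom_power[OF sub_K g w_K, of n] a(1) w by simp
    qed
    then have "w ^ n = 1"
      using inj_onD[OF fhom_inj[OF sub_K g], of "w ^ n" 1] fhom_1[OF g] subfield_power[OF sub_K w_K]
        subfield_1[OF sub_K] by simp
    then show False using prim_root n1 by blast
  qed
  have "\<gamma> (\<theta> x) = \<theta> (x [^] a)" if x: "x \<in> carrier G" for x
  proof (cases "x \<in> H")
    case True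
    have "\<theta> x ^ ?m = \<theta> (x [^] ?m)" by (simp add: lin_char_pow[OF H(1) lin True])
    also have "\<dots> = 1" using pow_order_eq_1[OF x] lin_char_one[OF H(1) lin] by (simp add: Coset.order_def)
    finally obtain j where j: "\<theta> x = w ^ j" using root_is_power by metis
    have "\<gamma> (\<theta> x) = \<theta> x ^ a"
      using fhom_power[OF sub_K g w_K, of j] a(1) by (simp add: j power_mult[symmetric] mult.commute)
    then show ?thesis by (simp add: lin_char_pow[OF H(1) lin True])
  next
    case False
    obtain b c where bc: "a * b = ?m * c + gcd a ?m" using bezout_nat[OF a(2)] by blast
    have "x [^] a \<notin> H"
    proof
      assume "x [^] a \<in> H"
      then have "(x [^] a) [^] b \<in> H" by (rule sub_pow_closed[OF H(1)])
      moreover have "(x [^] a) [^] b = x"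
      proof -
        have "(x [^] a) [^] b = x [^] (?m * c + 1)" using bc cop x by (simp add: nat_pow_pow)
        also have "\<dots> = (x [^] ?m) [^] c \<otimes> x" using x by (simp add: nat_pow_pow)
        also have "\<dots> = x" using x pow_order_eq_1[OF x] by (simp add: Coset.order_def)
        finally show ?thesis .
      qed
      ultimately show False using False by simp
    qed
    then show ?thesis using False by (simp add: lin_char_out[OF lin] fhom_0[OF sub_K g])
  qed
  then show thesis by (rule that)
qed

text \<open>Conjugation commutes with powers, so \<gamma> sends the value of the induced character
  at x to its value at x^a.\<close>

sublocale stable_subset w "card (carrier G)" "\<chi> ` M"
proof
  show "finite (\<chi> ` M)" using finite_sub[OF M] by simp
  show "\<chi> ` M \<subseteq> K" using chi_K by auto
  fix \<gamma> assume g: "fhom K \<gamma>"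
  obtain a where a: "\<And>x. x \<in> carrier G \<Longrightarrow> \<gamma> (\<theta> x) = \<theta> (x [^] (a::nat))" using fhom_theta_pow[OF g] by blast
  have "\<gamma> (\<chi> x) = \<chi> (x [^] a)" if x: "x \<in> M" for x
    using x sub_pow_closed[OF M x] M_carrier
    by (simp add: fhom_chi[OF g]) (simp add: ind_def a conj_pow)
  then show "\<gamma> ` \<chi> ` M \<subseteq> \<chi> ` M" using sub_pow_closed[OF M] by auto
qed

lemma lin_gamma: "fhom K \<gamma> \<Longrightarrow> lin_char G H (\<gamma> \<circ> \<theta>)"
  using lin fhom_mult[OF _ theta_K theta_K] fhom_eq_0[OF sub_K _ theta_K] fhom_0[OF sub_K]
  by (auto simp: lin_char_def)

lemma shoda_gamma: "fhom K \<gamma> \<Longrightarrow> shoda M H (\<gamma> \<circ> \<theta>)"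
  using shoda inj_onD[OF fhom_inj[OF sub_K] _ theta_K theta_K] unfolding shoda_def comp_apply by metis

text \<open>As the degree of the induced character divided by |M| is 1/|H|, this is the usual
  coefficient formula for the central idempotent of a character.\<close>

lemma ind_idem_eq:
  assumes l: "lin_char G H \<theta>'" and x: "x \<in> M"
  shows "ind_idem M H \<theta>' x = ind G M H \<theta>' (inv x) / of_nat (card H)"
proof -
  have "eps H \<theta>' (y \<otimes> x \<otimes> inv y) = \<theta>' (y \<otimes> inv x \<otimes> inv y) / of_nat (card H)" if y: "y \<in> M" for y
  proof -
    have e: "inv (y \<otimes> x \<otimes> inv y) = y \<otimes> inv x \<otimes> inv y"
      using x y M_carrier by (simp add: inv_mult_group m_assoc)
    have "y \<otimes> x \<otimes> inv y \<in> H \<longleftrightarrow> y \<otimes> inv x \<otimes> inv y \<in> H"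
      using e x y M_carrier subgroup.m_inv_closed[OF H(1)] by (metis inv_closed inv_inv m_closed)
    then show ?thesis using e lin_char_out[OF l] by (simp add: eps_def)
  qed
  then show ?thesis
    using x M_carrier subgroup.m_inv_closed[OF M x]
    by (simp add: ind_idem_apply[OF M H(2)] ind_def sum_divide_distrib[symmetric])
qed

lemma chi_one: "\<chi> \<one> = of_nat (card M) / of_nat (card H)"
proof -
  have "\<theta> (x \<otimes> \<one> \<otimes> inv x) = 1" if "x \<in> M" for x
    using M_carrier[OF that] lin_char_one[OF H(1) lin] by simp
  then show ?thesis by (simp add: ind_def subgroup.one_closed[OF M])
qed

lemma eQc_eq: "x \<in> M \<Longrightarrow> eQc G M \<chi> x = (\<Sum>\<sigma>\<in>Gal (\<chi> ` M). \<sigma> (\<chi> (inv x))) / of_nat (card H)"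
  using card_sub_pos[OF M] by (simp add: eQc_def chi_one)

text \<open>Each coefficient is a rational multiple of a sum over the whole Galois group, hence
  rational, so that the \<open>THE\<close> in \<open>eQ\<close> is meaningful.\<close>

lemma cr_eQ: "cr (eQ G M \<chi>) = eQc G M \<chi>"
proof
  fix x
  have "eQc G M \<chi> x \<in> \<rat>"
  proof (cases "x \<in> M")
    case True
    have "\<chi> (inv x) \<in> F" using genfield_subset subgroup.m_inv_closed[OF M True] by blast
    then have "(\<Sum>\<sigma>\<in>Gal (\<chi> ` M). \<sigma> (\<chi> (inv x))) \<in> \<rat>" by (rule Gal_sum_rational)
    then show ?thesis using True by (simp add: eQc_eq)
  qed (simp add: eQc_def)
  then obtain q where q: "eQc G M \<chi> x = of_rat q" by (auto elim: Rats_cases)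
  then show "cr (eQ G M \<chi>) x = eQc G M \<chi> x" by (simp add: cr_def eQ_def)
qed

text \<open>An automorphism of \<open>F\<close> cannot be applied to the values of \<theta>, which
  lie in \<open>K\<close>; a chosen extension \<open>f \<sigma>\<close> can.\<close>

lemma ex_extension:
  obtains f where "\<And>\<sigma>. \<sigma> \<in> Gal (\<chi> ` M) \<Longrightarrow> fhom K (f \<sigma>)"
    "\<And>\<sigma> x. \<sigma> \<in> Gal (\<chi> ` M) \<Longrightarrow> x \<in> F \<Longrightarrow> f \<sigma> x = \<sigma> x"
proof -
  have "\<forall>\<sigma>\<in>Gal (\<chi> ` M). \<exists>\<gamma>. fhom K \<gamma> \<and> (\<forall>x\<in>F. \<gamma> x = \<sigma> x)" by (metis Gal_extend)
  then obtain f where "\<forall>\<sigma>\<in>Gal (\<chi> ` M). fhom K (f \<sigma>) \<and> (\<forall>x\<in>F. f \<sigma> x = \<sigma> x)" by (rule bchoice[THEN exE])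
  then show thesis using that by blast
qed

lemma ind_idem_gamma:
  assumes "fhom K \<gamma>" "x \<in> M"
  shows "ind_idem M H (\<gamma> \<circ> \<theta>) x = \<gamma> (\<chi> (inv x)) / of_nat (card H)"
  by (simp add: ind_idem_eq[OF lin_gamma[OF assms(1)] assms(2)] fhom_chi[OF assms(1)])

lemma fhom_star:
  assumes g: "fhom K \<gamma>" and h: "\<And>x. h x \<in> K"
  shows "\<gamma> \<circ> (cr f \<star> h) = cr f \<star> (\<gamma> \<circ> h)" "(cr f \<star> h) x \<in> K"
proof -
  have t: "cr f y * h z \<in> K" for y z
    unfolding cr_def by (intro subfield_mult[OF sub_K] subfield_of_rat[OF sub_K] h)
  show "(cr f \<star> h) x \<in> K"
    by (simp add: star_def subfield_sum[OF sub_K t] subfield_0[OF sub_K])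
  have "\<gamma> (cr f y * h z) = cr f y * \<gamma> (h z)" for y z
    unfolding cr_def using fhom_mult[OF g subfield_of_rat[OF sub_K] h] by (simp add: fhom_of_rat[OF sub_K g])
  then show "\<gamma> \<circ> (cr f \<star> h) = cr f \<star> (\<gamma> \<circ> h)"
    by (simp add: star_def fun_eq_iff fhom_sum[OF sub_K g t] fhom_0[OF sub_K g])
qed

lemma eps_K: "eps H \<theta> x \<in> K"
  by (simp add: eps_def subfield_divide[OF sub_K theta_K] subfield_of_nat[OF sub_K] subfield_0[OF sub_K])

lemma fhom_eps:
  assumes g: "fhom K \<gamma>"
  shows "\<gamma> \<circ> eps H \<theta> = eps H (\<gamma> \<circ> \<theta>)"
proof
  fix x
  have "\<gamma> (\<theta> (inv x) / of_nat (card H)) = \<gamma> (\<theta> (inv x)) / of_nat (card H)"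
    using fhom_mult[OF g theta_K subfield_inverse[OF sub_K subfield_of_nat[OF sub_K]], of "inv x" "card H"]
      fhom_inverse[OF sub_K g subfield_of_nat[OF sub_K], of "card H"] fhom_of_nat[OF sub_K g]
    by (simp add: divide_inverse)
  then show "(\<gamma> \<circ> eps H \<theta>) x = eps H (\<gamma> \<circ> \<theta>) x" by (simp add: eps_def fhom_0[OF sub_K g])
qed

text \<open>Applied to coefficients, \<gamma> fixes the rational f and turns
  \<open>eps H \<theta>\<close> into the idempotent of the conjugate character, which inherits the
  vanishing.\<close>

lemma ann_gamma:
  assumes g: "fhom K \<gamma>" and f: "\<And>y. y \<in> M \<Longrightarrow> cr f \<star> (dl y \<star> eps H \<theta>) = 0"
  shows "cr f \<star> ind_idem M H (\<gamma> \<circ> \<theta>) = 0"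
proof -
  have *: "cr f \<star> (dl y \<star> eps H (\<gamma> \<circ> \<theta>)) = 0" if y: "y \<in> M" for y
  proof -
    have "dl y \<star> eps H (\<gamma> \<circ> \<theta>) = \<gamma> \<circ> (dl y \<star> eps H \<theta>)"
      using fhom_star(1)[where f="dl y", OF g eps_K] by (simp add: fhom_eps[OF g] cr_dl)
    then have "cr f \<star> (dl y \<star> eps H (\<gamma> \<circ> \<theta>)) = \<gamma> \<circ> (cr f \<star> (dl y \<star> eps H \<theta>))"
      using fhom_star(1)[OF g, where h="dl y \<star> eps H \<theta>"] fhom_star(2)[where f="dl y", OF g eps_K]
      by (simp add: cr_dl)
    then show ?thesis by (simp add: f[OF y] fun_eq_iff fhom_0[OF sub_K g])
  qed
  have "cr f \<star> (dl (inv y) \<star> eps H (\<gamma> \<circ> \<theta>) \<star> dl y) = 0" if "y \<in> M" for y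
    using *[OF subgroup.m_inv_closed[OF M that]] by (metis star_assoc star_0_left)
  then show ?thesis by (simp add: ind_idem_def star_scl_right star_sum_right)
qed

text \<open>The idempotent is the sum of the \<open>ind_idem\<close> of the conjugate characters
  \<open>f \<sigma> \<circ> \<theta>\<close>. Multiplied by \<open>eps H \<theta>\<close>, all terms
  except that of the identity vanish by orthogonality; the annihilator clause holds term by term, by
  \<open>ann_gamma\<close>.\<close>

theorem prim_eQ: "prim M H \<theta> (eQ G M \<chi>)"
proof -
  let ?E = "eQ G M \<chi>" and ?S = "Gal (\<chi> ` M)"
  obtain f where f: "\<And>\<sigma>. \<sigma> \<in> ?S \<Longrightarrow> fhom K (f \<sigma>)" "\<And>\<sigma> x. \<sigma> \<in> ?S \<Longrightarrow> x \<in> F \<Longrightarrow> f \<sigma> x = \<sigma> x"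
    using ex_extension by blast
  have chiF: "\<chi> x \<in> F" if "x \<in> M" for x using that genfield_subset by blast
  let ?e = "\<lambda>\<sigma>. ind_idem M H (f \<sigma> \<circ> \<theta>)"
  have e_apply: "?e \<sigma> x = \<sigma> (\<chi> (inv x)) / of_nat (card H)" if "\<sigma> \<in> ?S" "x \<in> M" for \<sigma> x
    using ind_idem_gamma[OF f(1)[OF that(1)] that(2)] f(2)[OF that(1) chiF[OF subgroup.m_inv_closed[OF M that(2)]]]
    by simp
  have E: "cr ?E = (\<Sum>\<sigma>\<in>?S. ?e \<sigma>)"
  proof
    fix x
    show "cr ?E x = (\<Sum>\<sigma>\<in>?S. ?e \<sigma>) x"
    proof (cases "x \<in> M")
      case True
      then show ?thesis
        by (simp add: cr_eQ eQc_eq sum_fun_apply sum_divide_distrib e_apply)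
    next
      case False
      then show ?thesis
        using sup_inD[OF sup_in_ind_idem[OF M H(2)] False]
        by (simp add: cr_eQ eQc_def sum_fun_apply)
    qed
  qed
  have "fhom F id" by (rule fhom_id)
  then have idS: "id \<in> ?S" by (simp add: Gal_iff)
  \<comment> \<open>The extension chosen for \<open>id\<close> may be nontrivial on
    \<open>K\<close>, but the idempotent depends only on the induced character, whose values lie in
    \<open>F\<close>.\<close>
  have e_id: "?e id = ind_idem M H \<theta>"
  proof
    fix x show "?e id x = ind_idem M H \<theta> x"
      by (cases "x \<in> M")
         (simp_all add: e_apply[OF idS] ind_idem_eq[OF lin] sup_inD[OF sup_in_ind_idem[OF M H(2)]])
  qed
  \<comment> \<open>If the idempotents agree, \<sigma> fixes all character values, hence the field
    \<open>F\<close> generated by them, so \<sigma> = id.\<close>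
  have ne: "?e \<sigma> \<noteq> ind_idem M H \<theta>" if s: "\<sigma> \<in> ?S" "\<sigma> \<noteq> id" for \<sigma>
  proof
    assume a: "?e \<sigma> = ind_idem M H \<theta>"
    have fx: "\<sigma> (\<chi> x) = \<chi> x" if x: "x \<in> M" for x
    proof -
      have ix: "inv x \<in> M" using subgroup.m_inv_closed[OF M x] .
      have "\<sigma> (\<chi> (inv (inv x))) / of_nat (card H) = \<chi> (inv (inv x)) / of_nat (card H)"
        using fun_cong[OF a, of "inv x"] e_apply[OF s(1) ix] ind_idem_eq[OF lin ix] by simp
      then show ?thesis using card_sub_pos[OF H(1)] M_carrier[OF x] by simp
    qed
    note sF = subfield_genfield[of "\<chi> ` M"] and hF = Gal_imp_fhom[OF s(1)]
    have "subfield_C {x \<in> F. \<sigma> x = x}"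
      unfolding subfield_C_def
      using subfield_0[OF sF] subfield_1[OF sF] subfield_add[OF sF] subfield_diff[OF sF] subfield_mult[OF sF]
        subfield_inverse[OF sF] fhom_0[OF sF hF] fhom_1[OF hF] fhom_add[OF hF] fhom_diff[OF sF hF]
        fhom_mult[OF hF] fhom_inverse[OF sF hF] by simp
    moreover have "\<chi> ` M \<subseteq> {x \<in> F. \<sigma> x = x}" using fx chiF by auto
    ultimately have "F \<subseteq> {x \<in> F. \<sigma> x = x}" by (rule genfield_least)
    then have "\<sigma> x = x" for x using fhom_out[OF hF, of x] by (cases "x \<in> F") auto
    then show False using s(2) by auto
  qed
  have "cr ?E \<star> eps H \<theta> = (\<Sum>\<sigma>\<in>?S. ?e \<sigma> \<star> eps H \<theta>)" by (simp add: E star_sum_left)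
  also have "\<dots> = (\<Sum>\<sigma>\<in>?S. if \<sigma> = id then eps H \<theta> else 0)"
  proof (rule sum.cong[OF refl])
    fix \<sigma> assume s: "\<sigma> \<in> ?S"
    show "?e \<sigma> \<star> eps H \<theta> = (if \<sigma> = id then eps H \<theta> else 0)"
      using ind_idem_orth[OF M H lin shoda lin_gamma[OF f(1)[OF s]] shoda_gamma[OF f(1)[OF s]] ne[OF s]]
        ind_idem_eps[OF M H lin shoda] e_id by (cases "\<sigma> = id") simp_all
  qed
  also have "\<dots> = eps H \<theta>" using finite_Gal idS by simp
  finally have 1: "cr ?E \<star> eps H \<theta> = eps H \<theta>" .
  have 2: "dl x \<star> ?E = ?E \<star> dl x" if "x \<in> M" for x
  proof -
    have "dl x \<star> cr ?E = cr ?E \<star> dl x"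
      by (simp add: E star_sum_left star_sum_right ind_idem_central[OF M that])
    then have "cr (dl x \<star> ?E) = cr (?E \<star> dl x)" by (simp add: cr_star cr_dl)
    then show ?thesis by (simp only: cr_inj)
  qed
  have 3: "sup_in M ?E"
  proof -
    have "sup_in M (cr ?E)" by (simp add: cr_eQ sup_in_def eQc_def)
    then show ?thesis by (simp add: sup_in_cr)
  qed
  have 4: "h \<star> ?E = 0" if "\<And>y. y \<in> M \<Longrightarrow> cr h \<star> (dl y \<star> eps H \<theta>) = 0" for h
  proof -
    have "cr h \<star> cr ?E = 0"
      using ann_gamma[OF f(1) that] by (simp add: E star_sum_right)
    then have "cr (h \<star> ?E) = cr 0" by (simp add: cr_star cr_0)
    then show ?thesis by (simp only: cr_inj)
  qed
  show ?thesis unfolding prim_def using 1 2 3 4 by blast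
qed

end

theorem (in finite_group) prim_eQ_ind:
  assumes "subgroup M G" "subgroup H G" "H \<subseteq> M" "lin_char G H \<theta>" "shoda M H \<theta>"
  shows "prim M H \<theta> (eQ G M (ind G M H \<theta>))"
proof -
  have "card (carrier G) > 0" using fin by (metis card_gt_0_iff empty_iff one_closed)
  then obtain w where "cyclotomic w (card (carrier G))" by (rule ex_cyclotomic)
  then interpret monomial G M H \<theta> w
    by (intro monomial.intro monomial_axioms.intro finite_group_axioms assms)
  show ?thesis by (rule prim_eQ)
qed

section \<open>Crossed products and matrix rings\<close>

text \<open>The rings at hand have carriers inside a function type with pointwise addition, so
  closure of the carrier suffices to pass from \<open>finsum\<close> to the type class sum.\<close>

lemma finsum_eq_sum:
  fixes P :: "('x::comm_monoid_add, 'm) ring_scheme"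
  assumes "(\<oplus>\<^bsub>P\<^esub>) = (+)" "\<zero>\<^bsub>P\<^esub> = 0" "0 \<in> carrier P"
    "\<And>x y. x \<in> carrier P \<Longrightarrow> y \<in> carrier P \<Longrightarrow> x + y \<in> carrier P"
    and I: "finite I" "\<And>i. i \<in> I \<Longrightarrow> h i \<in> carrier P"
  shows "finsum P h I = sum h I"
proof -
  interpret abelian_monoid P
    by (rule abelian_monoidI) (simp_all add: assms(1-4) ac_simps)
  show ?thesis using I
    by (induction I rule: finite_induct) (simp_all add: assms(1,2) Pi_iff)
qed

lemma sum_closed:
  assumes "0 \<in> Y" "\<And>x y. x \<in> Y \<Longrightarrow> y \<in> Y \<Longrightarrow> x + y \<in> Y" "\<And>i. i \<in> I \<Longrightarrow> h i \<in> Y"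
  shows "sum h I \<in> (Y :: 'x::comm_monoid_add set)"
  using assms(3) by (induction I rule: infinite_finite_induct) (auto intro: assms(1,2))

text \<open>\<open>A \<simeq> B\<close> asks for a homomorphism out of \<open>A\<close>, whereas the
  multiplicative law is easier to compute for the explicit map out of the matrix ring
  \<open>B\<close>. Closure of \<open>B\<close> under its operations takes the place of ring
  axioms.\<close>

lemma is_ring_iso_inverseI:
  assumes \<Psi>: "\<And>b. b \<in> carrier B \<Longrightarrow> \<Psi> b \<in> carrier A" and \<Phi>: "\<And>a. a \<in> carrier A \<Longrightarrow> \<Phi> a \<in> carrier B"
    and inv: "\<And>b. b \<in> carrier B \<Longrightarrow> \<Phi> (\<Psi> b) = b" "\<And>a. a \<in> carrier A \<Longrightarrow> \<Psi> (\<Phi> a) = a"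
    and mult: "\<And>b c. b \<in> carrier B \<Longrightarrow> c \<in> carrier B \<Longrightarrow> b \<otimes>\<^bsub>B\<^esub> c \<in> carrier B"
      "\<And>b c. b \<in> carrier B \<Longrightarrow> c \<in> carrier B \<Longrightarrow> \<Psi> (b \<otimes>\<^bsub>B\<^esub> c) = \<Psi> b \<otimes>\<^bsub>A\<^esub> \<Psi> c"
    and add: "\<And>b c. b \<in> carrier B \<Longrightarrow> c \<in> carrier B \<Longrightarrow> b \<oplus>\<^bsub>B\<^esub> c \<in> carrier B"
      "\<And>b c. b \<in> carrier B \<Longrightarrow> c \<in> carrier B \<Longrightarrow> \<Psi> (b \<oplus>\<^bsub>B\<^esub> c) = \<Psi> b \<oplus>\<^bsub>A\<^esub> \<Psi> c"
    and one: "\<one>\<^bsub>B\<^esub> \<in> carrier B" "\<Psi> \<one>\<^bsub>B\<^esub> = \<one>\<^bsub>A\<^esub>"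
  shows "A \<simeq> B"
proof -
  have "\<Phi> \<in> ring_hom A B"
  proof (rule ring_hom_memI)
    fix x y assume x: "x \<in> carrier A" and y: "y \<in> carrier A"
    show "\<Phi> (x \<otimes>\<^bsub>A\<^esub> y) = \<Phi> x \<otimes>\<^bsub>B\<^esub> \<Phi> y"
      using inv(1)[OF mult(1)[OF \<Phi>[OF x] \<Phi>[OF y]]] mult(2)[OF \<Phi>[OF x] \<Phi>[OF y]] by (simp add: inv(2) x y)
    show "\<Phi> (x \<oplus>\<^bsub>A\<^esub> y) = \<Phi> x \<oplus>\<^bsub>B\<^esub> \<Phi> y"
      using inv(1)[OF add(1)[OF \<Phi>[OF x] \<Phi>[OF y]]] add(2)[OF \<Phi>[OF x] \<Phi>[OF y]] by (simp add: inv(2) x y)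
  next
    show "\<Phi> \<one>\<^bsub>A\<^esub> = \<one>\<^bsub>B\<^esub>" using inv(1)[OF one(1)] one(2) by simp
  qed (rule \<Phi>)
  moreover have "bij_betw \<Phi> (carrier A) (carrier B)"
    by (rule bij_betwI[where g=\<Psi>]) (auto simp: \<Phi> \<Psi> inv)
  ultimately show ?thesis by (auto simp: is_ring_iso_def ring_iso_def)
qed

context finite_group
begin

lemma gaQ_mult:
  assumes L: "subgroup L G" and f: "sup_in L f" and g: "sup_in L g"
  shows "f \<otimes>\<^bsub>gaQ G L\<^esub> g = f \<star> g"
proof
  fix x
  show "(f \<otimes>\<^bsub>gaQ G L\<^esub> g) x = (f \<star> g) x"
  proof (cases "x \<in> L")
    case True
    have "(\<Sum>y\<in>L. f y * g (inv y \<otimes> x)) = (\<Sum>y\<in>carrier G. f y * g (inv y \<otimes> x))"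
      using fin subgroup.subset[OF L] sup_inD[OF f] by (intro sum.mono_neutral_left) auto
    then show ?thesis using True subgroup.mem_carrier[OF L True] by (simp add: gaQ_def star_def)
  next
    case False
    then show ?thesis using sup_inD[OF sup_in_star[OF L f g] False] by (simp add: gaQ_def)
  qed
qed

lemma gaQe_simps:
  "f \<otimes>\<^bsub>gaQe G L E\<^esub> g = f \<otimes>\<^bsub>gaQ G L\<^esub> g" "(\<oplus>\<^bsub>gaQe G L E\<^esub>) = (+)" "\<zero>\<^bsub>gaQe G L E\<^esub> = 0" "\<one>\<^bsub>gaQe G L E\<^esub> = E"
  by (simp_all add: gaQe_def gaQ_def fun_eq_iff)

lemma gaQe_carrier:
  assumes L: "subgroup L G" and E: "sup_in L E" "E \<star> E = E"
  shows "carrier (gaQe G L E) = {f. sup_in L f \<and> f \<star> E = f}"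
proof -
  have c: "carrier (gaQ G L) = {f. sup_in L f}" by (simp add: gaQ_def sup_in_def)
  have "carrier (gaQe G L E) = {f \<otimes>\<^bsub>gaQ G L\<^esub> E | f. sup_in L f}" by (simp add: gaQe_def c)
  also have "\<dots> = {f \<star> E | f. sup_in L f}" using gaQ_mult[OF L _ E(1)] by (intro Collect_cong) metis
  also have "\<dots> = {f. sup_in L f \<and> f \<star> E = f}"
    using sup_in_star[OF L _ E(1)] by (auto simp: star_assoc E(2)) metis
  finally show ?thesis .
qed

lemma gaQ_carrier_mult: "f \<otimes>\<^bsub>gaQ G (carrier G)\<^esub> g = f \<star> g"
  by (simp add: gaQ_def star_def)

lemma delta_eq_dl: "delta = dl"
  by (simp add: delta_def dl_def fun_eq_iff)

end

section \<open>The ring isomorphism at one edge of the path\<close>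

locale clifford_iso = clifford +
  fixes EM :: "'a \<Rightarrow> rat" and k :: nat and s :: "nat \<Rightarrow> 'a" and rep :: "'a set \<Rightarrow> 'a"
  assumes EM: "prim M H \<theta> EM"
    and s: "bij_betw (\<lambda>(c, i). c \<otimes> s i) (C \<times> {..<k}) M" "\<And>i. i < k \<Longrightarrow> s i \<in> M"
    and rep: "\<And>q. q \<in> carrier ((G\<lparr>carrier := C\<rparr>) Mod L) \<Longrightarrow> rep q \<in> q"
begin

declare mult_FactGroup [simp del] one_FactGroup [simp del]

abbreviation "Q \<equiv> (G\<lparr>carrier := C\<rparr>) Mod L"
abbreviation "R \<equiv> gaQe G L E"
abbreviation "\<sigma> \<equiv> sigma_node G rep"
abbreviation "\<tau> \<equiv> tau_node G Q rep E"
abbreviation "X1 \<equiv> crossed R Q \<sigma> \<tau>"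
abbreviation "X2 \<equiv> mat_ring k X1"

lemma L_normal: "normal L (G\<lparr>carrier := C\<rparr>)"
proof -
  interpret GC: group "G\<lparr>carrier := C\<rparr>" by (rule subgroup.subgroup_is_group[OF C_subgroup group_axioms])
  have "subgroup L (G\<lparr>carrier := C\<rparr>)" using subgroup_incl[OF L C_subgroup L_C] .
  moreover have "x \<otimes> h \<otimes> inv\<^bsub>G\<lparr>carrier := C\<rparr>\<^esub> x \<in> L" if "x \<in> C" "h \<in> L" for x h
    using C_normalizes[OF that(1)] that(2) m_inv_consistent[OF C_subgroup that(1)] by (simp add: normalizes_def)
  ultimately show ?thesis by (simp add: GC.normal_inv_iff)
qed

lemma Q_group: "group Q" by (rule normal.factorgroup_is_group[OF L_normal])

lemma Q_carrier: "q \<in> carrier Q \<longleftrightarrow> (\<exists>c\<in>C. q = L #> c)"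
  by (simp add: FactGroup_def RCOSETS_def r_coset_def)

lemma Q_one: "\<one>\<^bsub>Q\<^esub> = L" by (simp add: FactGroup_def)

lemma L_Q: "L \<in> carrier Q" using group.is_monoid[OF Q_group] monoid.one_closed Q_one by metis

lemma Q_closed: "p \<in> carrier Q \<Longrightarrow> q \<in> carrier Q \<Longrightarrow> p \<otimes>\<^bsub>Q\<^esub> q \<in> carrier Q"
  by (rule monoid.m_closed[OF group.is_monoid[OF Q_group]])

lemma Q_finite: "finite (carrier Q)"
proof -
  have "carrier Q \<subseteq> (\<lambda>c. L #> c) ` C" by (auto simp: Q_carrier)
  then show ?thesis using finite_sub[OF C_subgroup] finite_surj by blast
qed

lemma Q_sub: "q \<in> carrier Q \<Longrightarrow> q \<subseteq> C"
  using L_C subgroup.m_closed[OF C_subgroup] by (auto simp: Q_carrier r_coset_def)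

lemma rep_C: "q \<in> carrier Q \<Longrightarrow> rep q \<in> C"
  using rep Q_sub by blast

lemma rep_carrier [simp]: "q \<in> carrier Q \<Longrightarrow> rep q \<in> carrier G"
  using rep_C C_carrier by blast

lemma Q_eq: "q \<in> carrier Q \<Longrightarrow> x \<in> q \<Longrightarrow> q = L #> x"
  by (metis Q_carrier C_carrier L repr_independence)

lemma mem_coset_iff: "q \<in> carrier Q \<Longrightarrow> z \<in> carrier G \<Longrightarrow> z \<otimes> inv (rep q) \<in> L \<longleftrightarrow> z \<in> q"
proof -
  assume q: "q \<in> carrier Q" and z: "z \<in> carrier G"
  have r: "rep q \<in> carrier G" using q by simp
  have "z \<in> L #> rep q \<longleftrightarrow> z \<otimes> inv (rep q) \<in> L"
  proof
    assume "z \<in> L #> rep q"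
    then obtain l where l: "l \<in> L" "z = l \<otimes> rep q" by (auto simp: r_coset_def)
    then show "z \<otimes> inv (rep q) \<in> L" using r subgroup.mem_carrier[OF L l(1)] by (simp add: m_assoc)
  next
    assume a: "z \<otimes> inv (rep q) \<in> L"
    have "z = (z \<otimes> inv (rep q)) \<otimes> rep q" using r z by (simp add: m_assoc)
    then show "z \<in> L #> rep q" using a unfolding r_coset_def by blast
  qed
  then show ?thesis using Q_eq[OF q rep[OF q]] by simp
qed

lemma rep_mult:
  assumes "p \<in> carrier Q" "q \<in> carrier Q"
  shows "rep p \<otimes> rep q \<otimes> inv (rep (p \<otimes>\<^bsub>Q\<^esub> q)) \<in> L"
proof -
  have "rep p \<otimes> rep q \<in> p \<otimes>\<^bsub>Q\<^esub> q"
    using rep[OF assms(1)] rep[OF assms(2)] by (auto simp: FactGroup_def set_mult_def)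
  then show ?thesis using mem_coset_iff[OF Q_closed[OF assms]] assms by simp
qed

lemma E_sup: "sup_in L E" by (rule prim_sup[OF E])

lemma R_carrier: "f \<in> carrier R \<longleftrightarrow> sup_in L f \<and> f \<star> E = f"
  by (simp add: gaQe_carrier[OF L E_sup E_idem])

lemma R_mult: "f \<in> carrier R \<Longrightarrow> g \<in> carrier R \<Longrightarrow> f \<otimes>\<^bsub>R\<^esub> g = f \<star> g"
  by (simp add: gaQe_simps R_carrier gaQ_mult[OF L])

lemma R_closed: "f \<in> carrier R \<Longrightarrow> g \<in> carrier R \<Longrightarrow> f \<star> g \<in> carrier R"
  by (simp add: R_carrier sup_in_star[OF L] star_assoc)

lemma R_0: "0 \<in> carrier R"
  by (simp add: R_carrier sup_in_0)

lemma R_add: "f \<in> carrier R \<Longrightarrow> g \<in> carrier R \<Longrightarrow> f + g \<in> carrier R"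
  by (simp add: R_carrier sup_in_add star_add_left)

lemma R_finsum: "finite I \<Longrightarrow> (\<And>i. i \<in> I \<Longrightarrow> h i \<in> carrier R) \<Longrightarrow> finsum R h I = sum h I"
  by (rule finsum_eq_sum) (auto simp: gaQe_simps R_0 R_add)

lemma R_E_left: "f \<in> carrier R \<Longrightarrow> E \<star> f = f"
  using star_commute_sup[OF subgroup.subset[OF L] _ prim_comm[OF E], of f] by (simp add: R_carrier)

lemma sigma_eq: "\<sigma> p b = dl (rep p) \<star> b \<star> dl (inv (rep p))"
  by (simp add: sigma_node_def gaQ_carrier_mult delta_eq_dl)

lemma tau_eq: "\<tau> p q = dl (rep p \<otimes> rep q \<otimes> inv (rep (p \<otimes>\<^bsub>Q\<^esub> q))) \<star> E"
  by (simp add: tau_node_def gaQ_carrier_mult delta_eq_dl)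

text \<open>The representative lies in \<open>C\<close>, which normalizes \<open>L\<close> and
  commutes with \<open>E\<close>.\<close>

lemma sigma_R:
  assumes p: "p \<in> carrier Q" and b: "b \<in> carrier R"
  shows "\<sigma> p b \<in> carrier R"
proof -
  have "inv (rep p) \<in> C" using rep_C[OF p] by (rule subgroup.m_inv_closed[OF C_subgroup])
  then have "dl (rep p) \<star> b \<star> dl (inv (rep p)) \<star> E = dl (rep p) \<star> (b \<star> E) \<star> dl (inv (rep p))"
    using C_comm by (metis star_assoc)
  then show ?thesis
    using b sup_in_conj[OF L C_normalizes[OF rep_C[OF p]], of b] by (simp add: R_carrier sigma_eq)
qed

lemma tau_R: "p \<in> carrier Q \<Longrightarrow> q \<in> carrier Q \<Longrightarrow> \<tau> p q \<in> carrier R"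
  by (simp add: R_carrier tau_eq star_assoc E_idem sup_in_star[OF L _ E_sup] sup_in_dl rep_mult)

lemma X1_carrier: "f \<in> carrier X1 \<longleftrightarrow> (\<forall>q\<in>carrier Q. f q \<in> carrier R) \<and> (\<forall>q. q \<notin> carrier Q \<longrightarrow> f q = 0)"
  by (simp add: crossed_def gaQe_simps)

lemma X1_simps: "(\<oplus>\<^bsub>X1\<^esub>) = (+)" "\<zero>\<^bsub>X1\<^esub> = 0"
  by (simp_all add: crossed_def gaQe_simps fun_eq_iff)

lemma X1_0: "0 \<in> carrier X1"
  by (simp add: X1_carrier R_0)

lemma X1_add: "f \<in> carrier X1 \<Longrightarrow> g \<in> carrier X1 \<Longrightarrow> f + g \<in> carrier X1"
  by (simp add: X1_carrier R_add)

lemma X1_mult: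
  assumes f: "f \<in> carrier X1" and g: "g \<in> carrier X1" and q: "q \<in> carrier Q"
  shows "(f \<otimes>\<^bsub>X1\<^esub> g) q = (\<Sum>pq \<in> {pq \<in> carrier Q \<times> carrier Q. fst pq \<otimes>\<^bsub>Q\<^esub> snd pq = q}.
     f (fst pq) \<star> \<sigma> (fst pq) (g (snd pq)) \<star> \<tau> (fst pq) (snd pq))"
    "(f \<otimes>\<^bsub>X1\<^esub> g) q \<in> carrier R"
proof -
  let ?I = "{pq \<in> carrier Q \<times> carrier Q. fst pq \<otimes>\<^bsub>Q\<^esub> snd pq = q}"
  let ?t = "\<lambda>pq. f (fst pq) \<star> \<sigma> (fst pq) (g (snd pq)) \<star> \<tau> (fst pq) (snd pq)"
    and ?u = "\<lambda>pq. f (fst pq) \<otimes>\<^bsub>R\<^esub> \<sigma> (fst pq) (g (snd pq)) \<otimes>\<^bsub>R\<^esub> \<tau> (fst pq) (snd pq)"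
  have I: "{(p, p'). p \<in> carrier Q \<and> p' \<in> carrier Q \<and> p \<otimes>\<^bsub>Q\<^esub> p' = q} = ?I" by auto
  have fI: "finite ?I" using Q_finite by simp
  have t: "?u pq = ?t pq"
    "?t pq \<in> carrier R" if "pq \<in> ?I" for pq
  proof -
    have "f (fst pq) \<in> carrier R" "\<sigma> (fst pq) (g (snd pq)) \<in> carrier R" "\<tau> (fst pq) (snd pq) \<in> carrier R"
      using that f g sigma_R tau_R by (auto simp: X1_carrier)
    then show "?u pq = ?t pq"
      "?t pq \<in> carrier R"
      by (simp_all add: R_mult R_closed)
  qed
  have "(f \<otimes>\<^bsub>X1\<^esub> g) q = finsum R ?u ?I"
    using q by (simp add: crossed_def I)
  also have "\<dots> = (\<Sum>pq\<in>?I. ?u pq)"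
    using t by (intro R_finsum fI) simp
  also have "\<dots> = (\<Sum>pq\<in>?I. ?t pq)"
    using t(1) by (intro sum.cong refl) blast
  finally show eq: "(f \<otimes>\<^bsub>X1\<^esub> g) q = (\<Sum>pq\<in>?I. ?t pq)" .
  show "(f \<otimes>\<^bsub>X1\<^esub> g) q \<in> carrier R"
    unfolding eq using t(2) by (intro sum_closed R_0 R_add) auto
qed

lemma X1_closed: "f \<in> carrier X1 \<Longrightarrow> g \<in> carrier X1 \<Longrightarrow> f \<otimes>\<^bsub>X1\<^esub> g \<in> carrier X1"
  using X1_mult(2) unfolding X1_carrier[of "f \<otimes>\<^bsub>X1\<^esub> g"] by (auto simp: crossed_def gaQe_simps)

lemma rep_L: "rep L \<in> L" by (rule rep[OF L_Q])

text \<open>The representative of the trivial coset need not be 1, so the unit of the crossed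
  product involves the inverse of \<tau>(L, L), which is \<open>rep L\<close> times
  \<open>E\<close>. As \<open>inv\<close> in \<open>R\<close> is a definite description, uniqueness
  is verified as well.\<close>

lemma R_inv_tau: "inv\<^bsub>R\<^esub> (\<tau> L L) = dl (inv (rep L)) \<star> E"
proof -
  have LL: "L \<otimes>\<^bsub>Q\<^esub> L = L"
    using monoid.l_one[OF group.is_monoid[OF Q_group] L_Q] by (simp add: Q_one)
  have rc: "rep L \<in> carrier G" using L_Q by simp
  then have t: "\<tau> L L = dl (rep L) \<star> E" by (simp add: tau_eq LL m_assoc)
  have tR: "\<tau> L L \<in> carrier R" by (rule tau_R[OF L_Q L_Q])
  have iR: "dl (inv (rep L)) \<star> E \<in> carrier R"
    using rep_L subgroup.m_inv_closed[OF L]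
    by (simp add: R_carrier star_assoc E_idem sup_in_star[OF L _ E_sup] sup_in_dl)
  have e1: "dl (rep L) \<star> E \<star> (dl (inv (rep L)) \<star> E) = E"
  proof -
    have "dl (rep L) \<star> E \<star> (dl (inv (rep L)) \<star> E) = dl (rep L) \<star> (E \<star> dl (inv (rep L))) \<star> E"
      by (simp add: star_assoc)
    also have "\<dots> = dl (rep L) \<star> (dl (inv (rep L)) \<star> E) \<star> E"
      using prim_comm[OF E subgroup.m_inv_closed[OF L rep_L]] by simp
    also have "\<dots> = E"
      using dl_cancel_left[of "inv (rep L)" E] rc sup_E E_idem by simp
    finally show ?thesis .
  qed
  have e2: "dl (inv (rep L)) \<star> E \<star> (dl (rep L) \<star> E) = E"
  proof -
    have "dl (inv (rep L)) \<star> E \<star> (dl (rep L) \<star> E) = dl (inv (rep L)) \<star> (E \<star> dl (rep L)) \<star> E"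
      by (simp add: star_assoc)
    also have "\<dots> = dl (inv (rep L)) \<star> (dl (rep L) \<star> E) \<star> E"
      using prim_comm[OF E rep_L] by simp
    also have "\<dots> = E"
      using dl_cancel_left[OF rc sup_E] E_idem by simp
    finally show ?thesis .
  qed
  show ?thesis
    unfolding m_inv_def[of R]
  proof (rule the_equality, goal_cases)
    case 1

    show ?case
      using iR tR e1 e2 by (simp add: R_mult gaQe_simps(4)) (simp add: t)
  next
    case y: (2 y)
    then have "\<tau> L L \<star> y = E" using tR R_mult[of "\<tau> L L" y] by (simp add: gaQe_simps(4))
    then have "dl (rep L) \<star> E \<star> y = E" by (simp only: t)
    then have "dl (inv (rep L)) \<star> E \<star> (dl (rep L) \<star> E \<star> y) = dl (inv (rep L)) \<star> E \<star> E" by simp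
    then have "E \<star> y = dl (inv (rep L)) \<star> E" using e2 E_idem by (metis star_assoc)
    then show "y = dl (inv (rep L)) \<star> E" using y R_E_left by simp
  qed
qed

lemma X1_one: "\<one>\<^bsub>X1\<^esub> = (\<lambda>q. if q = L then dl (inv (rep L)) \<star> E else 0)"
  by (simp add: crossed_def Q_one[simplified] R_inv_tau gaQe_simps fun_eq_iff)

lemma X1_one_closed: "\<one>\<^bsub>X1\<^esub> \<in> carrier X1"
proof -
  have "dl (inv (rep L)) \<star> E \<in> carrier R"
    using rep_L subgroup.m_inv_closed[OF L]
    by (simp add: R_carrier star_assoc E_idem sup_in_star[OF L _ E_sup] sup_in_dl)
  then show ?thesis using L_Q R_0 by (auto simp: X1_carrier X1_one)
qed

text \<open>Realises the basis element u_q by the group element \<open>rep q\<close>. This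
  identifies the crossed product with \<rat>C E; \<open>coord\<close> is the inverse.\<close>

definition emb :: "('a set \<Rightarrow> 'a \<Rightarrow> rat) \<Rightarrow> 'a \<Rightarrow> rat" where
  "emb f = (\<Sum>q\<in>carrier Q. f q \<star> dl (rep q))"

text \<open>The coefficient at q is the part of y on the coset q, translated into \<open>L\<close>
  by the representative.\<close>

definition coord :: "('a \<Rightarrow> rat) \<Rightarrow> 'a set \<Rightarrow> 'a \<Rightarrow> rat" where
  "coord y = (\<lambda>q. if q \<in> carrier Q then (\<lambda>x. if x \<in> L then y (x \<otimes> rep q) else 0) else 0)"

lemma emb_add: "emb (f + g) = emb f + emb g"
  by (simp add: emb_def star_add_left sum.distrib)

lemma emb_0: "emb 0 = 0"
  by (simp only: emb_def zero_fun_apply star_0_left sum.neutral_const)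

lemma emb_sum: "emb (\<Sum>i\<in>I. f i) = (\<Sum>i\<in>I. emb (f i))"
proof (induction I rule: infinite_finite_induct)
  case (insert x F)
  then show ?case by (simp only: sum.insert emb_add not_False_eq_True if_False)
qed (simp_all only: emb_0 sum.empty sum.infinite not_False_eq_True)

lemma emb_sup:
  assumes f: "f \<in> carrier X1"
  shows "sup_in C (emb f)"
  unfolding emb_def
proof (rule sup_in_sum)
  fix q assume q: "q \<in> carrier Q"
  have "sup_in C (f q)" using f q L_C by (auto simp: X1_carrier R_carrier intro: sup_in_mono)
  then show "sup_in C (f q \<star> dl (rep q))" using rep_C[OF q] by (simp add: sup_in_star[OF C_subgroup] sup_in_dl)
qed

lemma emb_E:
  assumes f: "f \<in> carrier X1"
  shows "emb f \<star> E = emb f"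
proof -
  have "f q \<star> dl (rep q) \<star> E = f q \<star> dl (rep q)" if q: "q \<in> carrier Q" for q
  proof -
    have "f q \<star> dl (rep q) \<star> E = f q \<star> E \<star> dl (rep q)"
      using C_comm[OF rep_C[OF q]] by (metis star_assoc)
    then show ?thesis using f q by (simp add: X1_carrier R_carrier)
  qed
  then show ?thesis by (simp add: emb_def star_sum_left)
qed

lemma C_E_left: "sup_in C y \<Longrightarrow> E \<star> y = y \<star> E"
  using star_commute_sup[OF subgroup.subset[OF C_subgroup] _ C_comm] by simp

text \<open>In each term the inverse of \<open>rep p\<close> from \<sigma> cancels against \<tau>,
  and the representative of the product coset cancels against the one in \<tau>; what remains is (f
  p)(rep p)(g q)(rep q).\<close>

lemma emb_mult:
  assumes f: "f \<in> carrier X1" and g: "g \<in> carrier X1"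
  shows "emb (f \<otimes>\<^bsub>X1\<^esub> g) = emb f \<star> emb g"
proof -
  let ?t = "\<lambda>pq. f (fst pq) \<star> \<sigma> (fst pq) (g (snd pq)) \<star> \<tau> (fst pq) (snd pq)"
  have t: "?t (p, q) \<star> dl (rep (p \<otimes>\<^bsub>Q\<^esub> q)) = (f p \<star> dl (rep p)) \<star> (g q \<star> dl (rep q))"
    if p: "p \<in> carrier Q" and q: "q \<in> carrier Q" for p q
  proof -
    let ?r = "rep p" and ?r' = "rep q" and ?r'' = "rep (p \<otimes>\<^bsub>Q\<^esub> q)"
    have c: "?r \<in> carrier G" "?r' \<in> carrier G" "?r'' \<in> carrier G" using p q Q_closed by simp_all
    have E'': "E \<star> dl ?r'' = dl ?r'' \<star> E" using C_comm[OF rep_C[OF Q_closed[OF p q]]] by simp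
    have E': "dl ?r' \<star> E = E \<star> dl ?r'" using C_comm[OF rep_C[OF q]] .
    have gE: "g q \<star> E = g q" using g q by (simp add: X1_carrier R_carrier)
    have m: "dl (inv ?r) \<star> (dl (?r \<otimes> ?r' \<otimes> inv ?r'') \<star> dl ?r'') = dl ?r'"
      using c by (simp add: dl_mult m_assoc) (simp add: m_assoc[symmetric])
    have "?t (p, q) \<star> dl ?r'' = f p \<star> (dl ?r \<star> (g q \<star> (dl (inv ?r) \<star> (dl (?r \<otimes> ?r' \<otimes> inv ?r'') \<star> (E \<star> dl ?r'')))))"
      by (simp add: sigma_eq tau_eq star_assoc)
    also have "\<dots> = f p \<star> (dl ?r \<star> (g q \<star> (dl (inv ?r) \<star> (dl (?r \<otimes> ?r' \<otimes> inv ?r'') \<star> dl ?r'') \<star> E)))"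
      by (simp add: E'' star_assoc)
    also have "\<dots> = f p \<star> (dl ?r \<star> ((g q \<star> E) \<star> dl ?r'))"
      unfolding m by (simp add: star_assoc E')
    finally show ?thesis by (simp add: gE star_assoc)
  qed
  have "emb (f \<otimes>\<^bsub>X1\<^esub> g) = (\<Sum>q\<in>carrier Q. \<Sum>pq \<in> {pq \<in> carrier Q \<times> carrier Q. fst pq \<otimes>\<^bsub>Q\<^esub> snd pq = q}.
      ?t pq \<star> dl (rep (fst pq \<otimes>\<^bsub>Q\<^esub> snd pq)))"
    unfolding emb_def by (intro sum.cong refl) (simp add: X1_mult[OF f g] star_sum_left)
  also have "\<dots> = (\<Sum>pq \<in> carrier Q \<times> carrier Q. ?t pq \<star> dl (rep (fst pq \<otimes>\<^bsub>Q\<^esub> snd pq)))"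
    using Q_finite Q_closed by (intro sum.group) auto
  also have "\<dots> = (\<Sum>(p, q) \<in> carrier Q \<times> carrier Q. (f p \<star> dl (rep p)) \<star> (g q \<star> dl (rep q)))"
    using t by (intro sum.cong refl) auto
  also have "\<dots> = emb f \<star> emb g"
    by (simp add: emb_def star_sum_left star_sum_right sum.cartesian_product[symmetric]) (rule sum.swap)
  finally show ?thesis .
qed

lemma emb_one: "emb \<one>\<^bsub>X1\<^esub> = E"
proof -
  have "emb \<one>\<^bsub>X1\<^esub> = (\<Sum>q\<in>carrier Q. if q = L then dl (inv (rep L)) \<star> E \<star> dl (rep L) else 0)"
    unfolding emb_def X1_one by (intro sum.cong refl) simp
  also have "\<dots> = dl (inv (rep L)) \<star> E \<star> dl (rep L)" using L_Q Q_finite by simp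
  also have "\<dots> = E"
    using prim_comm[OF E rep_L] dl_cancel_left[of "rep L" E] sup_E L_Q by (simp add: star_assoc)
  finally show ?thesis .
qed

lemma coset_unique:
  assumes "p \<in> carrier Q" "q \<in> carrier Q" "x \<in> p" "x \<in> q"
  shows "p = q"
  using Q_eq assms by metis

lemma emb_apply:
  assumes f: "f \<in> carrier X1" and q: "q \<in> carrier Q" and z: "z \<in> q"
  shows "emb f z = f q (z \<otimes> inv (rep q))"
proof -
  have zc: "z \<in> carrier G" using z Q_sub[OF q] C_carrier by blast
  have "(f p \<star> dl (rep p)) z = (if p = q then f q (z \<otimes> inv (rep q)) else 0)" if p: "p \<in> carrier Q" for p
  proof -
    have "f p (z \<otimes> inv (rep p)) = 0" if "p \<noteq> q"
    proof (rule sup_inD[of L "f p"])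
      show "sup_in L (f p)" using f p by (simp add: X1_carrier R_carrier)
      show "z \<otimes> inv (rep p) \<notin> L" using that mem_coset_iff[OF p zc] coset_unique[OF p q _ z] by blast
    qed
    then show ?thesis using zc p by (simp add: star_dl)
  qed
  then have "emb f z = (\<Sum>p\<in>carrier Q. if p = q then f q (z \<otimes> inv (rep q)) else 0)"
    by (simp add: emb_def sum_fun_apply)
  then show ?thesis using Q_finite q by simp
qed

lemma coord_emb:
  assumes f: "f \<in> carrier X1"
  shows "coord (emb f) = f"
proof (intro ext)
  fix q x
  show "coord (emb f) q x = f q x"
  proof (cases "q \<in> carrier Q")
    case q: True
    show ?thesis
    proof (cases "x \<in> L")
      case True
      have xc: "x \<in> carrier G" using True by (rule subgroup.mem_carrier[OF L])
      have "x \<otimes> rep q \<in> q" using True mem_coset_iff[OF q, of "x \<otimes> rep q"] xc q by (simp add: m_assoc)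
      then show ?thesis using emb_apply[OF f q] True q xc by (simp add: coord_def m_assoc)
    next
      case False
      then have "f q x = 0" using f q sup_inD[of L "f q" x] by (simp add: X1_carrier R_carrier)
      then show ?thesis using False q by (simp add: coord_def)
    qed
  next
    case False
    then show ?thesis using f by (simp add: X1_carrier coord_def)
  qed
qed

lemma coord_X1:
  assumes y: "sup_in C y" "y \<star> E = y"
  shows "coord y \<in> carrier X1"
proof -
  have "coord y q \<in> carrier R" if q: "q \<in> carrier Q" for q
  proof -
    define u where "u = y \<star> dl (inv (rep q))"
    have rc: "rep q \<in> carrier G" using q by simp
    have uE: "u \<star> E = u" unfolding u_def
      using y(2) C_comm[OF subgroup.m_inv_closed[OF C_subgroup rep_C[OF q]]] by (metis star_assoc)
    have cu: "coord y q = (\<lambda>x. if x \<in> L then u x else 0)"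
      using q subgroup.mem_carrier[OF L] rc by (auto simp: coord_def u_def star_dl fun_eq_iff)
    have "((\<lambda>x. if x \<in> L then u x else 0) \<star> E) x = (if x \<in> L then u x else 0)" for x
    proof (cases "x \<in> L")
      case True
      have xc: "x \<in> carrier G" using True by (rule subgroup.mem_carrier[OF L])
      \<comment> \<open>For x in \<open>L\<close> and z outside \<open>L\<close>, inv z x is outside
        \<open>L\<close>, where \<open>E\<close> vanishes. Cutting u off to \<open>L\<close> thus
        does not change the product with \<open>E\<close> at x.\<close>
      have "(if z \<in> L then u z else 0) * E (inv z \<otimes> x) = u z * E (inv z \<otimes> x)" if z: "z \<in> carrier G" for z
      proof (cases "z \<in> L")
        case False
        have "inv z \<otimes> x \<notin> L"
        proof
          assume "inv z \<otimes> x \<in> L"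
          then have "x \<otimes> inv (inv z \<otimes> x) \<in> L" using True by (simp add: subgroup.m_closed[OF L] subgroup.m_inv_closed[OF L])
          then show False using False z xc by (simp add: inv_mult_group m_assoc[symmetric])
        qed
        then show ?thesis using sup_inD[OF E_sup] by simp
      qed simp
      then have "((\<lambda>x. if x \<in> L then u x else 0) \<star> E) x = (u \<star> E) x"
        using xc unfolding star_def by (simp only: if_True) (rule sum.cong[OF refl], blast)
      then show ?thesis using True uE by simp
    next
      case False
      have "sup_in L (\<lambda>x. if x \<in> L then u x else 0)" by (simp add: sup_in_def)
      then show ?thesis using sup_inD[OF sup_in_star[OF L _ E_sup] False] False by simp
    qed
    then show ?thesis unfolding cu by (auto simp: R_carrier sup_in_def)
  qed
  then show ?thesis by (simp add: X1_carrier coord_def)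
qed

lemma emb_coord:
  assumes y: "sup_in C y" "y \<star> E = y"
  shows "emb (coord y) = y"
proof
  fix z
  show "emb (coord y) z = y z"
  proof (cases "z \<in> C")
    case True
    have zc: "z \<in> carrier G" using True by (rule C_carrier)
    define q where "q = L #> z"
    have q: "q \<in> carrier Q" "z \<in> q" using True rcos_self[OF zc L] by (auto simp: q_def Q_carrier)
    have "z \<otimes> inv (rep q) \<in> L" using mem_coset_iff[OF q(1) zc] q(2) by simp
    then show ?thesis
      using emb_apply[OF coord_X1[OF y] q] q(1) zc by (simp add: coord_def m_assoc)
  next
    case False
    then show ?thesis using sup_inD[OF emb_sup[OF coord_X1[OF y]]] sup_inD[OF y(1)] by simp
  qed
qed

section \<open>Matrices over the crossed product\<close>

lemma s_carrier: "i < k \<Longrightarrow> s i \<in> carrier G"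
  using s(2) M_carrier by blast

lemma EM_eq: "EM = (\<Sum>i<k. dl (inv (s i)) \<star> E \<star> dl (s i))"
  by (rule prim_M_eq_sum_reps[OF EM s])

lemma H_M: "H \<subseteq> M" using H(3) L_M by blast

lemma EM_idem: "EM \<star> EM = EM" by (rule prim_idem[OF M EM H_M])

text \<open>For different i and j the element s_i s_j^-1 lies outside \<open>C\<close>, because the
  s_i represent distinct cosets; there the dichotomy gives 0.\<close>

lemma s_orth:
  assumes i: "i < k" and j: "j < k"
  shows "E \<star> dl (s i) \<star> dl (inv (s j)) \<star> E = (if i = j then E else 0)"
proof (cases "i = j")
  case True
  then show ?thesis using s_carrier[OF i] sup_E E_idem by (simp add: star_assoc[of E "dl _"] dl_mult star_dl_one)
next
  case False
  let ?c = "s i \<otimes> inv (s j)"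
  have c: "?c \<in> carrier G" using s_carrier i j by simp
  have "?c \<notin> C"
  proof
    assume cC: "?c \<in> C"
    have "?c \<otimes> s j = \<one> \<otimes> s i" using s_carrier[OF i] s_carrier[OF j] by (simp add: m_assoc)
    then have *: "(\<lambda>(c, i). c \<otimes> s i) (?c, j) = (\<lambda>(c, i). c \<otimes> s i) (\<one>, i)"
      by (simp only: case_prod_conv)
    have "(?c, j) = (\<one>, i)"
      by (rule inj_onD[OF bij_betw_imp_inj_on[OF s(1)] *]) (use cC i j subgroup.one_closed[OF C_subgroup] in auto)
    then show False using False by simp
  qed
  moreover have cM: "?c \<in> M" using s(2) i j by (simp add: subgroup.m_closed[OF M] subgroup.m_inv_closed[OF M])
  ultimately have "E \<star> dl ?c \<star> E = 0" using E_dichotomy[OF cM] by (auto simp: C_def)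
  moreover have "E \<star> dl (s i) \<star> dl (inv (s j)) = E \<star> dl ?c"
    using s_carrier[OF i] s_carrier[OF j] by (simp add: star_assoc dl_mult)
  ultimately show ?thesis using False by simp
qed

text \<open>For g outside \<open>C\<close> the product E g E is zero, so the corner of \<rat>M at
  \<open>E\<close> is supported on \<open>C\<close>.\<close>

lemma compress_sup:
  assumes y: "sup_in M y"
  shows "sup_in C (E \<star> y \<star> E)"
proof -
  have "E \<star> y \<star> E = (\<Sum>g\<in>M. scl (y g) (E \<star> dl g \<star> E))"
    by (simp add: star_eq_sum_right[OF subgroup.subset[OF M] y] star_sum_left star_scl_left)
  moreover have "sup_in C (scl (y g) (E \<star> dl g \<star> E))" if g: "g \<in> M" for g
  proof (cases "g \<in> C")
    case True
    then show ?thesis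
      by (intro sup_in_scl sup_in_star[OF C_subgroup] sup_in_mono[OF E_sup L_C]) (auto simp: sup_in_dl)
  next
    case False
    then have "E \<star> dl g \<star> E = 0" using E_dichotomy[OF g] g by (auto simp: C_def)
    then show ?thesis by (simp add: sup_in_0)
  qed
  ultimately show ?thesis by (simp add: sup_in_sum)
qed

lemma X2_carrier: "U \<in> carrier X2 \<longleftrightarrow>
    (\<forall>i j. (i < k \<and> j < k \<longrightarrow> U i j \<in> carrier X1) \<and> (\<not> (i < k \<and> j < k) \<longrightarrow> U i j = 0))"
  by (simp add: mat_ring_def X1_simps)

lemma X2_in: "U \<in> carrier X2 \<Longrightarrow> i < k \<Longrightarrow> j < k \<Longrightarrow> U i j \<in> carrier X1"
  by (simp add: X2_carrier)

lemma X2_add: "(U \<oplus>\<^bsub>X2\<^esub> V) i j = U i j + V i j"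
  by (simp add: mat_ring_def X1_simps)

lemma X2_mult:
  assumes U: "U \<in> carrier X2" and V: "V \<in> carrier X2" and ij: "i < k" "j < k"
  shows "(U \<otimes>\<^bsub>X2\<^esub> V) i j = (\<Sum>l<k. U i l \<otimes>\<^bsub>X1\<^esub> V l j)"
proof -
  have "U i l \<otimes>\<^bsub>X1\<^esub> V l j \<in> carrier X1" if "l \<in> {..<k}" for l
    using X1_closed[OF X2_in[OF U ij(1)] X2_in[OF V _ ij(2)]] that by simp
  then have "finsum X1 (\<lambda>l. U i l \<otimes>\<^bsub>X1\<^esub> V l j) {..<k} = (\<Sum>l<k. U i l \<otimes>\<^bsub>X1\<^esub> V l j)"
    by (intro finsum_eq_sum X1_simps X1_0 X1_add) auto
  then show ?thesis using ij by (simp add: mat_ring_def)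
qed

lemma X2_mult_closed:
  assumes U: "U \<in> carrier X2" and V: "V \<in> carrier X2"
  shows "U \<otimes>\<^bsub>X2\<^esub> V \<in> carrier X2"
proof -
  have "(U \<otimes>\<^bsub>X2\<^esub> V) i j \<in> carrier X1" if ij: "i < k" "j < k" for i j
    unfolding X2_mult[OF U V ij]
    using X1_closed[OF X2_in[OF U ij(1)] X2_in[OF V _ ij(2)]] by (intro sum_closed X1_0 X1_add) auto
  moreover have "(U \<otimes>\<^bsub>X2\<^esub> V) i j = 0" if "\<not> (i < k \<and> j < k)" for i j
    using that by (auto simp: mat_ring_def X1_simps)
  ultimately show ?thesis unfolding X2_carrier[of "U \<otimes>\<^bsub>X2\<^esub> V"] by blast
qed

text \<open>The conjugates of \<open>E\<close> by the \<open>s i\<close> are orthogonal with sum \<open>EM\<close>, and \<open>E \<rat>M E = \<rat>C E\<close>: \<open>emat\<close>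
  and \<open>cmat\<close> are the Peirce decomposition of \<open>\<rat>M EM\<close>.\<close>
definition emat :: "(nat \<Rightarrow> nat \<Rightarrow> 'a set \<Rightarrow> 'a \<Rightarrow> rat) \<Rightarrow> 'a \<Rightarrow> rat" where
  "emat U = (\<Sum>i<k. \<Sum>j<k. dl (inv (s i)) \<star> emb (U i j) \<star> dl (s j))"

definition cmat :: "('a \<Rightarrow> rat) \<Rightarrow> nat \<Rightarrow> nat \<Rightarrow> 'a set \<Rightarrow> 'a \<Rightarrow> rat" where
  "cmat y = (\<lambda>i j. if i < k \<and> j < k then coord (E \<star> dl (s i) \<star> y \<star> dl (inv (s j)) \<star> E) else 0)"

lemma emb_E_both: "f \<in> carrier X1 \<Longrightarrow> E \<star> emb f \<star> E = emb f"
  by (simp add: emb_E C_E_left[OF emb_sup])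

text \<open>Every entry absorbs \<open>E\<close> on both sides, so a factor \<open>E\<close> can be
  placed on each side of s_l s_{l'}^-1. By \<open>s_orth\<close> only l = l' survives, which leaves
  the matrix product.\<close>

lemma emat_mult:
  assumes U: "U \<in> carrier X2" and V: "V \<in> carrier X2"
  shows "emat (U \<otimes>\<^bsub>X2\<^esub> V) = emat U \<star> emat V"
proof -
  let ?q = "\<lambda>i l l' j. (dl (inv (s i)) \<star> emb (U i l) \<star> dl (s l)) \<star> (dl (inv (s l')) \<star> emb (V l' j) \<star> dl (s j))"
  let ?p = "\<lambda>i l j. dl (inv (s i)) \<star> (emb (U i l) \<star> emb (V l j)) \<star> dl (s j)"
  have t: "?q i l l' j
      = (if l = l' then ?p i l j else 0)"
    if ij: "i < k" "j < k" "l < k" "l' < k" for i j l l'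
  proof -
    have a: "emb (U i l) = emb (U i l) \<star> E" using emb_E[OF X2_in[OF U ij(1,3)]] by simp
    have b: "emb (V l' j) = E \<star> emb (V l' j)"
      using emb_E[OF X2_in[OF V ij(4,2)]] C_E_left[OF emb_sup[OF X2_in[OF V ij(4,2)]]] by simp
    have "?q i l l' j
        = dl (inv (s i)) \<star> emb (U i l) \<star> (E \<star> dl (s l) \<star> dl (inv (s l')) \<star> E) \<star> emb (V l' j) \<star> dl (s j)"
      by (subst a, subst b) (simp add: star_assoc)
    also have "\<dots> = (if l = l' then dl (inv (s i)) \<star> (emb (U i l) \<star> E \<star> emb (V l' j)) \<star> dl (s j) else 0)"
      unfolding s_orth[OF ij(3,4)] by (simp add: star_assoc)
    finally show ?thesis unfolding a[symmetric] by auto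
  qed
  have "emat U \<star> emat V = (\<Sum>i<k. \<Sum>l<k. \<Sum>l'<k. \<Sum>j<k.
      ?q i l l' j)"
    unfolding emat_def by (simp only: star_sum_left) (simp only: star_sum_right)
  also have "\<dots> = (\<Sum>i<k. \<Sum>l<k. \<Sum>l'<k. \<Sum>j<k.
      (if l = l' then ?p i l j else 0))"
    using t by (intro sum.cong refl) auto
  also have "\<dots> = (\<Sum>i<k. \<Sum>l<k. \<Sum>j<k. \<Sum>l'<k.
      (if l = l' then ?p i l j else 0))"
    by (intro sum.cong refl sum.swap)
  also have "\<dots> = (\<Sum>i<k. \<Sum>l<k. \<Sum>j<k. ?p i l j)"
    by (intro sum.cong refl) (simp add: sum.delta)
  also have "\<dots> = (\<Sum>i<k. \<Sum>j<k. \<Sum>l<k. ?p i l j)"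
    by (intro sum.cong refl sum.swap)
  also have "\<dots> = (\<Sum>i<k. \<Sum>j<k. dl (inv (s i)) \<star> emb ((U \<otimes>\<^bsub>X2\<^esub> V) i j) \<star> dl (s j))"
  proof (intro sum.cong refl)
    fix i j assume "i \<in> {..<k}" "j \<in> {..<k}"
    then have ij: "i < k" "j < k" by auto
    have "emb ((U \<otimes>\<^bsub>X2\<^esub> V) i j) = (\<Sum>l<k. emb (U i l) \<star> emb (V l j))"
      unfolding X2_mult[OF U V ij] emb_sum
      using X2_in[OF U ij(1)] X2_in[OF V _ ij(2)] by (intro sum.cong refl emb_mult) auto
    then show "(\<Sum>l<k. ?p i l j)
        = dl (inv (s i)) \<star> emb ((U \<otimes>\<^bsub>X2\<^esub> V) i j) \<star> dl (s j)"
      by (simp only: star_sum_left star_sum_right)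
  qed
  finally show ?thesis by (simp add: emat_def)
qed

lemma emat_add: "emat (U \<oplus>\<^bsub>X2\<^esub> V) = emat U + emat V"
  by (simp only: emat_def X2_add emb_add star_add_left star_add_right sum.distrib)

lemma emat_one: "emat \<one>\<^bsub>X2\<^esub> = EM"
proof -
  have "dl (inv (s i)) \<star> emb (\<one>\<^bsub>X2\<^esub> i j) \<star> dl (s j) = (if i = j then dl (inv (s i)) \<star> E \<star> dl (s i) else 0)"
    if "i < k" "j < k" for i j
    using that by (simp add: mat_ring_def X1_simps emb_one emb_0)
  then have "emat \<one>\<^bsub>X2\<^esub> = (\<Sum>i<k. \<Sum>j<k. if i = j then dl (inv (s i)) \<star> E \<star> dl (s i) else 0)"
    unfolding emat_def by (intro sum.cong refl) auto
  then show ?thesis by (simp add: EM_eq sum.delta)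
qed

lemma X2_one_closed: "\<one>\<^bsub>X2\<^esub> \<in> carrier X2"
  by (simp add: X2_carrier) (simp add: mat_ring_def X1_simps X1_one_closed X1_0)

lemma X2_add_closed: "U \<in> carrier X2 \<Longrightarrow> V \<in> carrier X2 \<Longrightarrow> U \<oplus>\<^bsub>X2\<^esub> V \<in> carrier X2"
  unfolding X2_carrier X2_add using X1_add by simp

lemma EM_sup: "sup_in M EM" by (rule prim_sup[OF EM])

lemma RM_carrier: "y \<in> carrier (gaQe G M EM) \<longleftrightarrow> sup_in M y \<and> y \<star> EM = y"
  by (simp add: gaQe_carrier[OF M EM_sup EM_idem])

lemma emat_carrier:
  assumes U: "U \<in> carrier X2"
  shows "emat U \<in> carrier (gaQe G M EM)"
proof -
  let ?a = "\<lambda>i j. dl (inv (s i)) \<star> emb (U i j) \<star> dl (s j)"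
  have "sup_in M (?a i j)" if "i < k" "j < k" for i j
    using sup_in_mono[OF emb_sup[OF X2_in[OF U that]] C_M] s(2) that
    by (intro sup_in_star[OF M]) (auto simp: sup_in_dl subgroup.m_inv_closed[OF M])
  then have 1: "sup_in M (emat U)" unfolding emat_def by (intro sup_in_sum) auto
  have "emat U = emat U \<star> EM"
  proof -
    have t: "?a i j \<star> (dl (inv (s l)) \<star> E \<star> dl (s l))
        = (if j = l then ?a i j else 0)"
      if ij: "i < k" "j < k" "l < k" for i j l
    proof -
      have a: "emb (U i j) = emb (U i j) \<star> E" using emb_E[OF X2_in[OF U ij(1,2)]] by simp
      have "?a i j \<star> (dl (inv (s l)) \<star> E \<star> dl (s l))
        = dl (inv (s i)) \<star> emb (U i j) \<star> (E \<star> dl (s j) \<star> dl (inv (s l)) \<star> E) \<star> dl (s l)"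
        by (subst a) (simp add: star_assoc)
      also have "\<dots> = (if j = l then dl (inv (s i)) \<star> (emb (U i j) \<star> E) \<star> dl (s j) else 0)"
        unfolding s_orth[OF ij(2,3)] by (simp add: star_assoc)
      finally show ?thesis unfolding a[symmetric] by auto
    qed
    have "emat U \<star> EM = (\<Sum>i<k. \<Sum>j<k. \<Sum>l<k.
        ?a i j \<star> (dl (inv (s l)) \<star> E \<star> dl (s l)))"
      unfolding EM_eq emat_def by (simp only: star_sum_left) (simp only: star_sum_right)
    also have "\<dots> = (\<Sum>i<k. \<Sum>j<k. \<Sum>l<k. if j = l then ?a i j else 0)"
      using t by (intro sum.cong refl) auto
    also have "\<dots> = emat U" unfolding emat_def by (intro sum.cong refl) (simp add: sum.delta)
    finally show ?thesis by simp
  qed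
  then show ?thesis using 1 by (simp add: RM_carrier)
qed

lemma entry_C:
  assumes y: "sup_in M y" and ij: "i < k" "j < k"
  shows "sup_in C (E \<star> dl (s i) \<star> y \<star> dl (inv (s j)) \<star> E)"
    "E \<star> dl (s i) \<star> y \<star> dl (inv (s j)) \<star> E \<star> E = E \<star> dl (s i) \<star> y \<star> dl (inv (s j)) \<star> E"
proof -
  have "sup_in M (dl (s i) \<star> y \<star> dl (inv (s j)))"
    using y s(2) ij by (intro sup_in_star[OF M]) (auto simp: sup_in_dl subgroup.m_inv_closed[OF M])
  from compress_sup[OF this] show "sup_in C (E \<star> dl (s i) \<star> y \<star> dl (inv (s j)) \<star> E)"
    by (simp add: star_assoc)
  show "E \<star> dl (s i) \<star> y \<star> dl (inv (s j)) \<star> E \<star> E = E \<star> dl (s i) \<star> y \<star> dl (inv (s j)) \<star> E"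
    by (simp add: star_assoc E_idem)
qed

lemma cmat_carrier:
  assumes "y \<in> carrier (gaQe G M EM)"
  shows "cmat y \<in> carrier X2"
  using assms coord_X1[OF entry_C] by (simp add: X2_carrier cmat_def RM_carrier)

text \<open>The sum of all components is EM y EM, by \<open>EM_eq\<close>.\<close>

lemma emat_cmat:
  assumes y: "y \<in> carrier (gaQe G M EM)"
  shows "emat (cmat y) = y"
proof -
  have sy: "sup_in M y" "y \<star> EM = y" using y by (auto simp: RM_carrier)
  have "emat (cmat y) = (\<Sum>i<k. \<Sum>j<k. (dl (inv (s i)) \<star> E \<star> dl (s i)) \<star> y \<star> (dl (inv (s j)) \<star> E \<star> dl (s j)))"
    unfolding emat_def
  proof (intro sum.cong refl)
    fix i j assume "i \<in> {..<k}" "j \<in> {..<k}"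
    then have ij: "i < k" "j < k" by auto
    then show "dl (inv (s i)) \<star> emb (cmat y i j) \<star> dl (s j)
        = (dl (inv (s i)) \<star> E \<star> dl (s i)) \<star> y \<star> (dl (inv (s j)) \<star> E \<star> dl (s j))"
      using emb_coord[OF entry_C[OF sy(1) ij]] by (simp add: cmat_def star_assoc)
  qed
  also have "\<dots> = EM \<star> y \<star> EM"
    unfolding EM_eq by (simp only: star_sum_left star_sum_right) (rule sum.swap)
  also have "EM \<star> y = y \<star> EM"
    using star_commute_sup[OF subgroup.subset[OF M] sy(1) prim_comm[OF EM]] by simp
  finally show ?thesis using sy(2) by simp
qed

lemma cmat_emat:
  assumes U: "U \<in> carrier X2"
  shows "cmat (emat U) = U"
proof (intro ext[of "cmat (emat U)"] ext)
  fix i j q x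
  have "cmat (emat U) i j = U i j"
  proof (cases "i < k \<and> j < k")
    case True
    then have ij: "i < k" "j < k" by auto
    have t: "E \<star> dl (s i) \<star> (dl (inv (s i')) \<star> emb (U i' j') \<star> dl (s j')) \<star> dl (inv (s j)) \<star> E
        = (if j' = j then if i' = i then emb (U i j) else 0 else 0)" if ij': "i' < k" "j' < k" for i' j'
    proof -
      have a: "emb (U i' j') = E \<star> emb (U i' j') \<star> E" using emb_E_both[OF X2_in[OF U ij']] by simp
      have "E \<star> dl (s i) \<star> (dl (inv (s i')) \<star> emb (U i' j') \<star> dl (s j')) \<star> dl (inv (s j)) \<star> E
        = (E \<star> dl (s i) \<star> dl (inv (s i')) \<star> E) \<star> emb (U i' j') \<star> (E \<star> dl (s j') \<star> dl (inv (s j)) \<star> E)"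
        by (subst a) (simp add: star_assoc)
      also have "\<dots> = (if j' = j then if i' = i then E \<star> emb (U i' j') \<star> E else 0 else 0)"
        by (simp add: s_orth[OF ij(1) ij'(1)] s_orth[OF ij'(2) ij(2)])
      finally show ?thesis unfolding a[symmetric] by auto
    qed
    have "E \<star> dl (s i) \<star> emat U \<star> dl (inv (s j)) \<star> E
        = (\<Sum>i'<k. \<Sum>j'<k. E \<star> dl (s i) \<star> (dl (inv (s i')) \<star> emb (U i' j') \<star> dl (s j')) \<star> dl (inv (s j)) \<star> E)"
      unfolding emat_def by (simp only: star_sum_left star_sum_right)
    also have "\<dots> = (\<Sum>i'<k. \<Sum>j'<k. if j' = j then if i' = i then emb (U i j) else 0 else 0)"
      using t by (intro sum.cong refl) auto
    also have "\<dots> = emb (U i j)" using ij by (simp add: sum.delta)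
    finally show ?thesis using ij coord_emb[OF X2_in[OF U ij]] by (simp add: cmat_def)
  next
    case False
    then show ?thesis using U by (auto simp: cmat_def X2_carrier)
  qed
  then show "cmat (emat U) i j q x = U i j q x" by simp
qed

theorem matrix_crossed_iso: "gaQe G M EM \<simeq> X2"
proof (rule is_ring_iso_inverseI[where \<Psi>=emat and \<Phi>=cmat])
  fix U V assume AB: "U \<in> carrier X2" "V \<in> carrier X2"
  show "emat (U \<otimes>\<^bsub>X2\<^esub> V) = emat U \<otimes>\<^bsub>gaQe G M EM\<^esub> emat V"
    using AB emat_carrier emat_mult by (simp add: gaQe_simps(1) RM_carrier gaQ_mult[OF M])
  show "emat (U \<oplus>\<^bsub>X2\<^esub> V) = emat U \<oplus>\<^bsub>gaQe G M EM\<^esub> emat V"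
    by (simp only: gaQe_simps(2) emat_add)
qed (simp_all only: emat_carrier cmat_carrier cmat_emat emat_cmat X2_mult_closed X2_add_closed
    X2_one_closed emat_one gaQe_simps(4))

end

section \<open>The leaf\<close>

context finite_group
begin

definition lin_eval :: "'a set \<Rightarrow> ('a \<Rightarrow> complex) \<Rightarrow> ('a \<Rightarrow> rat) \<Rightarrow> complex" where
  "lin_eval H \<theta> f = (\<Sum>h\<in>H. of_rat (f h) * \<theta> h)"

lemma scl_eps_cancel:
  assumes "subgroup H G" "lin_char G H \<theta>" "scl c (eps H \<theta>) = scl d (eps H \<theta>)"
  shows "c = d"
proof -
  have "scl (c - d) (eps H \<theta>) = 0" using assms(3) by (simp add: scl_diff_left)
  then show ?thesis using eps_nz[OF assms(1,2)] by (simp add: scl_eq_0)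
qed

lemma cr_star_eps:
  assumes "subgroup H G" "lin_char G H \<theta>" "sup_in H f"
  shows "cr f \<star> eps H \<theta> = scl (lin_eval H \<theta> f) (eps H \<theta>)"
  using star_eps_eq[OF assms(1,2), of "cr f"] assms(3) sup_in_cr[of H f] by (simp add: lin_eval_def cr_def)

text \<open>\<open>lin_eval\<close> is the eigenvalue of an element of \<rat>H on
  \<open>eps H \<theta>\<close>, so it is multiplicative because the action is associative.\<close>

lemma lin_eval_mult:
  assumes H: "subgroup H G" and l: "lin_char G H \<theta>" and f: "sup_in H f" and g: "sup_in H g"
  shows "lin_eval H \<theta> (f \<star> g) = lin_eval H \<theta> f * lin_eval H \<theta> g"
proof (rule scl_eps_cancel[OF H l])
  have "scl (lin_eval H \<theta> (f \<star> g)) (eps H \<theta>) = cr f \<star> (cr g \<star> eps H \<theta>)"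
    using cr_star_eps[OF H l sup_in_star[OF H f g]] by (simp add: cr_star star_assoc)
  then show "scl (lin_eval H \<theta> (f \<star> g)) (eps H \<theta>) = scl (lin_eval H \<theta> f * lin_eval H \<theta> g) (eps H \<theta>)"
    by (simp add: cr_star_eps[OF H l f] cr_star_eps[OF H l g] star_scl_right scl_scl mult.commute)
qed

lemma lin_eval_add: "lin_eval H \<theta> (f + g) = lin_eval H \<theta> f + lin_eval H \<theta> g"
  by (simp add: lin_eval_def of_rat_add algebra_simps sum.distrib)

lemma lin_eval_diff: "lin_eval H \<theta> (f - g) = lin_eval H \<theta> f - lin_eval H \<theta> g"
  by (simp add: lin_eval_def of_rat_diff algebra_simps sum_subtractf)

lemma lin_eval_scl: "lin_eval H \<theta> (scl c f) = of_rat c * lin_eval H \<theta> f"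
  by (simp add: lin_eval_def scl_def of_rat_mult sum_distrib_left mult.assoc)

lemma lin_eval_dl: "finite H \<Longrightarrow> h \<in> H \<Longrightarrow> lin_eval H \<theta> (dl h) = \<theta> h"
proof -
  assume "finite H" "h \<in> H"
  moreover have "lin_eval H \<theta> (dl h) = (\<Sum>x\<in>H. if x = h then \<theta> h else 0)"
    unfolding lin_eval_def dl_def by (intro sum.cong refl) auto
  ultimately show ?thesis by simp
qed

text \<open>The fibres of \<theta> are cosets of its kernel. This identifies k with the number of
  values of \<theta>.\<close>

lemma card_lin_char_image:
  assumes H: "subgroup H G" and l: "lin_char G H \<theta>"
  shows "card (\<theta> ` H) = card H div card (kerlin H \<theta>)"
proof -
  note mem = subgroup.mem_carrier[OF H] and cl = subgroup.m_closed[OF H] and iv = subgroup.m_inv_closed[OF H]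
  have fH: "finite H" by (rule finite_sub[OF H])
  have fib: "card {h \<in> H. \<theta> h = z} = card (kerlin H \<theta>)" if z: "z \<in> \<theta> ` H" for z
  proof -
    obtain h0 where h0: "h0 \<in> H" "z = \<theta> h0" using z by auto
    have "bij_betw (\<lambda>a. a \<otimes> h0) (kerlin H \<theta>) {h \<in> H. \<theta> h = z}"
    proof (rule bij_betwI[where g="\<lambda>h. h \<otimes> inv h0"])
      show "(\<lambda>a. a \<otimes> h0) \<in> kerlin H \<theta> \<rightarrow> {h \<in> H. \<theta> h = z}"
        using h0 cl lin_char_mult[OF l] by (auto simp: kerlin_def)
      show "(\<lambda>h. h \<otimes> inv h0) \<in> {h \<in> H. \<theta> h = z} \<rightarrow> kerlin H \<theta>"
        using h0 cl iv lin_char_mult[OF l] lin_char_inv[OF H l h0(1)] by (auto simp: kerlin_def mult.commute)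
    qed (use h0 mem in \<open>auto simp: kerlin_def m_assoc\<close>)
    then show ?thesis by (simp add: bij_betw_same_card)
  qed
  have "card H = (\<Sum>z\<in>\<theta> ` H. card {h \<in> H. \<theta> h = z})"
    using sum.image_gen[OF fH, of "\<lambda>_. 1::nat" \<theta>] by simp
  also have "\<dots> = card (\<theta> ` H) * card (kerlin H \<theta>)" using fib by simp
  finally have eq: "card H = card (\<theta> ` H) * card (kerlin H \<theta>)" .
  then have "card (kerlin H \<theta>) > 0" using card_sub_pos[OF H] by (metis mult_0_right gr0I less_irrefl)
  then show ?thesis using eq by simp
qed

text \<open>Multiplication by a value z permutes the k values of \<theta>; comparing the products of
  all values gives z^k = 1. There are at most k such z, so all of them occur.\<close>

lemma lin_char_image_roots:
  assumes H: "subgroup H G" and l: "lin_char G H \<theta>" and k: "k = card H div card (kerlin H \<theta>)"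
    and c: "cyclotomic \<xi> k"
  shows "\<theta> ` H = {z. z ^ k = 1}"
proof -
  interpret cyclotomic \<xi> k by (rule c)
  have fT: "finite (\<theta> ` H)" using finite_sub[OF H] by simp
  have cT: "card (\<theta> ` H) = k" using card_lin_char_image[OF H l] k by simp
  have sub: "\<theta> ` H \<subseteq> {z. z ^ k = 1}"
  proof
    fix z assume "z \<in> \<theta> ` H"
    then obtain h where h: "h \<in> H" "z = \<theta> h" by auto
    have inj: "inj_on ((*) z) (\<theta> ` H)" using lin_char_nz[OF l h(1)] h(2) by (auto simp: inj_on_def)
    have "(*) z ` (\<theta> ` H) \<subseteq> \<theta> ` H"
    proof
      fix u assume "u \<in> (*) z ` (\<theta> ` H)"
      then obtain g where g: "g \<in> H" "u = z * \<theta> g" by auto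
      then have "u = \<theta> (h \<otimes> g)" using h lin_char_mult[OF l] by simp
      then show "u \<in> \<theta> ` H" using subgroup.m_closed[OF H h(1) g(1)] by blast
    qed
    then have "(*) z ` (\<theta> ` H) = \<theta> ` H" by (rule endo_inj_surj[OF fT _ inj])
    then have "(\<Prod>t\<in>\<theta> ` H. t) = (\<Prod>t\<in>(*) z ` (\<theta> ` H). t)" by simp
    also have "\<dots> = z ^ k * (\<Prod>t\<in>\<theta> ` H. t)" by (simp add: prod.reindex[OF inj] prod.distrib cT)
    finally have "(\<Prod>t\<in>\<theta> ` H. t) = z ^ k * (\<Prod>t\<in>\<theta> ` H. t)" .
    moreover have "(\<Prod>t\<in>\<theta> ` H. t) \<noteq> 0" using fT lin_char_nz[OF l] by auto
    ultimately show "z \<in> {z. z ^ k = 1}" by simp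
  qed
  moreover have "card {z::complex. z ^ k = 1} \<le> card (\<theta> ` H)"
    using cT card_roots_unity[of k, where 'a=complex] m by simp
  moreover have "finite {z::complex. z ^ k = 1}" by (simp add: roots_of_unity)
  ultimately show ?thesis by (metis card_seteq)
qed

text \<open>An element of value 0 annihilates \<open>eps H \<theta>\<close>, hence \<open>E\<close>
  by the annihilator clause of \<open>prim\<close>; this gives injectivity. Surjectivity holds
  because \<xi> is a value of \<theta> and \<rat>(\<xi>) consists of polynomials in \<xi>.\<close>

theorem leaf_iso:
  assumes H: "subgroup H G" and l: "lin_char G H \<theta>" and k: "k = card H div card (kerlin H \<theta>)"
    and c: "cyclotomic \<xi> k" and E: "prim H H \<theta> E"
  shows "gaQe G H E \<simeq> Qadj \<xi>"
proof -
  interpret cyclotomic \<xi> k by (rule c)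
  let ?ev = "lin_eval H \<theta>"
  have fH: "finite H" by (rule finite_sub[OF H])
  have roots: "\<theta> ` H = {z. z ^ k = 1}" by (rule lin_char_image_roots[OF H l k c])
  have supE: "sup_in H E" by (rule prim_sup[OF E])
  have EE: "E \<star> E = E" by (rule prim_idem[OF H E order_refl])
  have car: "f \<in> carrier (gaQe G H E) \<longleftrightarrow> sup_in H f \<and> f \<star> E = f" for f
    by (simp add: gaQe_carrier[OF H supE EE])
  have ev_E: "?ev E = 1"
    using cr_star_eps[OF H l supE] prim_eps[OF E] scl_eps_cancel[OF H l, of "?ev E" 1] by simp
  have ev_K: "?ev f \<in> K" for f
  proof -
    have "\<theta> h \<in> K" if "h \<in> H" for h using roots that by (intro root_in_K) auto
    then show ?thesis unfolding lin_eval_def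
      by (intro subfield_sum subfield_mult subfield_of_rat subfield_genfield) auto
  qed
  obtain h1 where h1: "h1 \<in> H" "\<theta> h1 = \<xi>" using roots w by (metis (mono_tags, lifting) imageE mem_Collect_eq)
  have surj: "\<exists>f. sup_in H f \<and> ?ev f = rpoly p \<xi>" for p
  proof (induction p)
    case 0
    have "?ev 0 = rpoly 0 \<xi>" by (simp add: lin_eval_def)
    then show ?case using sup_in_0 by blast
  next
    case (pCons a p)
    then obtain f where f: "sup_in H f" "?ev f = rpoly p \<xi>" by auto
    have 1: "\<one> \<in> H" by (rule subgroup.one_closed[OF H])
    \<comment> \<open>Horner's scheme, with \<open>h1\<close> as the preimage of \<xi>.\<close>
    let ?g = "scl a (dl \<one>) + dl h1 \<star> f"
    have "sup_in H ?g"
      using 1 h1 f by (intro sup_in_add sup_in_scl sup_in_star[OF H]) (auto simp: sup_in_dl)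
    moreover have "?ev ?g = rpoly (pCons a p) \<xi>"
      using h1 f lin_eval_mult[OF H l, of "dl h1" f] lin_char_one[OF H l]
      by (simp add: lin_eval_add lin_eval_scl lin_eval_dl[OF fH] 1 sup_in_dl)
    ultimately show ?case by blast
  qed
  have "?ev \<in> ring_hom (gaQe G H E) (Qadj \<xi>)"
  proof (rule ring_hom_memI)
    fix f g assume fg: "f \<in> carrier (gaQe G H E)" "g \<in> carrier (gaQe G H E)"
    then show "?ev (f \<otimes>\<^bsub>gaQe G H E\<^esub> g) = ?ev f \<otimes>\<^bsub>Qadj \<xi>\<^esub> ?ev g"
      by (simp add: car gaQe_simps gaQ_mult[OF H] lin_eval_mult[OF H l] Qadj_def)
    show "?ev (f \<oplus>\<^bsub>gaQe G H E\<^esub> g) = ?ev f \<oplus>\<^bsub>Qadj \<xi>\<^esub> ?ev g"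
      by (simp add: gaQe_simps lin_eval_add Qadj_def)
  qed (simp_all add: gaQe_simps ev_E Qadj_def ev_K)
  moreover have "bij_betw ?ev (carrier (gaQe G H E)) (carrier (Qadj \<xi>))"
  proof (rule bij_betwI')
    fix f g assume fg: "f \<in> carrier (gaQe G H E)" "g \<in> carrier (gaQe G H E)"
    show "?ev f = ?ev g \<longleftrightarrow> f = g"
    proof
      assume eq: "?ev f = ?ev g"
      have "(f - g) \<star> E = 0"
      proof (rule prim_ann[OF E])
        fix y assume y: "y \<in> H"
        have "sup_in H (f - g)" using fg by (simp add: car sup_in_diff)
        then show "cr (f - g) \<star> (dl y \<star> eps H \<theta>) = 0"
          by (simp add: dl_eps[OF H l y] star_scl_right cr_star_eps[OF H l] lin_eval_diff eq)
      qed
      then show "f = g" using fg by (simp add: star_diff_left car)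
    qed simp
  next
    fix f assume "f \<in> carrier (gaQe G H E)"
    then show "?ev f \<in> carrier (Qadj \<xi>)" by (simp add: Qadj_def ev_K)
  next
    fix z assume "z \<in> carrier (Qadj \<xi>)"
    then obtain p where "z = rpoly p \<xi>" by (auto simp: Qadj_def K_eq)
    then obtain f where f: "sup_in H f" "?ev f = z" using surj by metis
    \<comment> \<open>Multiplication by \<open>E\<close> moves f into the component without changing
      its value, as \<open>E\<close> has value 1.\<close>
    have "f \<star> E \<in> carrier (gaQe G H E)" using f supE by (simp add: car sup_in_star[OF H] star_assoc EE)
    moreover have "z = ?ev (f \<star> E)" using f by (simp add: lin_eval_mult[OF H l _ supE] ev_E)
    ultimately show "\<exists>f\<in>carrier (gaQe G H E). z = ?ev f" by blast
  qed
  ultimately show ?thesis by (auto simp: is_ring_iso_def ring_iso_def)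
qed

section \<open>Paths to leaves\<close>

text \<open>Off \<open>A\<close> both functions vanish, since \<open>A\<close> is normalized by
  \<open>M\<close>; equality on the whole type reduces to \<open>A\<close>.\<close>

lemma conjc_eq_iff:
  assumes M: "subgroup M G" and A: "subgroup A G" and n: "\<And>m a. m \<in> M \<Longrightarrow> a \<in> A \<Longrightarrow> m \<otimes> a \<otimes> inv m \<in> A"
    and l: "lin_char G A \<phi>" and h: "h \<in> M"
  shows "conjc G \<phi> h = \<phi> \<longleftrightarrow> (\<forall>a\<in>A. \<phi> (h \<otimes> a \<otimes> inv h) = \<phi> a)"
proof
  assume c: "conjc G \<phi> h = \<phi>"
  show "\<forall>a\<in>A. \<phi> (h \<otimes> a \<otimes> inv h) = \<phi> a"
  proof
    fix a assume "a \<in> A"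
    then show "\<phi> (h \<otimes> a \<otimes> inv h) = \<phi> a"
      using fun_cong[OF c, of a] subgroup.mem_carrier[OF A] by (simp add: conjc_def)
  qed
next
  assume a: "\<forall>a\<in>A. \<phi> (h \<otimes> a \<otimes> inv h) = \<phi> a"
  show "conjc G \<phi> h = \<phi>"
  proof
    fix x show "conjc G \<phi> h x = \<phi> x"
    proof (cases "x \<in> A")
      case True
      then show ?thesis using a subgroup.mem_carrier[OF A] by (simp add: conjc_def)
    next
      case False
      have hc: "h \<in> carrier G" using h by (rule subgroup.mem_carrier[OF M])
      have "h \<otimes> x \<otimes> inv h \<notin> A" if x: "x \<in> carrier G"
      proof
        assume "h \<otimes> x \<otimes> inv h \<in> A"
        then have "inv h \<otimes> (h \<otimes> x \<otimes> inv h) \<otimes> inv (inv h) \<in> A"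
          by (rule n[OF subgroup.m_inv_closed[OF M h]])
        then show False using False x hc by (simp add: m_assoc) (simp add: m_assoc[symmetric])
      qed
      then show ?thesis using False lin_char_out[OF l] by (simp add: conjc_def)
    qed
  qed
qed

lemma normal_in_subgroup:
  assumes M: "subgroup M G" and A: "normal A (G\<lparr>carrier := M\<rparr>)"
  shows "subgroup A G" "A \<subseteq> M" "\<And>m a. m \<in> M \<Longrightarrow> a \<in> A \<Longrightarrow> m \<otimes> a \<otimes> inv m \<in> A"
proof -
  interpret GM: group "G\<lparr>carrier := M\<rparr>" by (rule subgroup.subgroup_is_group[OF M group_axioms])
  have s: "subgroup A (G\<lparr>carrier := M\<rparr>)" using A by (rule normal_imp_subgroup)
  show "subgroup A G" using incl_subgroup[OF M s] .
  show "A \<subseteq> M" using subgroup.subset[OF s] by simp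
  fix m a assume m: "m \<in> M" and a: "a \<in> A"
  show "m \<otimes> a \<otimes> inv m \<in> A"
    using normal.inv_op_closed2[OF A, of m a] m a m_inv_consistent[OF M m] by simp
qed

end

locale leaf = finite_group +
  fixes N :: "'a set" and Af :: "'a triple \<Rightarrow> 'a set" and Rp :: "'a triple \<Rightarrow> ('a \<Rightarrow> complex) set"
    and vs :: "'a triple list" and H :: "'a set" and \<theta> :: "'a \<Rightarrow> complex"
  assumes Af: "valid_Afun G N Af" and Rp: "valid_Rep G N Af Rp" and path: "leaf_path G N Af Rp vs H \<theta>"
begin

abbreviation "n \<equiv> length vs"
abbreviation "Hs j \<equiv> fst (vs ! j)"
abbreviation "As j \<equiv> fst (snd (vs ! j))"
abbreviation "ts j \<equiv> snd (snd (vs ! j))"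

lemma n_pos: "n > 0" using path by (simp add: leaf_path_def)

lemma NLT_vs: "j < n \<Longrightarrow> NLT G N (vs ! j)"
  using path by (simp add: leaf_path_def)

lemma Hs_subgroup: "j < n \<Longrightarrow> subgroup (Hs j) G"
  using NLT_vs[of j] by (simp add: NLT_def case_prod_beta)

lemma As_lin: "j < n \<Longrightarrow> lin_char G (As j) (ts j)"
  using NLT_vs[of j] by (simp add: NLT_def case_prod_beta)

lemma last_vs: "vs ! (n - Suc 0) = (H, H, \<theta>)"
  using path last_conv_nth[of vs] by (auto simp: leaf_path_def)

lemma step:
  assumes j: "Suc j < n"
  shows "Hs (Suc j) = stab G (Hs j) (ts (Suc j))" "normal (As (Suc j)) (G\<lparr>carrier := Hs j\<rparr>)"
    "\<And>b. b \<in> As j \<Longrightarrow> ts (Suc j) b = ts j b" "As j \<subseteq> As (Suc j)"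
proof -
  obtain M A \<psi> where v: "vs ! j = (M, A, \<psi>)" by (metis prod.exhaust)
  have N: "NLT G N (M, A, \<psi>)" using NLT_vs[of j] j v by simp
  have "vs ! Suc j \<in> Cl G Af Rp (M, A, \<psi>)" using path j v by (auto simp: leaf_path_def)
  then obtain \<phi> where p: "\<phi> \<in> Rp (M, A, \<psi>)" "vs ! Suc j = (stab G M \<phi>, Af (M, A, \<psi>), \<phi>)"
    by (auto simp: Cl_def split: if_splits)
  have "Rp (M, A, \<psi>) \<subseteq> Lin_t G N A (Af (M, A, \<psi>)) \<psi>"
    using Rp[unfolded valid_Rep_def Let_def, rule_format, OF N] by simp
  then have L: "\<phi> \<in> Lin_t G N A (Af (M, A, \<psi>)) \<psi>" using p(1) by blast
  show "Hs (Suc j) = stab G (Hs j) (ts (Suc j))" using v p(2) by simp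
  have "Af (M, A, \<psi>) \<in> A_cands G (M, A, \<psi>)" using Af N by (simp add: valid_Afun_def)
  then show "normal (As (Suc j)) (G\<lparr>carrier := Hs j\<rparr>)" using v p(2) by (simp add: A_cands_def)
  show r: "ts (Suc j) b = ts j b" if "b \<in> As j" for b using L v p(2) that by (simp add: Lin_t_def)
  \<comment> \<open>\<open>Lin_t\<close> prescribes only values. The inclusion is read off from
    supports: the old character is nonzero on its domain, and the new one vanishes outside its
    own.\<close>
  show "As j \<subseteq> As (Suc j)"
  proof
    fix b assume b: "b \<in> As j"
    then have "ts (Suc j) b \<noteq> 0" using r lin_char_nz[OF As_lin[of j]] j by simp
    then show "b \<in> As (Suc j)" using lin_char_out[OF As_lin[OF j]] by blast
  qed
qed

text \<open>Induction backwards from the leaf, where the node is (H, H, \<theta>) itself.\<close>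

lemma As_theta: "j < n \<Longrightarrow> As j \<subseteq> H \<and> (\<forall>a\<in>As j. \<theta> a = ts j a)"
proof -
  assume "j < n"
  then have "j \<le> n - 1" by simp
  then show ?thesis
  proof (induction rule: inc_induct)
    case base
    then show ?case by (simp add: last_vs)
  next
    case (step i)
    then have "Suc i < n" by simp
    note s = leaf.step(3,4)[OF leaf_axioms this]
    show ?case
    proof (intro conjI ballI)
      show "As i \<subseteq> H" using step.IH s(2) by blast
      fix a assume a: "a \<in> As i"
      then have "\<theta> a = ts (Suc i) a" using step.IH s(2) by blast
      then show "\<theta> a = ts i a" using s(1)[OF a] by simp
    qed
  qed
qed

lemma Hs_sub: "j < n \<Longrightarrow> H \<subseteq> Hs j"
proof -
  assume "j < n"
  then have "j \<le> n - 1" by simp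
  then show ?thesis
  proof (induction rule: inc_induct)
    case base
    then show ?case by (simp add: last_vs)
  next
    case (step i)
    then have "Suc i < n" by simp
    have "Hs (Suc i) \<subseteq> Hs i"
      unfolding leaf.step(1)[OF leaf_axioms \<open>Suc i < n\<close>] stab_def by (rule Collect_restrict)
    then show ?case using step.IH by blast
  qed
qed

lemma H_subgroup: "subgroup H G"
  using Hs_subgroup[of "n - 1"] n_pos by (simp add: last_vs)

lemma theta_lin: "lin_char G H \<theta>"
  using As_lin[of "n - 1"] n_pos by (simp add: last_vs)

lemma stab_iff:
  assumes j: "Suc j < n"
  shows "h \<in> Hs (Suc j) \<longleftrightarrow> h \<in> Hs j \<and> (\<forall>a\<in>As (Suc j). ts (Suc j) (h \<otimes> a \<otimes> inv h) = ts (Suc j) a)"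
proof -
  have M: "subgroup (Hs j) G" using j by (simp add: Hs_subgroup)
  note A = normal_in_subgroup[OF M step(2)[OF j]]
  show ?thesis
    unfolding step(1)[OF j] stab_def mem_Collect_eq
    using conjc_eq_iff[OF M A(1,3) As_lin[OF j]] by blast
qed

text \<open>Backwards along the path: an element of H_i outside H_{i+1} does not fix the character
  of A_{i+1}, so conjugation by it changes the value at some a in A_{i+1}. On A_{i+1} the character
  is the restriction of \<theta>, so a is the witness required.\<close>

lemma shoda_Hs: "j < n \<Longrightarrow> shoda (Hs j) H \<theta>"
proof -
  assume "j < n"
  then have "j \<le> n - 1" by simp
  then show ?thesis
  proof (induction rule: inc_induct)
    case base
    then show ?case by (simp add: last_vs shoda_def)
  next
    case (step i)
    then have i: "Suc i < n" by simp
    have M: "subgroup (Hs i) G" using i by (simp add: Hs_subgroup)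
    note A = normal_in_subgroup[OF M leaf.step(2)[OF leaf_axioms i]]
    show ?case unfolding shoda_def
    proof
      fix g assume g: "g \<in> Hs i - H"
      show "\<exists>a\<in>H. g \<otimes> a \<otimes> inv g \<in> H \<and> \<theta> (g \<otimes> a \<otimes> inv g) \<noteq> \<theta> a"
      proof (cases "g \<in> Hs (Suc i)")
        case True
        then show ?thesis using step.IH g by (auto simp: shoda_def)
      next
        case False
        then obtain a where a: "a \<in> As (Suc i)" "ts (Suc i) (g \<otimes> a \<otimes> inv g) \<noteq> ts (Suc i) a"
          using stab_iff[OF i] g by auto
        have "g \<otimes> a \<otimes> inv g \<in> As (Suc i)" using A(3) a(1) g by auto
        then have "g \<otimes> a \<otimes> inv g \<in> H" "\<theta> (g \<otimes> a \<otimes> inv g) = ts (Suc i) (g \<otimes> a \<otimes> inv g)"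
          "a \<in> H" "\<theta> a = ts (Suc i) a"
          using a(1) As_theta[OF i] by blast+
        then show ?thesis using a(2) by (intro bexI[of _ a]) simp_all
      qed
    qed
  qed
qed

lemma prim_node: "j < n \<Longrightarrow> prim (Hs j) H \<theta> (E_node G vs H \<theta> j)"
  unfolding E_node_def by (rule prim_eQ_ind[OF Hs_subgroup H_subgroup Hs_sub theta_lin shoda_Hs])

theorem node_iso:
  assumes j: "Suc j < n" and rep: "\<And>c. c \<in> carrier (Q_node G vs H \<theta> j) \<Longrightarrow> rep c \<in> c"
  shows "gaQe G (Hs j) (E_node G vs H \<theta> j) \<simeq>
            mat_ring (k_node G vs H \<theta> j)
              (crossed (gaQe G (Hs (Suc j)) (E_node G vs H \<theta> (Suc j)))
                 (Q_node G vs H \<theta> j) (sigma_node G rep)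
                 (tau_node G (Q_node G vs H \<theta> j) rep (E_node G vs H \<theta> (Suc j))))"
proof -
  have j': "j < n" using j by simp
  note A = normal_in_subgroup[OF Hs_subgroup[OF j'] step(2)[OF j]]
  \<comment> \<open>The idempotent \<open>\<Phi>\<close> of \<phi> is obtained from the general
    construction with both groups equal to A_{i+1}: induction then does nothing, and Shoda's
    criterion is vacuous.\<close>
  have sA: "shoda (As (Suc j)) (As (Suc j)) (ts (Suc j))" by (simp add: shoda_def)
  interpret clifford G "Hs j" "As (Suc j)" "Hs (Suc j)" H "ts (Suc j)" \<theta> "E_node G vs H \<theta> (Suc j)"
    "eQ G (As (Suc j)) (ind G (As (Suc j)) (As (Suc j)) (ts (Suc j)))"
    using As_theta[OF j]
    by (intro clifford.intro clifford_axioms.intro finite_group_axioms Hs_subgroup[OF j'] A As_lin[OF j]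
        Hs_subgroup[OF j] stab_iff[OF j] H_subgroup Hs_sub[OF j] theta_lin shoda_Hs[OF j'] prim_node[OF j]
        prim_eQ_ind[OF A(1) A(1) order_refl As_lin[OF j] sA]) auto
  have C: "C = C_node G vs H \<theta> j"
    by (simp add: C_def C_node_def cen_def gaQ_carrier_mult delta_eq_dl)
  obtain s where s: "bij_betw (\<lambda>(c, i). c \<otimes> s i) (C \<times> {..<card (Hs j) div card C}) (Hs j)"
    "\<And>i. i < card (Hs j) div card C \<Longrightarrow> s i \<in> Hs j"
    using coset_reps[OF C_subgroup M C_M] by blast
  interpret clifford_iso G "Hs j" "As (Suc j)" "Hs (Suc j)" H "ts (Suc j)" \<theta> "E_node G vs H \<theta> (Suc j)"
    "eQ G (As (Suc j)) (ind G (As (Suc j)) (As (Suc j)) (ts (Suc j)))" "E_node G vs H \<theta> j"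
    "k_node G vs H \<theta> j" s rep
    using s rep
    by (intro clifford_iso.intro clifford_iso_axioms.intro clifford_axioms prim_node[OF j'])
       (simp_all add: k_node_def C Q_node_def)
  show ?thesis using matrix_crossed_iso by (simp add: C Q_node_def)
qed

end

text \<open>The coefficients of each crossed product stay in the group algebra component of H_{i+1},
  where action and twisting are literal conjugation and multiplication. Replacing this component by
  the right side of the next isomorphism, down to the leaf, and transporting action and twisting
  along it yields the nested form.\<close>

theorem theorem5:
  fixes G :: "'g monoid" and N H :: "'g set" and \<theta> :: "'g \<Rightarrow> complex"
    and Af :: "'g triple \<Rightarrow> 'g set" and Rp :: "'g triple \<Rightarrow> ('g \<Rightarrow> complex) set"
    and vs :: "'g triple list" and n k :: nat and \<xi> :: complex
    and rep :: "nat \<Rightarrow> 'g set \<Rightarrow> 'g"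
  assumes "class_C G"
    and "normal N G"
    and "valid_Afun G N Af"
    and "valid_Rep G N Af Rp"
    and "leaf_path G N Af Rp vs H \<theta>"
    and "n = length vs"
    and "k = card H div card (kerlin H \<theta>)"
    and "\<xi> ^ k = 1" and "\<forall>j. 0 < j \<and> j < k \<longrightarrow> \<xi> ^ j \<noteq> 1"
    and "\<forall>j c. Suc j < n \<longrightarrow> c \<in> carrier (Q_node G vs H \<theta> j) \<longrightarrow> rep j c \<in> c"
  shows "gaQe G H (E_node G vs H \<theta> (n - 1)) \<simeq> Qadj \<xi>
     \<and> (\<forall>j. Suc j < n \<longrightarrow>
          gaQe G (fst (vs ! j)) (E_node G vs H \<theta> j) \<simeq>
            mat_ring (k_node G vs H \<theta> j)
              (crossed (gaQe G (fst (vs ! Suc j)) (E_node G vs H \<theta> (Suc j)))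
                 (Q_node G vs H \<theta> j)
                 (sigma_node G (rep j))
                 (tau_node G (Q_node G vs H \<theta> j) (rep j) (E_node G vs H \<theta> (Suc j)))))"
proof -
  interpret leaf G N Af Rp vs H \<theta>
    using assms(1,3-5)
    by (intro leaf.intro leaf_axioms.intro finite_group.intro finite_group_axioms.intro)
       (auto simp: class_C_def)
  \<comment> \<open>k counts the values of \<theta>, so it is positive, which
    \<open>cyclotomic\<close> requires.\<close>
  have "k = card (\<theta> ` H)" using card_lin_char_image[OF H_subgroup theta_lin] assms(7) by simp
  then have "k > 0" using finite_sub[OF H_subgroup] subgroup.one_closed[OF H_subgroup]
    by (metis card_gt_0_iff empty_iff finite_imageI image_is_empty)
  then have c: "cyclotomic \<xi> k" using assms(8,9) by (simp add: cyclotomic_def)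
  have "prim H H \<theta> (E_node G vs H \<theta> (n - 1))"
    using prim_node[of "n - 1"] n_pos assms(6) by (simp add: last_vs)
  then have "gaQe G H (E_node G vs H \<theta> (n - 1)) \<simeq> Qadj \<xi>"
    by (rule leaf_iso[OF H_subgroup theta_lin assms(7) c])
  then show ?thesis using node_iso assms(6,10) by blast
qed

end
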